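(* Let $P$ be a quantum while-program and $\{A\}P^*\{B\}$ a standard proof outline for partial correctness of $P$. If $\langle P,\rho\rangle\to^*\{|\langle P_i,\rho_i\rangle|\}$ (in the transition relation between configuration ensembles), then: (1) for each $i$, either $P_i\equiv\mathit{at}(T_i,P)$ for some subprogram $T_i$ of $P$, or $P_i\equiv\ \downarrow$; and (2) $\mathrm{tr}(A\rho)\le\sum_i\mathrm{tr}(B_i\rho_i)$, where $B_i=B$ if $P_i\equiv\ \downarrow$ and $B_i=\mathit{pre}(T_i)$ if $P_i\equiv\mathit{at}(T_i,P)$.
   Context: Hilbert spaces $\mathcal{H}_q$ (finite-dimensional or separable) for quantum variables $q$; $\mathcal{H}_X=\bigotimes_{q\in X}\mathcal{H}_q$; $\mathcal{D}(\mathcal{H})$ partial density operators; Löwner order $A\sqsubseteq B$ iff $B-A$ positive; quantum predicate: bounded Hermitian $A$ with $0\sqsubseteq A\sqsubseteq I$; operators on subsystems are extended by tensoring with identity. Quantum while-programs: $P::=\mathbf{skip}\mid P_1;P_2\mid q:=|0\rangle\mid\overline q:=U[\overline q]\mid\mathbf{if}\ (\square m\cdot M[\overline q]=m\to P_m)\ \mathbf{fi}\mid\mathbf{while}\ M[\overline q]=1\ \mathbf{do}\ P\ \mathbf{od}$ ($U$ unitary, $M=\{M_m\}$ a measurement, $\sum_mM_m^\dagger M_m=I$; outcomes $\{0,1\}$ in loops). $\mathcal{H}_P$ is the space of the variables of $P$. Configuration ensembles: multisets $\{|\langle P_i,\rho_i\rangle|\}$ of configurations ($P_i$ a program or termination symbol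 $\downarrow$, $\downarrow;Q=Q$) with $\sum_i\mathrm{tr}(\rho_i)\le1$; a singleton is identified with its configuration. Transitions: $\langle\mathbf{skip},\rho\rangle\to\langle\downarrow,\rho\rangle$; $\langle q:=|0\rangle,\rho\rangle\to\langle\downarrow,\sum_i|0\rangle_q\langle i|\rho|i\rangle_q\langle0|\rangle$; $\langle\overline q:=U[\overline q],\rho\rangle\to\langle\downarrow,U\rho U^\dagger\rangle$; if $\langle P_1,\rho\rangle\to\{|\langle P_{1j}',\rho_j'\rangle|\}$ then $\langle P_1;P_2,\rho\rangle\to\{|\langle P_{1j}';P_2,\rho_j'\rangle|\}$; $\langle\mathbf{if}\ (\square m\cdot M[\overline q]=m\to P_m)\ \mathbf{fi},\rho\rangle\to\{|\langle P_m,M_m\rho M_m^\dagger\rangle:m|\}$; $\langle\mathbf{while}\ M[\overline q]=1\ \mathbf{do}\ P\ \mathbf{od},\rho\rangle\to\{|\langle\downarrow,M_0\rho M_0^\dagger\rangle,\langle P;\mathbf{while}\ M[\overline q]=1\ \mathbf{do}\ P\ \mathbf{od},M_1\rho M_1^\dagger\rangle|\}$; (MS1) if $C\to\mathcal{A}$ for a configuration $C$ then $\{|C|\}\to\mathcal{A}$; (MS2) if $\{\mathcal{A}_i\}_{i\in I}$ partitions $\mathcal{A}$, $I=I_0\cup I_1$, $\mathcal{A}_i$ has no transition for $i\in I_0$, $\mathcal{A}_i\to\mathcal{B}_i$ for $i\in I_1$, then $\mathcal{A}\to(\bigcup_{I_0}\mathcal{A}_i)\cup(\bigcup_{I_1}\mathcal{B}_i)$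 (multiset unions). $\to^*$ is the reflexive transitive closure. Proof outlines for partial correctness: formulas $\{A\}P^*\{B\}$, $P^*$ obtained from $P$ by interspersing quantum predicates, formed by: $\{A\}\mathbf{skip}\{A\}$; $\{\sum_i|i\rangle_q\langle0|A|0\rangle_q\langle i|\}q:=|0\rangle\{A\}$; $\{U^\dagger AU\}\overline q:=U[\overline q]\{A\}$; from $\{A\}P_1^*\{B\}$, $\{B\}P_2^*\{C\}$ form $\{A\}P_1^*;\{B\}P_2^*\{C\}$; from $\{A_{m_i}\}P_{m_i}^*\{B\}$ for all outcomes $m_1,\dots,m_k$ of $M$ form $\{\sum_iM_{m_i}^\dagger A_{m_i}M_{m_i}\}\ \mathbf{if}\ M[\overline q]=m_1\to\{A_{m_1}\}P_{m_1}^*\ \square\cdots\square\ M[\overline q]=m_k\to\{A_{m_k}\}P_{m_k}^*\ \mathbf{fi}\ \{B\}$; from $\{B\}P^*\{M_0^\dagger AM_0+M_1^\dagger BM_1\}$ form $\{\mathbf{inv}:M_0^\dagger AM_0+M_1^\dagger BM_1\}\ \mathbf{while}\ M[\overline q]=1\ \mathbf{do}\ \{B\}P^*\{M_0^\dagger AM_0+M_1^\dagger BM_1\}\ \mathbf{od}\ \{A\}$; from $A\sqsubseteq A'$, $\{A'\}P^*\{B'\}$, $B'\sqsubseteq B$ form $\{A\}\{A'\}P^*\{B'\}\{B\}$; from $\{A\}P^*\{B\}$ form $\{A\}P^{**}\{B\}$ where $P^{**}$ deletes some predicates of $P^*$ other than those labelled $\mathbf{inv}$. A proof outline is standard if every subprogram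 (occurrence) $Q$ of $P$ is preceded in $P^*$ by exactly one predicate, denoted $\mathit{pre}(Q)$. For a (fixed occurrence of a) subprogram $T$ of $P$, $\mathit{at}(T,P)$ is defined by: $\mathit{at}(P,P)\equiv P$; if $P\equiv P_1;P_2$: $\mathit{at}(T,P)\equiv\mathit{at}(T,P_1);P_2$ if $T$ is in $P_1$, and $\equiv\mathit{at}(T,P_2)$ if $T$ is in $P_2$; if $P\equiv\mathbf{if}\ (\square m\cdot M[\overline q]=m\to P_m)\ \mathbf{fi}$ and $T$ is in $P_m$: $\mathit{at}(T,P)\equiv\mathit{at}(T,P_m)$; if $P\equiv\mathbf{while}\ M[\overline q]=1\ \mathbf{do}\ P'\ \mathbf{od}$ and $T$ is in $P'$: $\mathit{at}(T,P)\equiv\mathit{at}(T,P');P$. *)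

theory Defs
  imports "HOL-Analysis.Analysis" "HOL-Library.Complex_Order" "HOL-Library.Multiset"
begin

section \<open>The complex Hilbert space of square-summable families\<close>

typedef 'a ell2 = "{f :: 'a \<Rightarrow> complex. (\<lambda>x. (cmod (f x))\<^sup>2) summable_on UNIV}"
  morphisms coord Abs_ell2
  by (rule exI[of _ "\<lambda>_. 0"]) simp

setup_lifting type_definition_ell2

definition cinner :: "'a ell2 \<Rightarrow> 'a ell2 \<Rightarrow> complex" where
  "cinner \<phi> \<psi> = (\<Sum>\<^sub>\<infinity>x. cnj (coord \<phi> x) * coord \<psi> x)"

lemma sq_summable_add:
  fixes f g :: "'a \<Rightarrow> complex"
  assumes "(\<lambda>x. (cmod (f x))\<^sup>2) summable_on UNIV" "(\<lambda>x. (cmod (g x))\<^sup>2) summable_on UNIV"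
  shows "(\<lambda>x. (cmod (f x + g x))\<^sup>2) summable_on UNIV"
proof (rule summable_on_comparison_test)
  show "(\<lambda>x. 2 * (cmod (f x))\<^sup>2 + 2 * (cmod (g x))\<^sup>2) summable_on UNIV"
    using assms by (intro summable_on_add summable_on_cmult_right)
  fix x
  have "(cmod (f x + g x))\<^sup>2 \<le> (cmod (f x) + cmod (g x))\<^sup>2"
    by (simp add: norm_triangle_ineq power_mono)
  also have "\<dots> \<le> 2 * (cmod (f x))\<^sup>2 + 2 * (cmod (g x))\<^sup>2"
    using sum_squares_bound[of "cmod (f x)" "cmod (g x)"]
    by (simp add: power2_sum)
  finally show "(cmod (f x + g x))\<^sup>2 \<le> 2 * (cmod (f x))\<^sup>2 + 2 * (cmod (g x))\<^sup>2" .
qed auto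

lemma sq_summable_cmult:
  fixes f :: "'a \<Rightarrow> complex"
  assumes "(\<lambda>x. (cmod (f x))\<^sup>2) summable_on UNIV"
  shows "(\<lambda>x. (cmod (c * f x))\<^sup>2) summable_on UNIV"
  using summable_on_cmult_right[OF assms, of "(cmod c)\<^sup>2"]
  by (simp add: norm_mult power_mult_distrib)

lemma sq_summable_coord: "(\<lambda>x. (cmod (coord \<psi> x))\<^sup>2) summable_on UNIV"
  using coord[of \<psi>] by simp

lemma cinner_abs_summable:
  "(\<lambda>x. norm (cnj (coord \<phi> x) * coord \<psi> x)) summable_on UNIV"
proof (rule summable_on_comparison_test)
  show "(\<lambda>x. (cmod (coord \<phi> x))\<^sup>2 + (cmod (coord \<psi> x))\<^sup>2) summable_on UNIV"
    by (intro summable_on_add sq_summable_coord)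
  fix x
  show "norm (cnj (coord \<phi> x) * coord \<psi> x) \<le> (cmod (coord \<phi> x))\<^sup>2 + (cmod (coord \<psi> x))\<^sup>2"
    using sum_squares_bound[of "cmod (coord \<phi> x)" "cmod (coord \<psi> x)"]
    using sum_squares_bound[of "cmod (coord \<phi> x)" "cmod (coord \<psi> x)"]
      mult_nonneg_nonneg[OF norm_ge_zero norm_ge_zero, of "coord \<phi> x" "coord \<psi> x"]
    unfolding norm_mult complex_mod_cnj by linarith
qed auto

lemma cinner_summable: "(\<lambda>x. cnj (coord \<phi> x) * coord \<psi> x) summable_on UNIV"
  by (rule abs_summable_summable[OF cinner_abs_summable])

lift_definition scaleC :: "complex \<Rightarrow> 'a ell2 \<Rightarrow> 'a ell2" (infixr "*\<^sub>C" 75)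
  is "\<lambda>c f x. c * f x"
  using sq_summable_cmult by auto

instantiation ell2 :: (type) real_inner
begin

lift_definition zero_ell2 :: "'a ell2" is "\<lambda>_. 0" by simp

lift_definition plus_ell2 :: "'a ell2 \<Rightarrow> 'a ell2 \<Rightarrow> 'a ell2" is "\<lambda>f g x. f x + g x"
  using sq_summable_add by auto

lift_definition uminus_ell2 :: "'a ell2 \<Rightarrow> 'a ell2" is "\<lambda>f x. - f x" by simp

lift_definition minus_ell2 :: "'a ell2 \<Rightarrow> 'a ell2 \<Rightarrow> 'a ell2" is "\<lambda>f g x. f x - g x"
  subgoal for f g using sq_summable_add[of f "\<lambda>x. - g x"] by simp
  done

lift_definition scaleR_ell2 :: "real \<Rightarrow> 'a ell2 \<Rightarrow> 'a ell2" is "\<lambda>r f x. complex_of_real r * f x"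
  using sq_summable_cmult by auto

definition inner_ell2 :: "'a ell2 \<Rightarrow> 'a ell2 \<Rightarrow> real" where
  "inner_ell2 \<phi> \<psi> = Re (cinner \<phi> \<psi>)"

definition norm_ell2 :: "'a ell2 \<Rightarrow> real" where
  "norm_ell2 \<psi> = sqrt (inner \<psi> \<psi>)"

definition sgn_ell2 :: "'a ell2 \<Rightarrow> 'a ell2" where
  "sgn_ell2 \<psi> = inverse (norm \<psi>) *\<^sub>R \<psi>"

definition dist_ell2 :: "'a ell2 \<Rightarrow> 'a ell2 \<Rightarrow> real" where
  "dist_ell2 \<phi> \<psi> = norm (\<phi> - \<psi>)"

definition uniformity_ell2 :: "('a ell2 \<times> 'a ell2) filter" where
  "uniformity_ell2 = (INF e\<in>{0<..}. principal {(\<phi>, \<psi>). dist \<phi> \<psi> < e})"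

definition open_ell2 :: "'a ell2 set \<Rightarrow> bool" where
  "open_ell2 U = (\<forall>\<phi>\<in>U. \<forall>\<^sub>F (\<phi>', \<psi>) in uniformity. \<phi>' = \<phi> \<longrightarrow> \<psi> \<in> U)"

instance
proof
  fix \<phi> \<psi> \<xi> :: "'a ell2" and r s :: real and U :: "'a ell2 set"
  show "\<phi> + \<psi> + \<xi> = \<phi> + (\<psi> + \<xi>)" by transfer (simp add: add.assoc)
  show "\<phi> + \<psi> = \<psi> + \<phi>" by transfer (simp add: add.commute)
  show "0 + \<phi> = \<phi>" by transfer simp
  show "- \<phi> + \<phi> = 0" by transfer simp
  show "\<phi> - \<psi> = \<phi> + - \<psi>" by transfer simp
  show "r *\<^sub>R (\<phi> + \<psi>) = r *\<^sub>R \<phi> + r *\<^sub>R \<psi>" by transfer (simp add: algebra_simps)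
  show "(r + s) *\<^sub>R \<phi> = r *\<^sub>R \<phi> + s *\<^sub>R \<phi>" by transfer (simp add: algebra_simps)
  show "r *\<^sub>R s *\<^sub>R \<phi> = (r * s) *\<^sub>R \<phi>" by transfer (simp add: algebra_simps)
  show "1 *\<^sub>R \<phi> = \<phi>" by transfer simp
  show "sgn \<phi> = inverse (norm \<phi>) *\<^sub>R \<phi>" by (rule sgn_ell2_def)
  show "dist \<phi> \<psi> = norm (\<phi> - \<psi>)" by (rule dist_ell2_def)
  show "uniformity = (INF e\<in>{0<..}. principal {(\<phi>, \<psi> :: 'a ell2). dist \<phi> \<psi> < e})"
    by (rule uniformity_ell2_def)
  show "open U = (\<forall>\<phi>\<in>U. \<forall>\<^sub>F (\<phi>', \<psi>) in uniformity. \<phi>' = \<phi> \<longrightarrow> \<psi> \<in> U)"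
    by (rule open_ell2_def)
  show "norm \<phi> = sqrt (inner \<phi> \<phi>)" by (rule norm_ell2_def)
  have "cinner \<phi> \<psi> = cnj (cinner \<psi> \<phi>)"
  proof -
    have "cnj (coord \<phi> x) * coord \<psi> x = cnj (cnj (coord \<psi> x) * coord \<phi> x)" for x by simp
    then show ?thesis unfolding cinner_def by (simp only: infsum_cnj)
  qed
  then show "inner \<phi> \<psi> = inner \<psi> \<phi>" by (simp add: inner_ell2_def)
  have "cinner (\<phi> + \<psi>) \<xi> = cinner \<phi> \<xi> + cinner \<psi> \<xi>"
    by (simp add: cinner_def plus_ell2.rep_eq distrib_right infsum_add cinner_summable)
  then show "inner (\<phi> + \<psi>) \<xi> = inner \<phi> \<xi> + inner \<psi> \<xi>" by (simp add: inner_ell2_def)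
  have "cinner (r *\<^sub>R \<phi>) \<psi> = r * cinner \<phi> \<psi>"
    by (simp add: cinner_def scaleR_ell2.rep_eq mult.assoc infsum_cmult_right')
  then show "inner (r *\<^sub>R \<phi>) \<psi> = r * inner \<phi> \<psi>" by (simp add: inner_ell2_def)
  have eq: "cinner \<phi> \<phi> = complex_of_real (\<Sum>\<^sub>\<infinity>x. (cmod (coord \<phi> x))\<^sup>2)"
  proof -
    have "cnj (coord \<phi> x) * coord \<phi> x = complex_of_real ((cmod (coord \<phi> x))\<^sup>2)" for x
      by (metis complex_norm_square mult.commute)
    then show ?thesis unfolding cinner_def
      using has_sum_of_real[OF has_sum_infsum[OF sq_summable_coord[of \<phi>]], where 'a = complex]
      by (simp only: infsumI)
  qed
  show "0 \<le> inner \<phi> \<phi>" by (simp add: inner_ell2_def eq infsum_nonneg)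
  show "inner \<phi> \<phi> = 0 \<longleftrightarrow> \<phi> = 0"
  proof
    assume "inner \<phi> \<phi> = 0"
    then have "(\<Sum>\<^sub>\<infinity>x. (cmod (coord \<phi> x))\<^sup>2) = 0" by (simp add: inner_ell2_def eq)
    then have "(cmod (coord \<phi> x))\<^sup>2 = 0" for x
      using nonneg_infsum_le_0D[of "\<lambda>x. (cmod (coord \<phi> x))\<^sup>2" UNIV x] sq_summable_coord[of \<phi>]
      by auto
    then show "\<phi> = 0" by (auto simp: zero_ell2.rep_eq simp flip: coord_inject)
  qed (simp add: inner_ell2_def cinner_def zero_ell2.rep_eq)
qed

end

definition ket :: "'a \<Rightarrow> 'a ell2" where
  "ket x = Abs_ell2 (\<lambda>y. if y = x then 1 else 0)"


section \<open>Operators on the state spaces of quantum variables\<close>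

text \<open>
  The Hilbert space of a variable \<open>q\<close> has the orthonormal basis \<open>{|i> : i \<in> B q}\<close>, with \<open>B q\<close>
  countable and \<open>0 \<in> B q\<close>; its dimension may be finite or infinite and may depend on \<open>q\<close>.
  For a finite set \<open>X\<close> of variables, the tensor product of these spaces over \<open>X\<close> is the
  \<open>\<ell>\<^sup>2\<close>-space over \<open>PiE X B\<close>, embedded as the subspace \<open>hspace B X\<close> of one ambient type.
  An operator on \<open>hspace B X\<close> is a function on the ambient type that vanishes on the orthogonal
  complement and has its range in \<open>hspace B X\<close>, so that equality of operators is equality of
  functions, composition is \<open>\<circ>\<close>, and \<open>idop B X\<close> is the identity operator \<open>I\<close>.
\<close>

type_synonym ('v, 'b) qop = "('v \<Rightarrow> 'b) ell2 \<Rightarrow> ('v \<Rightarrow> 'b) ell2"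

definition hspace :: "('v \<Rightarrow> 'b set) \<Rightarrow> 'v set \<Rightarrow> ('v \<Rightarrow> 'b) ell2 set" where
  "hspace B X = {\<psi>. \<forall>x. x \<notin> PiE X B \<longrightarrow> coord \<psi> x = 0}"

definition idop :: "('v \<Rightarrow> 'b set) \<Rightarrow> 'v set \<Rightarrow> ('v, 'b) qop" where
  "idop B X \<psi> = Abs_ell2 (\<lambda>x. if x \<in> PiE X B then coord \<psi> x else 0)"

definition bops :: "('v \<Rightarrow> 'b set) \<Rightarrow> 'v set \<Rightarrow> ('v, 'b) qop set" where
  "bops B X = {T. bounded_linear T \<and> (\<forall>c \<psi>. T (c *\<^sub>C \<psi>) = c *\<^sub>C T \<psi>) \<and>
                  idop B X \<circ> T \<circ> idop B X = T}"

definition adj :: "('a ell2 \<Rightarrow> 'a ell2) \<Rightarrow> ('a ell2 \<Rightarrow> 'a ell2)" where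
  "adj T = (THE S. \<forall>\<phi> \<psi>. cinner (S \<phi>) \<psi> = cinner \<phi> (T \<psi>))"

text \<open>The order on \<^typ>\<open>complex\<close> is that of \<^theory>\<open>HOL-Library.Complex_Order\<close>: \<open>0 \<le> z\<close> includes
  that \<open>z\<close> is real.\<close>

definition positive_op :: "('a ell2 \<Rightarrow> 'a ell2) \<Rightarrow> bool" where
  "positive_op T \<longleftrightarrow> (\<forall>\<psi>. 0 \<le> cinner \<psi> (T \<psi>))"

definition loewner_le :: "('a ell2 \<Rightarrow> 'a ell2) \<Rightarrow> ('a ell2 \<Rightarrow> 'a ell2) \<Rightarrow> bool" (infix "\<sqsubseteq>\<^sub>L" 50) where
  "S \<sqsubseteq>\<^sub>L T \<longleftrightarrow> positive_op (\<lambda>\<psi>. T \<psi> - S \<psi>)"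

definition tr :: "('v \<Rightarrow> 'b set) \<Rightarrow> 'v set \<Rightarrow> ('v, 'b) qop \<Rightarrow> complex" where
  "tr B X T = (\<Sum>\<^sub>\<infinity>x\<in>PiE X B. cinner (ket x) (T (ket x)))"

text \<open>For a positive operator, summability of the diagonal is the trace-class condition.\<close>

definition partial_density :: "('v \<Rightarrow> 'b set) \<Rightarrow> 'v set \<Rightarrow> ('v, 'b) qop set" where
  "partial_density B X = {\<rho> \<in> bops B X. positive_op \<rho> \<and>
     (\<lambda>x. cinner (ket x) (\<rho> (ket x))) summable_on PiE X B \<and> tr B X \<rho> \<le> 1}"

definition qpred :: "('v \<Rightarrow> 'b set) \<Rightarrow> 'v set \<Rightarrow> ('v, 'b) qop \<Rightarrow> bool" where
  "qpred B X A \<longleftrightarrow> A \<in> bops B X \<and> adj A = A \<and> (\<lambda>_. 0) \<sqsubseteq>\<^sub>L A \<and> A \<sqsubseteq>\<^sub>L idop B X"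

definition tensor :: "('v \<Rightarrow> 'b set) \<Rightarrow> 'v set \<Rightarrow> 'v set \<Rightarrow>
    ('v \<Rightarrow> 'b) ell2 \<Rightarrow> ('v \<Rightarrow> 'b) ell2 \<Rightarrow> ('v \<Rightarrow> 'b) ell2" where
  "tensor B X Y \<phi> \<psi> = Abs_ell2 (\<lambda>z. if z \<in> PiE (X \<union> Y) B
     then coord \<phi> (restrict z X) * coord \<psi> (restrict z Y) else 0)"

text \<open>The cylindrical extension \<open>T \<otimes> I\<close> of an operator \<open>T\<close> on \<open>hspace B X\<close> to \<open>hspace B V\<close>,
  for \<open>X \<subseteq> V\<close>.\<close>

definition ext :: "('v \<Rightarrow> 'b set) \<Rightarrow> 'v set \<Rightarrow> 'v set \<Rightarrow> ('v, 'b) qop \<Rightarrow> ('v, 'b) qop" where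
  "ext B X V T = (THE S. S \<in> bops B V \<and>
     (\<forall>\<phi>\<in>hspace B X. \<forall>\<psi>\<in>hspace B (V - X).
        S (tensor B X (V - X) \<phi> \<psi>) = tensor B X (V - X) (T \<phi>) \<psi>))"

text \<open>\<open>ketbra B V q i j\<close> is \<open>|i>\<^sub>q<j|\<close>, as an operator on \<open>hspace B V\<close>.\<close>

definition ketbra :: "('v \<Rightarrow> 'b set) \<Rightarrow> 'v set \<Rightarrow> 'v \<Rightarrow> 'b \<Rightarrow> 'b \<Rightarrow> ('v, 'b) qop" where
  "ketbra B V q i j = ext B {q} V
     (\<lambda>\<psi>. cinner (ket (\<lambda>_\<in>{q}. j)) \<psi> *\<^sub>C ket (\<lambda>_\<in>{q}. i))"

text \<open>Sums over the possibly infinite basis of a variable converge strongly, that is, pointwise in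
  the norm of \<^typ>\<open>'a ell2\<close>.\<close>

definition init_state :: "('v \<Rightarrow> 'b::zero set) \<Rightarrow> 'v set \<Rightarrow> 'v \<Rightarrow> ('v, 'b) qop \<Rightarrow> ('v, 'b) qop" where
  "init_state B V q \<rho> = (\<lambda>\<psi>. \<Sum>\<^sub>\<infinity>i\<in>B q. (ketbra B V q 0 i \<circ> \<rho> \<circ> ketbra B V q i 0) \<psi>)"

definition init_pre :: "('v \<Rightarrow> 'b::zero set) \<Rightarrow> 'v set \<Rightarrow> 'v \<Rightarrow> ('v, 'b) qop \<Rightarrow> ('v, 'b) qop" where
  "init_pre B V q A = (\<lambda>\<psi>. \<Sum>\<^sub>\<infinity>i\<in>B q. (ketbra B V q i 0 \<circ> A \<circ> ketbra B V q 0 i) \<psi>)"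

text \<open>For \<open>T\<close> an operator on the register \<open>qs\<close>: \<open>T \<rho> T\<^sup>\<dagger>\<close> and \<open>T\<^sup>\<dagger> A T\<close> on \<open>hspace B V\<close>.\<close>

definition apply_op ::
    "('v \<Rightarrow> 'b set) \<Rightarrow> 'v set \<Rightarrow> 'v list \<Rightarrow> ('v, 'b) qop \<Rightarrow> ('v, 'b) qop \<Rightarrow> ('v, 'b) qop" where
  "apply_op B V qs T \<rho> = ext B (set qs) V T \<circ> \<rho> \<circ> adj (ext B (set qs) V T)"

definition pull_op ::
    "('v \<Rightarrow> 'b set) \<Rightarrow> 'v set \<Rightarrow> 'v list \<Rightarrow> ('v, 'b) qop \<Rightarrow> ('v, 'b) qop \<Rightarrow> ('v, 'b) qop" where
  "pull_op B V qs T A = adj (ext B (set qs) V T) \<circ> A \<circ> ext B (set qs) V T"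

definition unitary_on :: "('v \<Rightarrow> 'b set) \<Rightarrow> 'v set \<Rightarrow> ('v, 'b) qop \<Rightarrow> bool" where
  "unitary_on B X U \<longleftrightarrow> U \<in> bops B X \<and> adj U \<circ> U = idop B X \<and> U \<circ> adj U = idop B X"

definition measurement_on :: "('v \<Rightarrow> 'b set) \<Rightarrow> 'v set \<Rightarrow> ('v, 'b) qop list \<Rightarrow> bool" where
  "measurement_on B X Ms \<longleftrightarrow> set Ms \<subseteq> bops B X \<and>
     (\<lambda>\<psi>. \<Sum>M\<leftarrow>Ms. (adj M \<circ> M) \<psi>) = idop B X"


section \<open>Quantum while-programs and their transitions\<close>

text \<open>The outcomes of the measurement of an \<open>If\<close> are the positions in its list of pairs of a
  measurement operator \<open>M\<^sub>m\<close> and a branch \<open>P\<^sub>m\<close>. \<open>While qs M0 M1 P\<close> runs \<open>P\<close> on outcome 1. The type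
  parameter \<open>'o\<close> is instantiated by operators.\<close>

datatype ('v, 'o) prog =
    Skip
  | Seq "('v, 'o) prog" "('v, 'o) prog"
  | Init 'v
  | Unitary "'v list" 'o
  | If "'v list" "('o \<times> ('v, 'o) prog) list"
  | While "'v list" 'o 'o "('v, 'o) prog"

primrec vars :: "('v, 'o) prog \<Rightarrow> 'v set" where
  "vars Skip = {}"
| "vars (Seq P Q) = vars P \<union> vars Q"
| "vars (Init q) = {q}"
| "vars (Unitary qs U) = set qs"
| "vars (If qs bs) = set qs \<union> \<Union> (snd ` set (map (map_prod id vars) bs))"
| "vars (While qs M0 M1 P) = set qs \<union> vars P"

primrec wf_prog :: "('v \<Rightarrow> 'b set) \<Rightarrow> ('v, ('v, 'b) qop) prog \<Rightarrow> bool" where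
  "wf_prog B Skip \<longleftrightarrow> True"
| "wf_prog B (Seq P Q) \<longleftrightarrow> wf_prog B P \<and> wf_prog B Q"
| "wf_prog B (Init q) \<longleftrightarrow> True"
| "wf_prog B (Unitary qs U) \<longleftrightarrow> distinct qs \<and> unitary_on B (set qs) U"
| "wf_prog B (If qs bs) \<longleftrightarrow> distinct qs \<and> measurement_on B (set qs) (map fst bs) \<and>
     list_all snd (map (map_prod id (wf_prog B)) bs)"
| "wf_prog B (While qs M0 M1 P) \<longleftrightarrow> distinct qs \<and> measurement_on B (set qs) [M0, M1] \<and> wf_prog B P"

text \<open>The termination symbol is \<^const>\<open>None\<close>.\<close>

type_synonym ('v, 'b) config = "('v, ('v, 'b) qop) prog option \<times> ('v, 'b) qop"

fun seq_rest :: "('v, 'o) prog option \<Rightarrow> ('v, 'o) prog \<Rightarrow> ('v, 'o) prog option" where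
  "seq_rest None Q = Some Q"
| "seq_rest (Some P) Q = Some (Seq P Q)"

inductive config_step ::
    "('v \<Rightarrow> 'b::zero set) \<Rightarrow> 'v set \<Rightarrow> ('v, 'b) config \<Rightarrow> ('v, 'b) config multiset \<Rightarrow> bool"
  for B V where
  skip: "config_step B V (Some Skip, \<rho>) {#(None, \<rho>)#}"
| init: "config_step B V (Some (Init q), \<rho>) {#(None, init_state B V q \<rho>)#}"
| unitary: "config_step B V (Some (Unitary qs U), \<rho>) {#(None, apply_op B V qs U \<rho>)#}"
| seq: "config_step B V (Some P, \<rho>) \<A> \<Longrightarrow>
     config_step B V (Some (Seq P Q), \<rho>) {#(seq_rest P' Q, \<rho>'). (P', \<rho>') \<in># \<A>#}"
| measure: "config_step B V (Some (If qs bs), \<rho>)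
     (mset (map (\<lambda>(M, P). (Some P, apply_op B V qs M \<rho>)) bs))"
| loop: "config_step B V (Some (While qs M0 M1 P), \<rho>)
     {#(None, apply_op B V qs M0 \<rho>), (Some (Seq P (While qs M0 M1 P)), apply_op B V qs M1 \<rho>)#}"

definition stuck ::
    "('v \<Rightarrow> 'b::zero set) \<Rightarrow> 'v set \<Rightarrow> ('v, 'b) config multiset \<Rightarrow> bool" where
  "stuck B V \<A> \<longleftrightarrow> (\<forall>C\<in>#\<A>. \<nexists>\<B>. config_step B V C \<B>)"

text \<open>
  The premise of the second rule that a part of the partition has no transition cannot refer to
  \<open>ens_step\<close> inside its inductive definition; it is expressed by \<^const>\<open>stuck\<close>, and
  \<open>stuck_iff_no_step\<close> below shows that this is what it means. At least one part has to make a
  transition: otherwise an ensemble without transitions would have a transition (to itself).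
  The bound 1 on the total trace is no side condition, since transitions preserve it.
\<close>

inductive ens_step ::
    "('v \<Rightarrow> 'b::zero set) \<Rightarrow> 'v set \<Rightarrow> ('v, 'b) config multiset \<Rightarrow> ('v, 'b) config multiset \<Rightarrow> bool"
  for B V where
  MS1: "config_step B V C \<A> \<Longrightarrow> ens_step B V {#C#} \<A>"
| MS2: "\<lbrakk>finite I\<^sub>0; finite (I\<^sub>1 :: nat set); I\<^sub>0 \<inter> I\<^sub>1 = {}; I\<^sub>1 \<noteq> {}; \<forall>i\<in>I\<^sub>0 \<union> I\<^sub>1. \<A> i \<noteq> {#};
         \<forall>i\<in>I\<^sub>0. stuck B V (\<A> i); \<forall>i\<in>I\<^sub>1. ens_step B V (\<A> i) (\<B> i)\<rbrakk> \<Longrightarrow>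
       ens_step B V (\<Sum>i\<in>I\<^sub>0 \<union> I\<^sub>1. \<A> i) ((\<Sum>i\<in>I\<^sub>0. \<A> i) + (\<Sum>i\<in>I\<^sub>1. \<B> i))"

lemma ens_step_not_stuck: "ens_step B V \<A> \<B> \<Longrightarrow> \<not> stuck B V \<A>"
proof (induction rule: ens_step.induct)
  case (MS1 C \<A>)
  then show ?case by (auto simp: stuck_def)
next
  case (MS2 I\<^sub>0 I\<^sub>1 \<A> \<B>)
  then obtain i where i: "i \<in> I\<^sub>1" "\<not> stuck B V (\<A> i)" by blast
  then show ?case using MS2.hyps(1,2) by (auto simp: stuck_def set_mset_sum)
qed

lemma stuck_iff_no_step: "stuck B V \<A> \<longleftrightarrow> (\<nexists>\<B>. ens_step B V \<A> \<B>)"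
proof
  assume "\<nexists>\<B>. ens_step B V \<A> \<B>"
  show "stuck B V \<A>"
  proof (rule ccontr)
    assume ns: "\<not> stuck B V \<A>"
    obtain cs where cs: "mset cs = \<A>" using ex_mset by blast
    define I\<^sub>1 where "I\<^sub>1 = {i. i < length cs \<and> (\<exists>\<B>. config_step B V (cs ! i) \<B>)}"
    define I\<^sub>0 where "I\<^sub>0 = {..<length cs} - I\<^sub>1"
    define \<B> where "\<B> i = (SOME \<B>. config_step B V (cs ! i) \<B>)" for i
    have un: "I\<^sub>0 \<union> I\<^sub>1 = {..<length cs}" by (auto simp: I\<^sub>0_def I\<^sub>1_def)
    have "mset xs = (\<Sum>i<length xs. {#xs ! i#})" for xs :: "('a, 'b) config list"
      by (induction xs rule: rev_induct) (simp_all add: nth_append)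
    then have "\<A> = (\<Sum>i<length cs. {#cs ! i#})" using cs by metis
    moreover have "I\<^sub>1 \<noteq> {}" using ns
      by (fastforce simp: stuck_def I\<^sub>1_def in_set_conv_nth simp flip: cs)
    moreover have "\<forall>i\<in>I\<^sub>1. ens_step B V {#cs ! i#} (\<B> i)"
      by (auto simp: I\<^sub>1_def \<B>_def intro: ens_step.MS1 someI)
    moreover have "\<forall>i\<in>I\<^sub>0. stuck B V {#cs ! i#}" by (auto simp: I\<^sub>0_def I\<^sub>1_def stuck_def)
    ultimately have "ens_step B V \<A> ((\<Sum>i\<in>I\<^sub>0. {#cs ! i#}) + (\<Sum>i\<in>I\<^sub>1. \<B> i))"
      using ens_step.MS2[of I\<^sub>0 I\<^sub>1 "\<lambda>i. {#cs ! i#}" B V \<B>] un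
      by (auto simp: I\<^sub>0_def I\<^sub>1_def)
    with \<open>\<nexists>\<B>. ens_step B V \<A> \<B>\<close> show False by blast
  qed
qed (use ens_step_not_stuck in blast)


section \<open>Occurrences of subprograms\<close>

datatype dir = Fst | Snd | Branch nat | Body

text \<open>An occurrence of a subprogram of \<open>P\<close> is a path \<open>p\<close> with \<open>subprog P p \<noteq> None\<close>.\<close>

fun subprog :: "('v, 'o) prog \<Rightarrow> dir list \<Rightarrow> ('v, 'o) prog option" where
  "subprog P [] = Some P"
| "subprog (Seq P Q) (Fst # p) = subprog P p"
| "subprog (Seq P Q) (Snd # p) = subprog Q p"
| "subprog (If qs bs) (Branch m # p) = (if m < length bs then subprog (snd (bs ! m)) p else None)"
| "subprog (While qs M0 M1 P) (Body # p) = subprog P p"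
| "subprog _ _ = None"

text \<open>\<open>at_prog p P\<close> is only meaningful if \<open>p\<close> is an occurrence in \<open>P\<close>.\<close>

fun at_prog :: "dir list \<Rightarrow> ('v, 'o) prog \<Rightarrow> ('v, 'o) prog" where
  "at_prog [] P = P"
| "at_prog (Fst # p) (Seq P Q) = Seq (at_prog p P) Q"
| "at_prog (Snd # p) (Seq P Q) = at_prog p Q"
| "at_prog (Branch m # p) (If qs bs) = at_prog p (snd (bs ! m))"
| "at_prog (Body # p) (While qs M0 M1 P) = Seq (at_prog p P) (While qs M0 M1 P)"
| "at_prog _ _ = undefined"


section \<open>Proof outlines\<close>

datatype 'o annot = Plain (pred_of: 'o) | Inv (pred_of: 'o)

text \<open>Annotated programs: \<open>APre a S\<close> and \<open>APost S a\<close> are \<open>{a} S\<close> and \<open>S {a}\<close>, and \<open>Inv A\<close> is a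
  predicate with the label \<open>inv\<close>.\<close>

datatype ('v, 'o) aprog =
    ASkip
  | ASeq "('v, 'o) aprog" "('v, 'o) aprog"
  | AInit 'v
  | AUnitary "'v list" 'o
  | AIf "'v list" "('o \<times> ('v, 'o) aprog) list"
  | AWhile "'v list" 'o 'o "('v, 'o) aprog"
  | APre "'o annot" "('v, 'o) aprog"
  | APost "('v, 'o) aprog" "'o annot"

primrec strip :: "('v, 'o) aprog \<Rightarrow> ('v, 'o) prog" where
  "strip ASkip = Skip"
| "strip (ASeq S S') = Seq (strip S) (strip S')"
| "strip (AInit q) = Init q"
| "strip (AUnitary qs U) = Unitary qs U"
| "strip (AIf qs bs) = If qs (map (map_prod id strip) bs)"
| "strip (AWhile qs M0 M1 S) = While qs M0 M1 (strip S)"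
| "strip (APre a S) = strip S"
| "strip (APost S a) = strip S"

text \<open>\<open>erase S S'\<close>: \<open>S'\<close> results from \<open>S\<close> by deleting predicates that are not labelled \<open>inv\<close>.\<close>

inductive erase :: "('v, 'o) aprog \<Rightarrow> ('v, 'o) aprog \<Rightarrow> bool" where
  "erase S S"
| "erase S S' \<Longrightarrow> erase (APre (Plain A) S) S'"
| "erase S S' \<Longrightarrow> erase (APost S (Plain A)) S'"
| "erase S S' \<Longrightarrow> erase (APre a S) (APre a S')"
| "erase S S' \<Longrightarrow> erase (APost S a) (APost S' a)"
| "\<lbrakk>erase S\<^sub>1 S\<^sub>1'; erase S\<^sub>2 S\<^sub>2'\<rbrakk> \<Longrightarrow> erase (ASeq S\<^sub>1 S\<^sub>2) (ASeq S\<^sub>1' S\<^sub>2')"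
| "\<lbrakk>map fst bs = map fst bs';
    \<forall>m<length bs. erase (snd (bs ! m)) (snd (bs' ! m))\<rbrakk> \<Longrightarrow> erase (AIf qs bs) (AIf qs bs')"
| "erase S S' \<Longrightarrow> erase (AWhile qs M0 M1 S) (AWhile qs M0 M1 S')"

text \<open>\<open>outline B V a S D\<close> is the formula \<open>{a} S {D}\<close>, where the predicates act on \<open>hspace B V\<close>.\<close>

inductive outline :: "('v \<Rightarrow> 'b::zero set) \<Rightarrow> 'v set \<Rightarrow>
    ('v, 'b) qop annot \<Rightarrow> ('v, ('v, 'b) qop) aprog \<Rightarrow> ('v, 'b) qop \<Rightarrow> bool"
  for B V where
  skip: "qpred B V A \<Longrightarrow> outline B V (Plain A) ASkip A"
| init: "qpred B V A \<Longrightarrow> outline B V (Plain (init_pre B V q A)) (AInit q) A"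
| unitary: "qpred B V A \<Longrightarrow> outline B V (Plain (pull_op B V qs U A)) (AUnitary qs U) A"
| seq: "\<lbrakk>outline B V a S\<^sub>1 (pred_of b); outline B V b S\<^sub>2 C\<rbrakk> \<Longrightarrow>
     outline B V a (ASeq S\<^sub>1 (APre b S\<^sub>2)) C"
| measure: "\<forall>(M, a, S)\<in>set bs. outline B V a S D \<Longrightarrow>
     outline B V (Plain (\<lambda>\<psi>. \<Sum>(M, a, S)\<leftarrow>bs. pull_op B V qs M (pred_of a) \<psi>))
       (AIf qs (map (\<lambda>(M, a, S). (M, APre a S)) bs)) D"
| loop: "\<lbrakk>qpred B V A; outline B V b S C;
     C = (\<lambda>\<psi>. pull_op B V qs M0 A \<psi> + pull_op B V qs M1 (pred_of b) \<psi>)\<rbrakk> \<Longrightarrow>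
     outline B V (Inv C) (AWhile qs M0 M1 (APost (APre b S) (Plain C))) A"
| conseq: "\<lbrakk>qpred B V A; A \<sqsubseteq>\<^sub>L pred_of a'; outline B V a' S D'; D' \<sqsubseteq>\<^sub>L D; qpred B V D\<rbrakk> \<Longrightarrow>
     outline B V (Plain A) (APost (APre a' S) (Plain D')) D"
| delete: "\<lbrakk>outline B V a S D; erase S S'\<rbrakk> \<Longrightarrow> outline B V a S' D"

text \<open>
  \<open>preceding as S p\<close> is the block of consecutive predicates standing immediately before the
  subprogram occurrence \<open>p\<close> in the text of \<open>S\<close>, if the text of \<open>S\<close> is itself preceded by \<open>as\<close>.
  A sequential composition and its first component begin at the same place of the text and
  hence have the same block; predicates followed by one of the delimiters of the syntax (such
  as \<open>;\<close> or \<open>od\<close>) do not precede a subprogram.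
\<close>

fun leading :: "('v, 'o) aprog \<Rightarrow> 'o annot list" where
  "leading (APre a S) = a # leading S"
| "leading (APost S a) = leading S"
| "leading (ASeq S S') = leading S"
| "leading _ = []"

fun preceding :: "'o annot list \<Rightarrow> ('v, 'o) aprog \<Rightarrow> dir list \<Rightarrow> 'o annot list" where
  "preceding as S [] = as @ leading S"
| "preceding as (APre a S) (d # p) = preceding (as @ [a]) S (d # p)"
| "preceding as (APost S a) (d # p) = preceding as S (d # p)"
| "preceding as (ASeq S S') (Fst # p) = preceding as S p"
| "preceding as (ASeq S S') (Snd # p) = preceding [] S' p"
| "preceding as (AIf qs bs) (Branch m # p) = preceding [] (snd (bs ! m)) p"
| "preceding as (AWhile qs M0 M1 S) (Body # p) = preceding [] S p"
| "preceding as _ _ = []"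

definition standard :: "'o annot \<Rightarrow> ('v, 'o) aprog \<Rightarrow> bool" where
  "standard a S \<longleftrightarrow> (\<forall>p. subprog (strip S) p \<noteq> None \<longrightarrow> length (preceding [a] S p) = 1)"

definition pre :: "'o annot \<Rightarrow> ('v, 'o) aprog \<Rightarrow> dir list \<Rightarrow> 'o" where
  "pre a S p = pred_of (hd (preceding [a] S p))"

end

theory Submission
  imports Defs
begin

text \<open>
  A state \<open>\<rho>\<close> is represented as a mixture \<open>\<Sum>\<^sub>k |v\<^sub>k><v\<^sub>k|\<close> with \<open>\<Sum>\<^sub>k \<parallel>v\<^sub>k\<parallel>\<^sup>2 < \<infinity>\<close>; for a
  partial density operator such vectors come from a Cholesky decomposition along a countable basis,
  which needs no spectral theory. Then \<open>tr (A \<rho>) = \<Sum>\<^sub>k <v\<^sub>k|A|v\<^sub>k>\<close>, and the cyclicity of the trace,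
  \<open>tr (T\<^sup>\<dagger> A T \<rho>) = tr (A T \<rho> T\<^sup>\<dagger>)\<close>, is the substitution of \<open>T v\<^sub>k\<close> for \<open>v\<^sub>k\<close>; likewise for
  initialisation, with the vectors \<open>|0><i| v\<^sub>k\<close>.

  In a standard outline the one predicate before a loop has to be its invariant, since invariants
  cannot be deleted. Hence the predicates \<open>pre(T)\<close> are verification conditions for \<open>P\<close>, and each
  transition of a configuration at \<open>T\<close> can only increase the sum of the \<open>tr (B\<^sub>i \<rho>\<^sub>i)\<close>.
\<close>

section \<open>Square-summable families\<close>

text \<open>\<open>adj\<close> and \<open>ext\<close> are definite descriptions,
  \<open>Abs_ell2\<close> is unspecified off the square-summable families, and a divergent
  \<open>infsum\<close> is 0. So each operator of the semantics has first to be exhibited in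
  coordinates, with square summability checked on finite sets of labels: \<open>cyl\<close> for
  \<open>ext\<close>, matrix coefficients for \<open>adj\<close>, \<open>ipre\<close> for
  \<open>init_pre\<close>. Nearly every such check cuts a vector into pieces with disjoint supports
  and adds up their squared norms.

  Deletion is itself a formation rule, applicable anywhere in a derivation, so pre(T) cannot be read
  off the derivation of an outline. The outline is therefore converted twice: to
  \<open>annotated\<close>, which follows the text, and to \<open>verified\<close>, which attaches
  assertions to the paths of the bare program.

  Equal configurations may stand at different occurrences, and the simultaneous steps of the second
  ensemble rule act on whole parts. Hence the invariant of execution (\<open>dominated\<close>)
  quantifies over a multiset of tagged configurations, and an ensemble step is first broken into
  steps of single configurations.\<close>

lemma ell2_eqI: "(\<And>x. coord \<phi> x = coord \<psi> x) \<Longrightarrow> \<phi> = \<psi>"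
  by (metis coord_inject ext)

lemma coord_Abs: "(\<lambda>x. (cmod (f x))\<^sup>2) summable_on UNIV \<Longrightarrow> coord (Abs_ell2 f) = f"
  by (simp add: Abs_ell2_inverse)

lemma sq_summableI:
  assumes "\<And>F. finite F \<Longrightarrow> (\<Sum>x\<in>F. (cmod (f x))\<^sup>2) \<le> C"
  shows "(\<lambda>x. (cmod (f x))\<^sup>2) summable_on UNIV"
  by (rule nonneg_bdd_above_summable_on) (auto intro!: bdd_aboveI[of _ C] assms)

lemma coord_add [simp]: "coord (\<phi> + \<psi>) x = coord \<phi> x + coord \<psi> x"
  by (simp add: plus_ell2.rep_eq)

lemma coord_diff [simp]: "coord (\<phi> - \<psi>) x = coord \<phi> x - coord \<psi> x"
  by (simp add: minus_ell2.rep_eq)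

lemma coord_zero [simp]: "coord 0 x = 0"
  by (simp add: zero_ell2.rep_eq)

lemma coord_scaleC [simp]: "coord (c *\<^sub>C \<psi>) x = c * coord \<psi> x"
  by (simp add: scaleC.rep_eq)

lemma coord_scaleR [simp]: "coord (r *\<^sub>R \<psi>) x = complex_of_real r * coord \<psi> x"
  by (simp add: scaleR_ell2.rep_eq)

lemma coord_sum: "coord (\<Sum>i\<in>F. f i) x = (\<Sum>i\<in>F. coord (f i) x)"
  by (induction F rule: infinite_finite_induct) auto

lemma coord_ket [simp]: "coord (ket x) y = (if y = x then 1 else 0)"
proof -
  have "(\<lambda>y. (cmod (if y = x then 1 else 0 :: complex))\<^sup>2) summable_on UNIV"
    by (rule finite_nonzero_values_imp_summable_on) (auto intro: finite_subset[of _ "{x}"] split: if_splits)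
  then show ?thesis by (simp add: ket_def coord_Abs)
qed

section \<open>Inner product, norm and completeness\<close>

lemma cinner_has_sum: "((\<lambda>x. cnj (coord \<phi> x) * coord \<psi> x) has_sum cinner \<phi> \<psi>) UNIV"
  unfolding cinner_def by (rule has_sum_infsum[OF cinner_summable])

lemma cinner_commute: "cinner \<phi> \<psi> = cnj (cinner \<psi> \<phi>)"
proof -
  have "cnj (coord \<phi> x) * coord \<psi> x = cnj (cnj (coord \<psi> x) * coord \<phi> x)" for x by simp
  then show ?thesis unfolding cinner_def by (simp only: infsum_cnj)
qed

lemma cinner_add_right [simp]: "cinner \<phi> (\<psi> + \<xi>) = cinner \<phi> \<psi> + cinner \<phi> \<xi>"
  by (simp add: cinner_def distrib_left infsum_add cinner_summable)

lemma cinner_diff_right [simp]: "cinner \<phi> (\<psi> - \<xi>) = cinner \<phi> \<psi> - cinner \<phi> \<xi>"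
  using cinner_add_right[of \<phi> "\<psi> - \<xi>" \<xi>] by simp

lemma cinner_scaleC_right [simp]: "cinner \<phi> (c *\<^sub>C \<psi>) = c * cinner \<phi> \<psi>"
  by (simp add: cinner_def mult.left_commute infsum_cmult_right')

lemma cinner_scaleR_right [simp]: "cinner \<phi> (r *\<^sub>R \<psi>) = complex_of_real r * cinner \<phi> \<psi>"
  by (simp add: cinner_def mult.left_commute infsum_cmult_right')

lemma cinner_zero_right [simp]: "cinner \<phi> 0 = 0"
  by (simp add: cinner_def)

lemma cinner_add_left [simp]: "cinner (\<phi> + \<psi>) \<xi> = cinner \<phi> \<xi> + cinner \<psi> \<xi>"
  by (simp add: cinner_commute[of _ \<xi>])

lemma cinner_scaleC_left [simp]: "cinner (c *\<^sub>C \<phi>) \<psi> = cnj c * cinner \<phi> \<psi>"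
  by (simp add: cinner_commute[of _ \<psi>])

lemma cinner_zero_left [simp]: "cinner 0 \<psi> = 0"
  by (simp add: cinner_def)

lemma cinner_self: "cinner \<psi> \<psi> = complex_of_real ((norm \<psi>)\<^sup>2)"
proof -
  have "Im (cinner \<psi> \<psi>) = 0"
    using arg_cong[OF cinner_commute[of \<psi> \<psi>], of Im] by simp
  moreover have "Re (cinner \<psi> \<psi>) = (norm \<psi>)\<^sup>2"
    by (simp add: power2_norm_eq_inner inner_ell2_def)
  ultimately show ?thesis by (simp add: complex_eq_iff)
qed

lemma norm_sq_has_sum: "((\<lambda>x. (cmod (coord \<psi> x))\<^sup>2) has_sum (norm \<psi>)\<^sup>2) UNIV"
proof -
  have "((\<lambda>x. Re (cnj (coord \<psi> x) * coord \<psi> x)) has_sum Re (cinner \<psi> \<psi>)) UNIV"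
    by (rule has_sum_Re[OF cinner_has_sum])
  then show ?thesis by (simp add: cinner_self cmod_power2) (simp add: power2_eq_square)
qed

lemma sum_coord_le_norm: "finite F \<Longrightarrow> (\<Sum>x\<in>F. (cmod (coord \<psi> x))\<^sup>2) \<le> (norm \<psi>)\<^sup>2"
  by (rule finite_sum_le_has_sum[OF norm_sq_has_sum]) auto

lemma norm_sq_leI:
  "(\<And>F. finite F \<Longrightarrow> (\<Sum>x\<in>F. (cmod (coord \<psi> x))\<^sup>2) \<le> C) \<Longrightarrow> (norm \<psi>)\<^sup>2 \<le> C"
  by (rule has_sum_le_finite_sums[OF norm_sq_has_sum])

lemma coord_le_norm: "cmod (coord \<psi> x) \<le> norm \<psi>"
  using sum_coord_le_norm[of "{x}" \<psi>] by (simp add: abs_le_square_iff[symmetric])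

lemma cinner_ket_left [simp]: "cinner (ket x) \<psi> = coord \<psi> x"
proof -
  have "((\<lambda>y. cnj (coord (ket x) y) * coord \<psi> y) has_sum coord \<psi> x) UNIV"
    by (rule has_sum_finite_neutralI[of "{x}"]) auto
  then show ?thesis using cinner_has_sum has_sum_unique by blast
qed

lemma cinner_ket_right [simp]: "cinner \<psi> (ket x) = cnj (coord \<psi> x)"
  by (subst cinner_commute) simp

lemma norm_ket [simp]: "norm (ket x) = 1"
proof -
  have "complex_of_real ((norm (ket x))\<^sup>2) = 1" unfolding cinner_self[symmetric] by simp
  then have "(norm (ket x))\<^sup>2 = 1" using of_real_eq_1_iff by blast
  then show ?thesis using norm_ge_zero[of "ket x"] unfolding power2_eq_1_iff by linarith
qed

lemma norm_scaleC [simp]: "norm (c *\<^sub>C \<psi>) = cmod c * norm \<psi>"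
proof -
  have "complex_of_real ((norm (c *\<^sub>C \<psi>))\<^sup>2) = complex_of_real ((cmod c * norm \<psi>)\<^sup>2)"
    unfolding cinner_self[symmetric] power_mult_distrib of_real_mult complex_norm_square
    by (simp flip: cinner_self)
  then show ?thesis by (metis of_real_eq_iff norm_ge_zero mult_nonneg_nonneg power2_eq_iff_nonneg)
qed

text \<open>Follows from the real Cauchy-Schwarz inequality of the \<open>real_inner\<close>
  instance: multiplying \<open>\<psi>\<close> by the conjugate of
  \<open>cinner \<phi> \<psi>\<close> makes the product real, namely the squared modulus.\<close>

lemma norm_cinner_le: "cmod (cinner \<phi> \<psi>) \<le> norm \<phi> * norm \<psi>"
proof (cases "cinner \<phi> \<psi> = 0")
  case False
  let ?c = "cinner \<phi> \<psi>"
  have "(cmod ?c)\<^sup>2 = inner \<phi> (cnj ?c *\<^sub>C \<psi>)"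
    unfolding cmod_power2 by (simp add: inner_ell2_def power2_eq_square)
  also have "\<dots> \<le> norm \<phi> * (cmod ?c * norm \<psi>)"
    using norm_cauchy_schwarz[of \<phi> "cnj ?c *\<^sub>C \<psi>"] by simp
  finally have "cmod ?c * cmod ?c \<le> cmod ?c * (norm \<phi> * norm \<psi>)"
    by (simp add: power2_eq_square algebra_simps)
  then show ?thesis using False by simp
qed auto

lemma scaleC_add_right: "c *\<^sub>C (\<phi> + \<psi>) = c *\<^sub>C \<phi> + c *\<^sub>C \<psi>"
  by (rule ell2_eqI) (simp add: algebra_simps)

lemma scaleC_add_left: "(c + d) *\<^sub>C \<psi> = c *\<^sub>C \<psi> + d *\<^sub>C \<psi>"
  by (rule ell2_eqI) (simp add: algebra_simps)

lemma scaleC_diff_right: "c *\<^sub>C (\<phi> - \<psi>) = c *\<^sub>C \<phi> - c *\<^sub>C \<psi>"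
  by (rule ell2_eqI) (simp add: algebra_simps)

lemma scaleC_scaleC [simp]: "c *\<^sub>C d *\<^sub>C \<psi> = (c * d) *\<^sub>C \<psi>"
  by (rule ell2_eqI) simp

lemma scaleC_zero_left [simp]: "0 *\<^sub>C \<psi> = 0"
  by (rule ell2_eqI) simp

lemma scaleC_zero_right [simp]: "c *\<^sub>C 0 = 0"
  by (rule ell2_eqI) simp

lemma scaleC_one [simp]: "1 *\<^sub>C \<psi> = \<psi>"
  by (rule ell2_eqI) simp

lemma scaleR_scaleC: "r *\<^sub>R \<psi> = complex_of_real r *\<^sub>C \<psi>"
  by (rule ell2_eqI) simp

lemma bounded_linear_cinner_right: "bounded_linear (cinner \<phi>)"
  by (rule bounded_linear_intro[of _ "norm \<phi>"])
     (auto simp: norm_cinner_le mult.commute[of "norm _" "norm \<phi>"] scaleR_conv_of_real)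

lemma bounded_linear_scaleC: "bounded_linear (\<lambda>\<psi>. c *\<^sub>C \<psi>)"
  by (rule bounded_linear_intro[of _ "cmod c"])
     (auto simp: scaleC_add_right scaleR_scaleC mult.commute)

lemma bounded_linear_coord: "bounded_linear (\<lambda>\<psi>. coord \<psi> x)"
proof -
  have "cinner (ket x) = (\<lambda>\<psi>. coord \<psi> x)" by auto
  then show ?thesis using bounded_linear_cinner_right[of "ket x"] by simp
qed

text \<open>The limit is taken in each coordinate. The Cauchy estimate on a finite set of
  coordinates survives the limit in \<open>m\<close> with a bound independent of the set; this gives
  both square summability of the limit and convergence in norm. Absolutely summable families of
  vectors thereby become summable.\<close>

lemma ell2_complete:
  fixes X :: "nat \<Rightarrow> 'a ell2"
  assumes "Cauchy X"
  shows "convergent X"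
proof -
  have "Cauchy (\<lambda>n. coord (X n) x)" for x
    by (rule bounded_linear.Cauchy[OF bounded_linear_coord assms])
  then have "convergent (\<lambda>n. coord (X n) x)" for x by (simp add: Cauchy_convergent_iff)
  then obtain f where f: "(\<lambda>n. coord (X n) x) \<longlonglongrightarrow> f x" for x
    unfolding convergent_def by metis
  have tail: "(\<Sum>x\<in>F. (cmod (f x - coord (X n) x))\<^sup>2) \<le> e\<^sup>2"
    if F: "finite F" and N: "\<forall>m\<ge>N. \<forall>n\<ge>N. norm (X m - X n) < e" "n \<ge> N" for F e N n
  proof (rule tendsto_upperbound)
    show "(\<lambda>m. \<Sum>x\<in>F. (cmod (coord (X m) x - coord (X n) x))\<^sup>2)
            \<longlonglongrightarrow> (\<Sum>x\<in>F. (cmod (f x - coord (X n) x))\<^sup>2)"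
      by (intro tendsto_intros f)
    have "(\<Sum>x\<in>F. (cmod (coord (X m) x - coord (X n) x))\<^sup>2) \<le> e\<^sup>2" if "m \<ge> N" for m
    proof -
      have "(\<Sum>x\<in>F. (cmod (coord (X m) x - coord (X n) x))\<^sup>2) \<le> (norm (X m - X n))\<^sup>2"
        using sum_coord_le_norm[OF F, of "X m - X n"] by simp
      also have "\<dots> \<le> e\<^sup>2" using N that by (intro power_mono) (auto intro: less_imp_le)
      finally show ?thesis .
    qed
    then show "\<forall>\<^sub>F m in sequentially. (\<Sum>x\<in>F. (cmod (coord (X m) x - coord (X n) x))\<^sup>2) \<le> e\<^sup>2"
      by (auto simp: eventually_sequentially)
  qed auto
  have cau: "\<exists>N. \<forall>m\<ge>N. \<forall>n\<ge>N. norm (X m - X n) < e" if "e > 0" for e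
    using assms that by (simp add: Cauchy_def dist_norm)
  obtain N where N: "\<forall>m\<ge>N. \<forall>n\<ge>N. norm (X m - X n) < 1" using cau[of 1] by auto
  \<comment> \<open>\<open>f\<close> is \<open>f - X N\<close> plus \<open>X N\<close>, and only for
    a square-summable \<open>f\<close> does \<open>Abs_ell2 f\<close> have the coordinates
    \<open>f\<close>.\<close>
  have "(\<lambda>x. (cmod (f x - coord (X N) x))\<^sup>2) summable_on UNIV"
    by (rule sq_summableI) (rule tail[OF _ N order_refl])
  then have "(\<lambda>x. (cmod (f x))\<^sup>2) summable_on UNIV"
    using sq_summable_add[OF _ sq_summable_coord[of "X N"]] by fastforce
  then have L: "coord (Abs_ell2 f) = f" by (rule coord_Abs)
  have "X \<longlonglongrightarrow> Abs_ell2 f"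
    unfolding LIMSEQ_def
  proof (intro allI impI)
    fix r :: real assume "r > 0"
    then obtain N where N: "\<forall>m\<ge>N. \<forall>n\<ge>N. norm (X m - X n) < r / 2" using cau[of "r / 2"] by auto
    have "dist (X n) (Abs_ell2 f) < r" if "n \<ge> N" for n
    proof -
      have "(norm (Abs_ell2 f - X n))\<^sup>2 \<le> (r / 2)\<^sup>2"
        by (rule norm_sq_leI) (simp add: L tail[OF _ N that])
      then have "norm (Abs_ell2 f - X n) \<le> r / 2" using \<open>r > 0\<close> by (simp add: abs_le_square_iff[symmetric])
      then show ?thesis using \<open>r > 0\<close> by (simp add: dist_norm norm_minus_commute)
    qed
    then show "\<exists>no. \<forall>n\<ge>no. dist (X n) (Abs_ell2 f) < r" by blast
  qed
  then show ?thesis by (auto simp: convergent_def)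
qed

instance ell2 :: (type) banach
  by standard (rule ell2_complete)

section \<open>Restriction to sets of basis labels, and expansions of vectors\<close>

definition restr :: "'a set \<Rightarrow> 'a ell2 \<Rightarrow> 'a ell2" where
  "restr S \<psi> = Abs_ell2 (\<lambda>x. if x \<in> S then coord \<psi> x else 0)"

lemma coord_restr [simp]: "coord (restr S \<psi>) x = (if x \<in> S then coord \<psi> x else 0)"
proof -
  have "(\<lambda>x. (cmod (if x \<in> S then coord \<psi> x else 0))\<^sup>2) summable_on UNIV"
    by (rule summable_on_comparison_test[OF sq_summable_coord[of \<psi>]]) auto
  then show ?thesis by (simp add: restr_def coord_Abs)
qed

lemma norm_restr_le: "norm (restr S \<psi>) \<le> norm \<psi>"
proof -
  have "(norm (restr S \<psi>))\<^sup>2 \<le> (norm \<psi>)\<^sup>2"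
  proof (rule norm_sq_leI)
    fix F :: "'a set" assume "finite F"
    have "(\<Sum>x\<in>F. (cmod (coord (restr S \<psi>) x))\<^sup>2) \<le> (\<Sum>x\<in>F. (cmod (coord \<psi> x))\<^sup>2)"
      by (rule sum_mono) auto
    also have "\<dots> \<le> (norm \<psi>)\<^sup>2" by (rule sum_coord_le_norm) fact
    finally show "(\<Sum>x\<in>F. (cmod (coord (restr S \<psi>) x))\<^sup>2) \<le> (norm \<psi>)\<^sup>2" .
  qed
  then show ?thesis by (simp add: abs_le_square_iff[symmetric])
qed

lemma cinner_restr: "cinner (restr S \<phi>) \<psi> = cinner \<phi> (restr S \<psi>)"
  by (auto simp: cinner_def intro!: infsum_cong)

text \<open>With \<open>c\<close> the identity this yields the basis expansion, with
  \<open>c z = z q\<close> the convergence of the sum in \<open>init_pre\<close>. What is left after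
  the fibres in \<open>F\<close> is supported outside any set \<open>G\<close> whose image under
  \<open>c\<close> lies in \<open>F\<close>, and beyond a large finite \<open>G\<close> little of
  the norm remains.\<close>

lemma has_sum_restr_fibres:
  fixes c :: "'a \<Rightarrow> 'i"
  shows "((\<lambda>i. restr {z. c z = i} \<psi>) has_sum \<psi>) UNIV"
  unfolding has_sum_def tendsto_iff eventually_finite_subsets_at_top
proof (intro allI impI)
  fix e :: real assume "e > 0"
  then have "(e/2)\<^sup>2 > 0" by simp
  from norm_sq_has_sum[of \<psi>, unfolded has_sum_def tendsto_iff eventually_finite_subsets_at_top, rule_format, OF this]
  obtain G where G: "finite G"
    "\<And>Y. finite Y \<Longrightarrow> G \<subseteq> Y \<Longrightarrow> dist (\<Sum>x\<in>Y. (cmod (coord \<psi> x))\<^sup>2) ((norm \<psi>)\<^sup>2) < (e/2)\<^sup>2"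
    by auto
  have "dist (\<Sum>i\<in>F. restr {z. c z = i} \<psi>) \<psi> < e" if F: "finite F" "c ` G \<subseteq> F" for F
  proof -
    have eq: "\<psi> - (\<Sum>i\<in>F. restr {z. c z = i} \<psi>) = restr {z. c z \<notin> F} \<psi>"
      by (rule ell2_eqI) (simp add: coord_sum F(1))
    have "(norm (restr {z. c z \<notin> F} \<psi>))\<^sup>2 \<le> (e/2)\<^sup>2"
    proof (rule norm_sq_leI)
      fix H :: "'a set" assume H: "finite H"
      \<comment> \<open>No label of \<open>G\<close> contributes to the remainder, since
        \<open>c\<close> maps \<open>G\<close> into \<open>F\<close>.\<close>
      have "(\<Sum>x\<in>H. (cmod (coord (restr {z. c z \<notin> F} \<psi>) x))\<^sup>2) =
          (\<Sum>x\<in>H - G. (cmod (coord (restr {z. c z \<notin> F} \<psi>) x))\<^sup>2)"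
        using F(2) by (intro sum.mono_neutral_right H) auto
      also have "\<dots> \<le> (\<Sum>x\<in>H - G. (cmod (coord \<psi> x))\<^sup>2)" by (intro sum_mono) auto
      also have "\<dots> = (\<Sum>x\<in>G \<union> H. (cmod (coord \<psi> x))\<^sup>2) - (\<Sum>x\<in>G. (cmod (coord \<psi> x))\<^sup>2)"
        using sum.union_diff2[OF G(1) H] by (simp add: G(1) H sum_diff[symmetric] Un_Diff)
      also have "\<dots> \<le> (norm \<psi>)\<^sup>2 - (\<Sum>x\<in>G. (cmod (coord \<psi> x))\<^sup>2)"
        using sum_coord_le_norm[of "G \<union> H" \<psi>] G(1) H by simp
      also have "\<dots> \<le> (e/2)\<^sup>2" using G(2)[of G] G(1) by (simp add: dist_real_def)
      finally show "(\<Sum>x\<in>H. (cmod (coord (restr {z. c z \<notin> F} \<psi>) x))\<^sup>2) \<le> (e/2)\<^sup>2" .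
    qed
    then have "norm (restr {z. c z \<notin> F} \<psi>) \<le> e/2" using \<open>e > 0\<close> by (simp add: abs_le_square_iff[symmetric])
    then show ?thesis using \<open>e > 0\<close> eq by (simp add: dist_norm norm_minus_commute)
  qed
  then show "\<exists>X. finite X \<and> X \<subseteq> UNIV \<and> (\<forall>Y. finite Y \<and> X \<subseteq> Y \<and> Y \<subseteq> UNIV \<longrightarrow>
      dist (\<Sum>i\<in>Y. restr {z. c z = i} \<psi>) \<psi> < e)"
    using G(1) by (intro exI[of _ "c ` G"]) auto
qed

lemma has_sum_ket: "((\<lambda>x. coord \<psi> x *\<^sub>C ket x) has_sum \<psi>) UNIV"
proof -
  have "restr {z. z = x} \<psi> = coord \<psi> x *\<^sub>C ket x" for x
    by (rule ell2_eqI) auto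
  then show ?thesis using has_sum_restr_fibres[of "\<lambda>x. x" \<psi>] by simp
qed

section \<open>Bounded complex-linear operators and their adjoints\<close>

definition clin :: "('a ell2 \<Rightarrow> 'b ell2) \<Rightarrow> bool" where
  "clin T \<longleftrightarrow> bounded_linear T \<and> (\<forall>c \<psi>. T (c *\<^sub>C \<psi>) = c *\<^sub>C T \<psi>)"

lemma clin_bl: "clin T \<Longrightarrow> bounded_linear T"
  and clin_scaleC: "clin T \<Longrightarrow> T (c *\<^sub>C \<psi>) = c *\<^sub>C T \<psi>"
  by (auto simp: clin_def)

lemma clinI:
  assumes "\<And>\<phi> \<psi>. T (\<phi> + \<psi>) = T \<phi> + T \<psi>" "\<And>c \<psi>. T (c *\<^sub>C \<psi>) = c *\<^sub>C T \<psi>"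
    "\<And>\<psi>. norm (T \<psi>) \<le> K * norm \<psi>"
  shows "clin T"
  unfolding clin_def
  using assms by (auto intro!: bounded_linear_intro[of _ K] simp: scaleR_scaleC mult.commute)

lemma clin_bound: "clin T \<Longrightarrow> \<exists>K\<ge>0. \<forall>\<psi>. norm (T \<psi>) \<le> K * norm \<psi>"
  using bounded_linear.nonneg_bounded[of T] by (auto simp: clin_def mult.commute)

lemma clin_add: "clin T \<Longrightarrow> T (\<phi> + \<psi>) = T \<phi> + T \<psi>"
  by (simp add: clin_def linear_simps)

lemma clin_zero: "clin T \<Longrightarrow> T 0 = 0"
  by (simp add: clin_def linear_simps)

lemma clin_sum: "clin T \<Longrightarrow> T (\<Sum>i\<in>F. f i) = (\<Sum>i\<in>F. T (f i))"
  by (rule linear_sum) (simp add: clin_def bounded_linear.linear)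

lemma clin_comp: "clin S \<Longrightarrow> clin T \<Longrightarrow> clin (S \<circ> T)"
  by (auto simp: clin_def comp_def bounded_linear_compose)

lemma clin_eq_on_kets:
  assumes "clin S" "clin T" "\<And>x. S (ket x) = T (ket x)"
  shows "S = T"
proof
  fix \<psi>
  have "((\<lambda>x. coord \<psi> x *\<^sub>C S (ket x)) has_sum S \<psi>) UNIV"
    using has_sum_bounded_linear[OF clin_bl[OF assms(1)] has_sum_ket[of \<psi>]] clin_scaleC[OF assms(1)] by simp
  moreover have "((\<lambda>x. coord \<psi> x *\<^sub>C S (ket x)) has_sum T \<psi>) UNIV"
    using has_sum_bounded_linear[OF clin_bl[OF assms(2)] has_sum_ket[of \<psi>]] clin_scaleC[OF assms(2)] assms(3)
    by simp
  ultimately show "S \<psi> = T \<psi>" by (rule has_sum_unique)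
qed

lemma clin_restr: "clin (restr S)"
proof (rule clinI[of _ 1])
  show "norm (restr S \<psi>) \<le> 1 * norm \<psi>" for \<psi> by (simp add: norm_restr_le)
qed (auto intro: ell2_eqI)

lemma cinner_eqI: "(\<And>\<phi>. cinner \<phi> \<psi> = cinner \<phi> \<xi>) \<Longrightarrow> \<psi> = \<xi>"
  by (metis cinner_ket_left ell2_eqI)

text \<open>Gives content to the description in \<open>adj\<close>. The coordinates of the image are
  forced to be \<open>cinner (T (ket x)) \<phi>\<close>. To bound them, \<open>T\<close> is applied
  to their own truncation \<open>\<xi>\<close>: its squared norm equals
  \<open>cinner (T \<xi>) \<phi>\<close>, hence is at most \<open>K\<close> times the norms of
  \<open>\<xi>\<close> and \<open>\<phi>\<close>, and one factor cancels.\<close>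

lemma adj_exists:
  assumes T: "clin T"
  shows "\<exists>S. \<forall>\<phi> \<psi>. cinner (S \<phi>) \<psi> = cinner \<phi> (T \<psi>)"
proof -
  obtain K where K: "K \<ge> 0" "\<And>\<psi>. norm (T \<psi>) \<le> K * norm \<psi>" using clin_bound[OF T] by auto
  define f where "f \<phi> x = cinner (T (ket x)) \<phi>" for \<phi> x
  have le: "(\<Sum>x\<in>F. (cmod (f \<phi> x))\<^sup>2) \<le> (K * norm \<phi>)\<^sup>2" if F: "finite F" for F \<phi>
  proof -
    define \<xi> where "\<xi> = (\<Sum>x\<in>F. f \<phi> x *\<^sub>C ket x)"
    define s where "s = (\<Sum>x\<in>F. (cmod (f \<phi> x))\<^sup>2)"
    have s0: "s \<ge> 0" by (simp add: s_def sum_nonneg)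
    have coord: "coord \<xi> y = (if y \<in> F then f \<phi> y else 0)" for y
      by (simp add: \<xi>_def coord_sum F if_distrib[of "(*) _"] cong: if_cong)
    have "((\<lambda>x. (cmod (coord \<xi> x))\<^sup>2) has_sum s) UNIV"
      unfolding s_def by (rule has_sum_finite_neutralI[OF F]) (auto simp: coord)
    then have nxi: "(norm \<xi>)\<^sup>2 = s" using norm_sq_has_sum has_sum_unique by blast
    have cs: "cinner (\<Sum>x\<in>F. g x) \<phi> = (\<Sum>x\<in>F. cinner (g x) \<phi>)" for g
      by (induction F rule: infinite_finite_induct) auto
    have "complex_of_real s = cinner (T \<xi>) \<phi>"
      unfolding s_def of_real_sum complex_norm_square
      by (simp add: \<xi>_def clin_sum[OF T] clin_scaleC[OF T] cs f_def mult.commute)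
    then have "s = cmod (cinner (T \<xi>) \<phi>)" using s0 by (metis norm_of_real abs_of_nonneg)
    also have "\<dots> \<le> (K * norm \<xi>) * norm \<phi>"
      using norm_cinner_le[of "T \<xi>" \<phi>] K(2)[of \<xi>] by (meson mult_right_mono norm_ge_zero order_trans)
    finally have "norm \<xi> * norm \<xi> \<le> norm \<xi> * (K * norm \<phi>)"
      using nxi by (simp add: power2_eq_square algebra_simps)
    then have "norm \<xi> \<le> K * norm \<phi>"
      using K(1) by (cases "norm \<xi> = 0") (auto simp: mult_le_cancel_left)
    then show ?thesis using nxi s_def by (metis norm_ge_zero power_mono)
  qed
  have co: "coord (Abs_ell2 (f \<phi>)) = f \<phi>" for \<phi>
    by (rule coord_Abs, rule sq_summableI, rule le)
  have "cinner (Abs_ell2 (f \<phi>)) \<psi> = cinner \<phi> (T \<psi>)" for \<phi> \<psi>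
  proof -
    have "((\<lambda>x. cinner \<phi> (T (coord \<psi> x *\<^sub>C ket x))) has_sum cinner \<phi> (T \<psi>)) UNIV"
      by (rule has_sum_bounded_linear[OF bounded_linear_cinner_right
            has_sum_bounded_linear[OF clin_bl[OF T] has_sum_ket]])
    moreover have "cinner \<phi> (T (coord \<psi> x *\<^sub>C ket x)) = cnj (coord (Abs_ell2 (f \<phi>)) x) * coord \<psi> x" for x
      by (simp add: co f_def clin_scaleC[OF T] cinner_commute[of "T _" \<phi>])
    ultimately show ?thesis using cinner_has_sum[of "Abs_ell2 (f \<phi>)" \<psi>] has_sum_unique by simp blast
  qed
  then show ?thesis by (intro exI[of _ "\<lambda>\<phi>. Abs_ell2 (f \<phi>)"]) auto
qed

lemma cinner_left_eqI: "(\<And>\<psi>. cinner \<phi> \<psi> = cinner \<xi> \<psi>) \<Longrightarrow> \<phi> = \<xi>"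
  by (rule cinner_eqI) (metis cinner_commute)

lemma adjI:
  assumes "\<And>\<phi> \<psi>. cinner (S \<phi>) \<psi> = cinner \<phi> (T \<psi>)"
  shows "adj T = S"
  unfolding adj_def
proof (rule the_equality)
  fix S' assume "\<forall>\<phi> \<psi>. cinner (S' \<phi>) \<psi> = cinner \<phi> (T \<psi>)"
  then show "S' = S" by (intro ext cinner_left_eqI) (simp add: assms)
qed (simp add: assms)

lemma cinner_adj: "clin T \<Longrightarrow> cinner (adj T \<phi>) \<psi> = cinner \<phi> (T \<psi>)"
  using adj_exists[of T] adjI[of _ T] by metis

lemma cinner_adj_right: "clin T \<Longrightarrow> cinner \<psi> (adj T \<phi>) = cinner (T \<psi>) \<phi>"
  using cinner_adj[of T \<phi> \<psi>] by (metis cinner_commute)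

lemma clin_adj:
  assumes T: "clin T"
  shows "clin (adj T)"
proof -
  obtain K where K: "K \<ge> 0" "\<And>\<psi>. norm (T \<psi>) \<le> K * norm \<psi>" using clin_bound[OF T] by auto
  show ?thesis
  proof (rule clinI[of _ K])
    show "adj T (\<phi> + \<psi>) = adj T \<phi> + adj T \<psi>" for \<phi> \<psi>
      by (rule cinner_left_eqI) (simp add: cinner_adj[OF T])
    show "adj T (c *\<^sub>C \<psi>) = c *\<^sub>C adj T \<psi>" for c \<psi>
      by (rule cinner_left_eqI) (simp add: cinner_adj[OF T])
    fix \<psi>
    have "(norm (adj T \<psi>))\<^sup>2 = cmod (cinner (adj T \<psi>) (adj T \<psi>))" by (simp add: cinner_self norm_power)
    also have "\<dots> = cmod (cinner \<psi> (T (adj T \<psi>)))" by (simp add: cinner_adj[OF T])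
    also have "\<dots> \<le> norm \<psi> * (K * norm (adj T \<psi>))"
      using norm_cinner_le[of \<psi> "T (adj T \<psi>)"] K(2)[of "adj T \<psi>"]
      by (meson mult_left_mono norm_ge_zero order_trans)
    finally have "norm (adj T \<psi>) * norm (adj T \<psi>) \<le> norm (adj T \<psi>) * (K * norm \<psi>)"
      by (simp add: power2_eq_square algebra_simps)
    then show "norm (adj T \<psi>) \<le> K * norm \<psi>"
      using K(1) by (cases "norm (adj T \<psi>) = 0") (auto simp: mult_le_cancel_left)
  qed
qed

section \<open>Operators on a register and their cylindrical extensions\<close>

lemma idop_eq_restr: "idop B X = restr (PiE X B)"
  by (rule ext) (simp add: idop_def restr_def)

lemma restr_restr: "restr S (restr S' \<psi>) = restr (S \<inter> S') \<psi>"
  by (rule ell2_eqI) auto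

lemma bops_clin: "T \<in> bops B X \<Longrightarrow> clin T"
  by (simp add: bops_def clin_def)

lemma bops_restr:
  assumes "T \<in> bops B X"
  shows bops_restr_arg: "T (restr (PiE X B) \<psi>) = T \<psi>"
    and bops_restr_val: "restr (PiE X B) (T \<psi>) = T \<psi>"
proof -
  have *: "T \<phi> = restr (PiE X B) (T (restr (PiE X B) \<phi>))" for \<phi>
    using assms by (auto simp: bops_def idop_eq_restr fun_eq_iff)
  have idem: "restr (PiE X B) (restr (PiE X B) \<phi>) = restr (PiE X B) \<phi>" for \<phi>
    by (simp add: restr_restr)
  show "T (restr (PiE X B) \<psi>) = T \<psi>" by (metis * idem)
  show "restr (PiE X B) (T \<psi>) = T \<psi>" by (metis * idem)
qed

lemma bopsI:
  assumes "clin T" "\<And>\<psi>. T (restr (PiE X B) \<psi>) = T \<psi>" "\<And>\<psi>. restr (PiE X B) (T \<psi>) = T \<psi>"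
  shows "T \<in> bops B X"
  using assms by (auto simp: bops_def idop_eq_restr clin_def)

lemma bops_coord_outside: "T \<in> bops B X \<Longrightarrow> x \<notin> PiE X B \<Longrightarrow> coord (T \<psi>) x = 0"
  using bops_restr_val[of T B X \<psi>] coord_restr by metis

lemma bops_ket_outside:
  assumes "T \<in> bops B X" "x \<notin> PiE X B"
  shows "T (ket x) = 0"
proof -
  have "restr (PiE X B) (ket x) = 0" by (rule ell2_eqI) (use assms in auto)
  then show ?thesis using bops_restr_arg[OF assms(1), of "ket x"] clin_zero[OF bops_clin[OF assms(1)]] by simp
qed

lemma bops_comp: "S \<in> bops B X \<Longrightarrow> T \<in> bops B X \<Longrightarrow> S \<circ> T \<in> bops B X"
  by (rule bopsI) (auto simp: bops_restr intro: clin_comp bops_clin)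

lemma bops_adj:
  assumes T: "T \<in> bops B X"
  shows "adj T \<in> bops B X"
proof (rule bopsI)
  note cT = bops_clin[OF T]
  show "clin (adj T)" by (rule clin_adj[OF cT])
  show "adj T (restr (PiE X B) \<psi>) = adj T \<psi>" for \<psi>
    by (rule cinner_left_eqI) (simp add: cinner_adj[OF cT] cinner_restr bops_restr[OF T])
  show "restr (PiE X B) (adj T \<psi>) = adj T \<psi>" for \<psi>
    by (rule cinner_left_eqI) (simp add: cinner_adj[OF cT] cinner_restr bops_restr[OF T])
qed

lemma clin_plus:
  assumes "clin S" "clin T"
  shows "clin (\<lambda>\<psi>. S \<psi> + T \<psi>)"
  using assms by (auto simp: clin_def bounded_linear_add scaleC_add_right)

lemma clin_0: "clin (\<lambda>_. 0)"
  by (simp add: clin_def)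

lemma bops_0: "(\<lambda>_. 0) \<in> bops B X"
  by (rule bopsI) (auto intro: clin_0 ell2_eqI)

lemma bops_plus: "S \<in> bops B X \<Longrightarrow> T \<in> bops B X \<Longrightarrow> (\<lambda>\<psi>. S \<psi> + T \<psi>) \<in> bops B X"
  by (rule bopsI) (auto simp: bops_restr clin_add[OF clin_restr] intro: clin_plus bops_clin)

lemma bops_sum:
  assumes "\<And>i. i \<in> I \<Longrightarrow> T i \<in> bops B X"
  shows "(\<lambda>\<psi>. \<Sum>i\<in>I. T i \<psi>) \<in> bops B X"
  using assms
proof (induction I rule: infinite_finite_induct)
  case (insert i I)
  then show ?case using bops_plus[of "T i" B X "\<lambda>\<psi>. \<Sum>i\<in>I. T i \<psi>"] by simp
qed (auto intro: bops_0)

section \<open>Splitting basis labels, slices of vectors, and the cylindrical extension\<close>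

definition glue :: "'v set \<Rightarrow> ('v \<Rightarrow> 'b) \<Rightarrow> ('v \<Rightarrow> 'b) \<Rightarrow> 'v \<Rightarrow> 'b" where
  "glue X x y = (\<lambda>v. if v \<in> X then x v else y v)"

text \<open>\<open>slice B X \<psi> y\<close> is the contraction of \<open>\<psi>\<close> with \<open><y|\<close> outside \<open>X\<close>.\<close>

definition slice :: "('v \<Rightarrow> 'b set) \<Rightarrow> 'v set \<Rightarrow> ('v \<Rightarrow> 'b) ell2 \<Rightarrow> ('v \<Rightarrow> 'b) \<Rightarrow> ('v \<Rightarrow> 'b) ell2" where
  "slice B X \<psi> y = Abs_ell2 (\<lambda>x. if x \<in> PiE X B then coord \<psi> (glue X x y) else 0)"

lemma glue_inj:
  assumes "x \<in> PiE X B" "x' \<in> PiE X B" "y \<in> PiE Y B" "y' \<in> PiE Y B" "X \<inter> Y = {}"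
    "glue X x y = glue X x' y'"
  shows "x = x' \<and> y = y'"
proof
  have *: "(if v \<in> X then x v else y v) = (if v \<in> X then x' v else y' v)" for v
    using fun_cong[OF assms(6), of v] by (simp add: glue_def)
  show "x = x'"
  proof (rule PiE_ext[of x X _ x'])
    fix v assume "v \<in> X"
    then show "x v = x' v" using *[of v] by simp
  qed (use assms in auto)
  show "y = y'"
  proof (rule PiE_ext[of y Y _ y'])
    fix v assume "v \<in> Y"
    then show "y v = y' v" using *[of v] assms(5) by (auto split: if_splits)
  qed (use assms in auto)
qed

text \<open>Distinct pairs glue to distinct labels, so the double sum is a partial sum of the
  squared norm.\<close>

lemma sum_glue_le:
  assumes "finite F" "finite G" "F \<subseteq> PiE X B" "G \<subseteq> PiE Y B" "X \<inter> Y = {}"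
  shows "(\<Sum>y\<in>G. \<Sum>x\<in>F. (cmod (coord \<psi> (glue X x y)))\<^sup>2) \<le> (norm \<psi>)\<^sup>2"
proof -
  have inj: "inj_on (\<lambda>(y, x). glue X x y) (G \<times> F)"
  proof (rule inj_onI, clarify)
    fix y x y' x' assume "y \<in> G" "x \<in> F" "y' \<in> G" "x' \<in> F" "glue X x y = glue X x' y'"
    then show "y = y' \<and> x = x'" using glue_inj[of x X B x' y Y y'] assms(3-5) by blast
  qed
  have "(\<Sum>y\<in>G. \<Sum>x\<in>F. (cmod (coord \<psi> (glue X x y)))\<^sup>2) =
      (\<Sum>z\<in>(\<lambda>(y, x). glue X x y) ` (G \<times> F). (cmod (coord \<psi> z))\<^sup>2)"
    unfolding sum.reindex[OF inj] by (simp add: sum.cartesian_product case_prod_unfold)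
  also have "\<dots> \<le> (norm \<psi>)\<^sup>2" using assms by (intro sum_coord_le_norm) auto
  finally show ?thesis .
qed

lemma coord_slice:
  assumes "y \<in> PiE Y B" "X \<inter> Y = {}"
  shows "coord (slice B X \<psi> y) x = (if x \<in> PiE X B then coord \<psi> (glue X x y) else 0)"
proof -
  have "(\<Sum>x\<in>F. (cmod (if x \<in> PiE X B then coord \<psi> (glue X x y) else 0))\<^sup>2) \<le> (norm \<psi>)\<^sup>2"
    if F: "finite F" for F
  proof -
    have "(\<Sum>x\<in>F. (cmod (if x \<in> PiE X B then coord \<psi> (glue X x y) else 0))\<^sup>2)
        = (\<Sum>y\<in>{y}. \<Sum>x\<in>F \<inter> PiE X B. (cmod (coord \<psi> (glue X x y)))\<^sup>2)"
      using F by (auto simp: sum.inter_restrict intro!: sum.cong)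
    also have "\<dots> \<le> (norm \<psi>)\<^sup>2" using F assms by (intro sum_glue_le) auto
    finally show ?thesis .
  qed
  from sq_summableI[OF this] show ?thesis by (simp add: slice_def coord_Abs)
qed

lemma has_sum_finite_sum:
  fixes f :: "'i \<Rightarrow> 'a \<Rightarrow> 'c::topological_comm_monoid_add"
  assumes "\<And>i. i \<in> I \<Longrightarrow> (f i has_sum s i) A"
  shows "((\<lambda>x. \<Sum>i\<in>I. f i x) has_sum (\<Sum>i\<in>I. s i)) A"
  using assms
proof (induction I rule: infinite_finite_induct)
  case (insert i I)
  then have "(f i has_sum s i) A" "((\<lambda>x. \<Sum>i\<in>I. f i x) has_sum sum s I) A" by auto
  from has_sum_add[OF this] show ?case using insert.hyps by simp
qed auto

text \<open>The slices read disjoint sets of coordinates of \<open>\<psi>\<close>. This preserves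
  the norm bound of an operator when it is applied slice by slice.\<close>

lemma sum_norm_slice_le:
  assumes "finite G" "G \<subseteq> PiE Y B" "X \<inter> Y = {}"
  shows "(\<Sum>y\<in>G. (norm (slice B X \<psi> y))\<^sup>2) \<le> (norm \<psi>)\<^sup>2"
proof (rule has_sum_le_finite_sums)
  show "((\<lambda>x. \<Sum>y\<in>G. (cmod (coord (slice B X \<psi> y) x))\<^sup>2) has_sum (\<Sum>y\<in>G. (norm (slice B X \<psi> y))\<^sup>2)) UNIV"
    by (intro has_sum_finite_sum norm_sq_has_sum)
  fix F :: "('a \<Rightarrow> 'b) set" assume F: "finite F"
  have "(\<Sum>x\<in>F. \<Sum>y\<in>G. (cmod (coord (slice B X \<psi> y) x))\<^sup>2)
      = (\<Sum>y\<in>G. \<Sum>x\<in>F \<inter> PiE X B. (cmod (coord \<psi> (glue X x y)))\<^sup>2)"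
    using F assms by (subst sum.swap)
      (auto simp: sum.inter_restrict coord_slice[where Y = Y] subset_iff intro!: sum.cong)
  also have "\<dots> \<le> (norm \<psi>)\<^sup>2" using F assms by (intro sum_glue_le) auto
  finally show "(\<Sum>x\<in>F. \<Sum>y\<in>G. (cmod (coord (slice B X \<psi> y) x))\<^sup>2) \<le> (norm \<psi>)\<^sup>2" .
qed

lemma restrict_PiE: "z \<in> PiE V B \<Longrightarrow> X \<subseteq> V \<Longrightarrow> restrict z X \<in> PiE X B"
  by (auto simp: PiE_def Pi_def)

lemma glue_restrict: "z \<in> PiE V B \<Longrightarrow> X \<subseteq> V \<Longrightarrow> glue X (restrict z X) (restrict z (V - X)) = z"
  by (auto simp: glue_def fun_eq_iff PiE_def extensional_def)

lemma restrict_pair_inj: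
  assumes "X \<subseteq> V" "H \<subseteq> PiE V B"
  shows "inj_on (\<lambda>z. (restrict z (V - X), restrict z X)) H"
  using assms by (intro inj_onI) (metis (no_types, lifting) Pair_inject glue_restrict subsetD)

text \<open>Enlarges a finite set of labels to the rectangle spanned by its two projections, where
  the sum becomes an iterated one.\<close>

lemma sum_restrict_le:
  fixes g :: "('v \<Rightarrow> 'b) \<Rightarrow> ('v \<Rightarrow> 'b) \<Rightarrow> real"
  assumes "finite H" "H \<subseteq> PiE V B" "X \<subseteq> V" "\<And>y x. 0 \<le> g y x"
  shows "(\<Sum>z\<in>H. g (restrict z (V - X)) (restrict z X)) \<le>
    (\<Sum>y\<in>(\<lambda>z. restrict z (V - X)) ` H. \<Sum>x\<in>(\<lambda>z. restrict z X) ` H. g y x)"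
proof -
  let ?r = "\<lambda>z. (restrict z (V - X), restrict z X)"
  have "(\<Sum>z\<in>H. g (restrict z (V - X)) (restrict z X)) = (\<Sum>(y, x)\<in>?r ` H. g y x)"
    by (subst sum.reindex[OF restrict_pair_inj[OF assms(3,2)]]) simp
  also have "\<dots> \<le> (\<Sum>(y, x)\<in>((\<lambda>z. restrict z (V - X)) ` H) \<times> ((\<lambda>z. restrict z X) ` H). g y x)"
    using assms by (intro sum_mono2) auto
  finally show ?thesis by (simp add: sum.cartesian_product)
qed

lemma coord_slice_restrict:
  assumes "X \<subseteq> V" "z \<in> PiE V B"
  shows "coord (slice B X \<psi> (restrict z (V - X))) x =
    (if x \<in> PiE X B then coord \<psi> (glue X x (restrict z (V - X))) else 0)"
  using assms by (intro coord_slice[where Y = "V - X"]) (auto simp: PiE_iff)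

text \<open>The witness for the description \<open>ext\<close>: acting with \<open>T\<close> on
  every slice is \<open>T\<close> tensored with the identity, written in coordinates.\<close>

definition cyl :: "('v \<Rightarrow> 'b set) \<Rightarrow> 'v set \<Rightarrow> 'v set \<Rightarrow> ('v, 'b) qop \<Rightarrow> ('v, 'b) qop" where
  "cyl B X V T \<psi> = Abs_ell2 (\<lambda>z. if z \<in> PiE V B
     then coord (T (slice B X \<psi> (restrict z (V - X)))) (restrict z X) else 0)"

context
  fixes B :: "'v \<Rightarrow> 'b set" and X V :: "'v set" and T :: "('v, 'b) qop"
  assumes X: "X \<subseteq> V" and T: "T \<in> bops B X"
begin

text \<open>Each slice contributes at most \<open>K\<close> squared times its own squared norm. The
  summand is spelled out because the estimate serves twice: it justifies \<open>Abs_ell2\<close> in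
  \<open>cyl\<close>, and it then bounds the norm of \<open>cyl\<close>.\<close>

lemma cyl_sum_le:
  assumes K: "K \<ge> 0" "\<And>\<psi>. norm (T \<psi>) \<le> K * norm \<psi>" and F: "finite F"
  shows "(\<Sum>z\<in>F. (cmod (if z \<in> PiE V B
     then coord (T (slice B X \<psi> (restrict z (V - X)))) (restrict z X) else 0))\<^sup>2) \<le> (K * norm \<psi>)\<^sup>2"
proof -
  let ?H = "F \<inter> PiE V B"
  let ?G = "(\<lambda>z. restrict z (V - X)) ` ?H"
  have "(\<Sum>z\<in>F. (cmod (if z \<in> PiE V B
     then coord (T (slice B X \<psi> (restrict z (V - X)))) (restrict z X) else 0))\<^sup>2)
    = (\<Sum>z\<in>?H. (cmod (coord (T (slice B X \<psi> (restrict z (V - X)))) (restrict z X)))\<^sup>2)"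
    using F by (auto simp: sum.inter_restrict intro!: sum.cong)
  also have "\<dots> \<le> (\<Sum>y\<in>?G. \<Sum>x\<in>(\<lambda>z. restrict z X) ` ?H. (cmod (coord (T (slice B X \<psi> y)) x))\<^sup>2)"
    using F X by (intro sum_restrict_le) auto
  also have "\<dots> \<le> (\<Sum>y\<in>?G. (norm (T (slice B X \<psi> y)))\<^sup>2)"
    using F by (intro sum_mono sum_coord_le_norm) auto
  also have "\<dots> \<le> (\<Sum>y\<in>?G. K\<^sup>2 * (norm (slice B X \<psi> y))\<^sup>2)"
    unfolding power_mult_distrib[symmetric] by (intro sum_mono power_mono K) auto
  also have "\<dots> = K\<^sup>2 * (\<Sum>y\<in>?G. (norm (slice B X \<psi> y))\<^sup>2)" by (simp add: sum_distrib_left)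
  also have "\<dots> \<le> K\<^sup>2 * (norm \<psi>)\<^sup>2"
    using F X by (intro mult_left_mono sum_norm_slice_le[where Y = "V - X"]) (auto simp: PiE_iff)
  finally show ?thesis by (simp add: power_mult_distrib)
qed

lemma coord_cyl: "coord (cyl B X V T \<psi>) z = (if z \<in> PiE V B
    then coord (T (slice B X \<psi> (restrict z (V - X)))) (restrict z X) else 0)"
proof -
  obtain K where "K \<ge> 0" "\<And>\<psi>. norm (T \<psi>) \<le> K * norm \<psi>" using clin_bound[OF bops_clin[OF T]] by auto
  from coord_Abs[OF sq_summableI[OF cyl_sum_le[OF this]]] show ?thesis unfolding cyl_def by simp
qed

lemma cyl_bops: "cyl B X V T \<in> bops B V"
proof (rule bopsI)
  obtain K where K: "K \<ge> 0" "\<And>\<psi>. norm (T \<psi>) \<le> K * norm \<psi>" using clin_bound[OF bops_clin[OF T]] by auto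
  note cs = coord_slice_restrict[OF X]
  have add: "slice B X (\<phi> + \<psi>) (restrict z (V - X)) =
      slice B X \<phi> (restrict z (V - X)) + slice B X \<psi> (restrict z (V - X))"
    and scale: "slice B X (c *\<^sub>C \<psi>) (restrict z (V - X)) = c *\<^sub>C slice B X \<psi> (restrict z (V - X))"
    if "z \<in> PiE V B" for \<phi> \<psi> c z
    using that by (auto intro!: ell2_eqI simp: cs)
  show "clin (cyl B X V T)"
  proof (rule clinI[of _ K])
    show "cyl B X V T (\<phi> + \<psi>) = cyl B X V T \<phi> + cyl B X V T \<psi>" for \<phi> \<psi>
      by (rule ell2_eqI) (auto simp: coord_cyl add clin_add[OF bops_clin[OF T]])
    show "cyl B X V T (c *\<^sub>C \<psi>) = c *\<^sub>C cyl B X V T \<psi>" for c \<psi>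
      by (rule ell2_eqI) (auto simp: coord_cyl scale clin_scaleC[OF bops_clin[OF T]])
    fix \<psi>
    have "(norm (cyl B X V T \<psi>))\<^sup>2 \<le> (K * norm \<psi>)\<^sup>2"
      by (rule norm_sq_leI) (simp only: coord_cyl cyl_sum_le[OF K])
    then show "norm (cyl B X V T \<psi>) \<le> K * norm \<psi>" using K(1) by (simp add: power2_le_iff_abs_le)
  qed
  show "cyl B X V T (restr (PiE V B) \<psi>) = cyl B X V T \<psi>" for \<psi>
  proof (rule ell2_eqI)
    fix z
    have "slice B X (restr (PiE V B) \<psi>) (restrict z (V - X)) = slice B X \<psi> (restrict z (V - X))"
      if z: "z \<in> PiE V B"
    proof (rule ell2_eqI)
      fix x
      have "glue X x (restrict z (V - X)) \<in> PiE V B" if "x \<in> PiE X B"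
        using that z X by (auto simp: glue_def PiE_def Pi_def extensional_def)
      then show "coord (slice B X (restr (PiE V B) \<psi>) (restrict z (V - X))) x =
          coord (slice B X \<psi> (restrict z (V - X))) x" by (simp add: cs z)
    qed
    then show "coord (cyl B X V T (restr (PiE V B) \<psi>)) z = coord (cyl B X V T \<psi>) z"
      by (simp add: coord_cyl)
  qed
  show "restr (PiE V B) (cyl B X V T \<psi>) = cyl B X V T \<psi>" for \<psi>
    by (rule ell2_eqI) (simp add: coord_cyl)
qed

end

lemma coord_tensor:
  assumes "X \<subseteq> V"
  shows "coord (tensor B X (V - X) \<phi> \<psi>) z =
    (if z \<in> PiE V B then coord \<phi> (restrict z X) * coord \<psi> (restrict z (V - X)) else 0)"
proof -
  have V: "X \<union> (V - X) = V" using assms by auto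
  have "(\<Sum>z\<in>F. (cmod (if z \<in> PiE V B then coord \<phi> (restrict z X) * coord \<psi> (restrict z (V - X)) else 0))\<^sup>2)
      \<le> (norm \<psi>)\<^sup>2 * (norm \<phi>)\<^sup>2" if F: "finite F" for F
  proof -
    let ?H = "F \<inter> PiE V B"
    have "(\<Sum>z\<in>F. (cmod (if z \<in> PiE V B then coord \<phi> (restrict z X) * coord \<psi> (restrict z (V - X)) else 0))\<^sup>2)
      = (\<Sum>z\<in>?H. (cmod (coord \<psi> (restrict z (V - X))))\<^sup>2 * (cmod (coord \<phi> (restrict z X)))\<^sup>2)"
      using F by (auto simp: sum.inter_restrict norm_mult power_mult_distrib mult.commute intro!: sum.cong)
    also have "\<dots> \<le> (\<Sum>y\<in>(\<lambda>z. restrict z (V - X)) ` ?H. \<Sum>x\<in>(\<lambda>z. restrict z X) ` ?H.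
        (cmod (coord \<psi> y))\<^sup>2 * (cmod (coord \<phi> x))\<^sup>2)"
      using F assms by (intro sum_restrict_le) auto
    also have "\<dots> = (\<Sum>y\<in>(\<lambda>z. restrict z (V - X)) ` ?H. (cmod (coord \<psi> y))\<^sup>2) *
        (\<Sum>x\<in>(\<lambda>z. restrict z X) ` ?H. (cmod (coord \<phi> x))\<^sup>2)"
      by (simp add: sum_product)
    also have "\<dots> \<le> (norm \<psi>)\<^sup>2 * (norm \<phi>)\<^sup>2"
      using F by (intro mult_mono sum_coord_le_norm) (auto intro: sum_nonneg)
    finally show ?thesis .
  qed
  from coord_Abs[OF sq_summableI[OF this]] show ?thesis unfolding tensor_def V by simp
qed

text \<open>Existence: a slice of a product vector is a multiple of the first factor. Uniqueness:
  each basis vector of \<open>hspace B V\<close> is a product of basis vectors, and bounded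
  operators agreeing on all basis vectors coincide.\<close>

lemma ext_eq_cyl:
  assumes X: "X \<subseteq> V" and T: "T \<in> bops B X"
  shows "ext B X V T = cyl B X V T"
  unfolding ext_def
proof (rule the_equality)
  have cyl_tensor: "cyl B X V T (tensor B X (V - X) \<phi> \<psi>) = tensor B X (V - X) (T \<phi>) \<psi>"
    if "\<phi> \<in> hspace B X" for \<phi> \<psi>
  proof (rule ell2_eqI)
    fix z
    have "slice B X (tensor B X (V - X) \<phi> \<psi>) (restrict z (V - X)) =
        restr (PiE X B) (coord \<psi> (restrict z (V - X)) *\<^sub>C \<phi>)" if z: "z \<in> PiE V B"
    proof (rule ell2_eqI)
      fix x
      let ?m = "glue X x (restrict z (V - X))"
      have "?m \<in> PiE V B" "restrict ?m X = x" "restrict ?m (V - X) = restrict z (V - X)" if "x \<in> PiE X B"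
        using that z X by (auto simp: glue_def PiE_def Pi_def extensional_def fun_eq_iff)
      then show "coord (slice B X (tensor B X (V - X) \<phi> \<psi>) (restrict z (V - X))) x =
          coord (restr (PiE X B) (coord \<psi> (restrict z (V - X)) *\<^sub>C \<phi>)) x"
        by (simp add: coord_tensor[OF X] coord_slice_restrict[OF X z])
    qed
    then show "coord (cyl B X V T (tensor B X (V - X) \<phi> \<psi>)) z = coord (tensor B X (V - X) (T \<phi>) \<psi>) z"
      by (simp add: coord_cyl[OF X T] coord_tensor[OF X] bops_restr[OF T] clin_scaleC[OF bops_clin[OF T]])
  qed
  then show "cyl B X V T \<in> bops B V \<and> (\<forall>\<phi>\<in>hspace B X. \<forall>\<psi>\<in>hspace B (V - X).
       cyl B X V T (tensor B X (V - X) \<phi> \<psi>) = tensor B X (V - X) (T \<phi>) \<psi>)"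
    using cyl_bops[OF X T] by blast
  fix S assume S: "S \<in> bops B V \<and> (\<forall>\<phi>\<in>hspace B X. \<forall>\<psi>\<in>hspace B (V - X).
       S (tensor B X (V - X) \<phi> \<psi>) = tensor B X (V - X) (T \<phi>) \<psi>)"
  show "S = cyl B X V T"
  proof (rule clin_eq_on_kets)
    fix z
    show "S (ket z) = cyl B X V T (ket z)"
    proof (cases "z \<in> PiE V B")
      case True
      have "ket z = tensor B X (V - X) (ket (restrict z X)) (ket (restrict z (V - X)))"
      proof (rule ell2_eqI)
        fix z'
        have "z' = z" if "z' \<in> PiE V B" "restrict z' X = restrict z X" "restrict z' (V - X) = restrict z (V - X)"
          using that True glue_restrict[OF _ X] by metis
        then show "coord (ket z) z' = coord (tensor B X (V - X) (ket (restrict z X)) (ket (restrict z (V - X)))) z'"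
          using True by (auto simp: coord_tensor[OF X])
      qed
      moreover have "ket (restrict z X) \<in> hspace B X" "ket (restrict z (V - X)) \<in> hspace B (V - X)"
        using True X by (auto simp: hspace_def restrict_PiE)
      ultimately show ?thesis using S cyl_tensor by metis
    next
      case False
      then show ?thesis using bops_ket_outside[OF conjunct1[OF S]] bops_ket_outside[OF cyl_bops[OF X T]] by simp
    qed
  qed (use S cyl_bops[OF X T] in \<open>auto intro: bops_clin\<close>)
qed

lemma ext_bops: "X \<subseteq> V \<Longrightarrow> T \<in> bops B X \<Longrightarrow> ext B X V T \<in> bops B V"
  by (simp add: ext_eq_cyl cyl_bops)

lemma rank_one_bops:
  assumes "x \<in> PiE X B" "y \<in> PiE X B"
  shows "(\<lambda>\<psi>. cinner (ket y) \<psi> *\<^sub>C ket x) \<in> bops B X"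
proof (rule bopsI)
  show "clin (\<lambda>\<psi>. cinner (ket y) \<psi> *\<^sub>C ket x)"
    by (rule clinI[of _ 1]) (auto simp: scaleC_add_left coord_le_norm)
  show "restr (PiE X B) (cinner (ket y) \<psi> *\<^sub>C ket x) = cinner (ket y) \<psi> *\<^sub>C ket x" for \<psi>
    using assms by (intro ell2_eqI) auto
qed (use assms in auto)

section \<open>The operators |i><j| on a single variable\<close>

context
  fixes B :: "'v \<Rightarrow> 'b set" and V :: "'v set" and q :: 'v and i j :: 'b
  assumes q: "q \<in> V" and i: "i \<in> B q" and j: "j \<in> B q"
begin

lemma ketbra_op_bops: "(\<lambda>\<psi>. cinner (ket (\<lambda>_\<in>{q}. j)) \<psi> *\<^sub>C ket (\<lambda>_\<in>{q}. i)) \<in> bops B {q}"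
  using i j by (intro rank_one_bops) auto

lemma ketbra_bops: "ketbra B V q i j \<in> bops B V"
  unfolding ketbra_def using q ketbra_op_bops by (intro ext_bops) auto

lemma coord_ketbra:
  "coord (ketbra B V q i j \<psi>) z = (if z \<in> PiE V B \<and> z q = i then coord \<psi> (z(q := j)) else 0)"
proof -
  have 1: "{q} \<subseteq> V" using q by auto
  have 2: "restrict z {q} = (\<lambda>_\<in>{q}. i) \<longleftrightarrow> z q = i" by (auto simp: fun_eq_iff)
  have 3: "coord (slice B {q} \<psi> (restrict z (V - {q}))) (\<lambda>_\<in>{q}. j) = coord \<psi> (z(q := j))"
    if z: "z \<in> PiE V B"
  proof -
    have "glue {q} (\<lambda>_\<in>{q}. j) (restrict z (V - {q})) = z(q := j)"
      using z q by (auto simp: glue_def fun_eq_iff PiE_def extensional_def)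
    then show ?thesis using j coord_slice_restrict[OF 1 z] by auto
  qed
  show ?thesis
    unfolding ketbra_def ext_eq_cyl[OF 1 ketbra_op_bops] coord_cyl[OF 1 ketbra_op_bops]
    by (simp add: 2 3)
qed

end

section \<open>Mixtures of pure states\<close>

definition mix :: "('k \<Rightarrow> 'a ell2) \<Rightarrow> 'a ell2 \<Rightarrow> 'a ell2" where
  "mix v \<psi> = (\<Sum>\<^sub>\<infinity>k. cinner (v k) \<psi> *\<^sub>C v k)"

definition sq_summable_vecs :: "('k \<Rightarrow> 'a ell2) \<Rightarrow> bool" where
  "sq_summable_vecs v \<longleftrightarrow> (\<lambda>k. (norm (v k))\<^sup>2) summable_on UNIV"

lemma mix_abs_summable:
  assumes "sq_summable_vecs v"
  shows "(\<lambda>k. norm (cinner (v k) \<psi> *\<^sub>C v k)) summable_on UNIV"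
proof (rule summable_on_comparison_test)
  show "(\<lambda>k. norm \<psi> * (norm (v k))\<^sup>2) summable_on UNIV"
    using assms by (intro summable_on_cmult_right) (simp add: sq_summable_vecs_def)
  fix k
  show "norm (cinner (v k) \<psi> *\<^sub>C v k) \<le> norm \<psi> * (norm (v k))\<^sup>2"
    using mult_right_mono[OF norm_cinner_le[of "v k" \<psi>], of "norm (v k)"]
    by (simp add: power2_eq_square algebra_simps)
qed auto

lemma mix_has_sum:
  assumes "sq_summable_vecs v"
  shows "((\<lambda>k. cinner (v k) \<psi> *\<^sub>C v k) has_sum mix v \<psi>) UNIV"
  unfolding mix_def by (rule has_sum_infsum[OF abs_summable_summable[OF mix_abs_summable[OF assms]]])

lemma clin_mix:
  assumes v: "sq_summable_vecs v"
  shows "clin (mix v)"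
proof (rule clinI)
  show "mix v (\<phi> + \<psi>) = mix v \<phi> + mix v \<psi>" for \<phi> \<psi>
    using has_sum_add[OF mix_has_sum[OF v, of \<phi>] mix_has_sum[OF v, of \<psi>]]
    by (intro has_sum_unique[OF mix_has_sum[OF v]]) (simp add: scaleC_add_left)
  show "mix v (c *\<^sub>C \<psi>) = c *\<^sub>C mix v \<psi>" for c \<psi>
    using has_sum_bounded_linear[OF bounded_linear_scaleC mix_has_sum[OF v, of \<psi>], of c]
    by (intro has_sum_unique[OF mix_has_sum[OF v]]) simp
  show "norm (mix v \<psi>) \<le> (\<Sum>\<^sub>\<infinity>k. (norm (v k))\<^sup>2) * norm \<psi>" for \<psi>
  proof -
    have "norm (mix v \<psi>) \<le> (\<Sum>\<^sub>\<infinity>k. norm (cinner (v k) \<psi> *\<^sub>C v k))"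
      unfolding mix_def by (rule norm_infsum_bound[OF mix_abs_summable[OF v]])
    also have "\<dots> \<le> (\<Sum>\<^sub>\<infinity>k. (norm (v k))\<^sup>2 * norm \<psi>)"
    proof (rule infsum_mono[OF mix_abs_summable[OF v]])
      show "(\<lambda>k. (norm (v k))\<^sup>2 * norm \<psi>) summable_on UNIV"
        using v by (intro summable_on_cmult_left) (simp add: sq_summable_vecs_def)
      fix k
      show "norm (cinner (v k) \<psi> *\<^sub>C v k) \<le> (norm (v k))\<^sup>2 * norm \<psi>"
        using mult_right_mono[OF norm_cinner_le[of "v k" \<psi>], of "norm (v k)"]
        by (simp add: power2_eq_square algebra_simps)
    qed
    finally show ?thesis by (simp add: infsum_cmult_left')
  qed
qed

text \<open>The absolute values stand inside the sum, which is stronger than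
  \<open>norm_cinner_le\<close>; the exchange of sums in \<open>tr_mix\<close> needs this
  form.\<close>

lemma infsum_abs_cinner_le:
  "(\<Sum>\<^sub>\<infinity>x. norm (cnj (coord \<phi> x) * coord \<psi> x)) \<le> norm \<phi> * norm \<psi>"
proof (rule infsum_le_finite_sums[OF cinner_abs_summable])
  fix F :: "'a set" assume F: "finite F"
  have L2: "L2_set (\<lambda>x. cmod (coord \<xi> x)) F \<le> norm \<xi>" for \<xi> :: "'a ell2"
    using real_sqrt_le_mono[OF sum_coord_le_norm[OF F, of \<xi>]] by (simp add: L2_set_def)
  have "(\<Sum>x\<in>F. norm (cnj (coord \<phi> x) * coord \<psi> x)) = (\<Sum>x\<in>F. \<bar>cmod (coord \<phi> x)\<bar> * \<bar>cmod (coord \<psi> x)\<bar>)"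
    by (simp add: norm_mult)
  also have "\<dots> \<le> L2_set (\<lambda>x. cmod (coord \<phi> x)) F * L2_set (\<lambda>x. cmod (coord \<psi> x)) F"
    by (rule L2_set_mult_ineq)
  also have "\<dots> \<le> norm \<phi> * norm \<psi>" by (intro mult_mono L2) (auto simp: L2_set_nonneg)
  finally show "(\<Sum>x\<in>F. norm (cnj (coord \<phi> x) * coord \<psi> x)) \<le> norm \<phi> * norm \<psi>" .
qed

section \<open>Traces of operators against mixtures\<close>

lemma sq_summable_vecs_clin:
  assumes "clin A" "sq_summable_vecs v"
  shows "sq_summable_vecs (\<lambda>k. A (v k))"
proof -
  obtain K where K: "K \<ge> 0" "\<And>\<psi>. norm (A \<psi>) \<le> K * norm \<psi>" using clin_bound[OF assms(1)] by auto
  have le: "(norm (A (v k)))\<^sup>2 \<le> K\<^sup>2 * (norm (v k))\<^sup>2" for k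
    using power_mono[OF K(2)[of "v k"], of 2] by (simp add: power_mult_distrib)
  have "(\<lambda>k. K\<^sup>2 * (norm (v k))\<^sup>2) summable_on UNIV"
    using assms(2) unfolding sq_summable_vecs_def by (rule summable_on_cmult_right)
  then show ?thesis
    unfolding sq_summable_vecs_def by (rule summable_on_comparison_test) (auto simp: le)
qed

lemma summable_norm_mult_clin:
  assumes A: "clin A" and v: "sq_summable_vecs v"
  shows "(\<lambda>k. norm (v k) * norm (A (v k))) summable_on UNIV"
proof -
  obtain K where K: "K \<ge> 0" "\<And>\<psi>. norm (A \<psi>) \<le> K * norm \<psi>" using clin_bound[OF A] by auto
  have le: "norm (v k) * norm (A (v k)) \<le> K * (norm (v k))\<^sup>2" for k
    using mult_left_mono[OF K(2)[of "v k"], of "norm (v k)"] by (simp add: power2_eq_square algebra_simps)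
  have "(\<lambda>k. K * (norm (v k))\<^sup>2) summable_on UNIV"
    using v unfolding sq_summable_vecs_def by (rule summable_on_cmult_right)
  then show ?thesis by (rule summable_on_comparison_test) (auto simp: le)
qed

lemma expectation_summable:
  assumes A: "clin A" and v: "sq_summable_vecs v"
  shows "(\<lambda>k. cinner (v k) (A (v k))) summable_on UNIV"
  by (rule abs_summable_summable, rule summable_on_comparison_test[OF summable_norm_mult_clin[OF A v]])
     (auto simp: norm_cinner_le)

text \<open>Fubini: the trace sums over basis labels, the mixture over \<open>k\<close>, and the
  double series converges absolutely, because for each \<open>k\<close> the sum over labels is at
  most \<open>norm (v k) * norm (A (v k))\<close>.\<close>

lemma tr_mix:
  assumes A: "A \<in> bops B V" and v: "sq_summable_vecs v"
  shows "tr B V (A \<circ> mix v) = (\<Sum>\<^sub>\<infinity>k. cinner (v k) (A (v k)))"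
proof -
  note cA = bops_clin[OF A]
  define F where "F = (\<lambda>k x. cnj (coord (v k) x) * coord (A (v k)) x)"
  have "(\<lambda>p. norm (F (fst p) (snd p))) summable_on Sigma UNIV (\<lambda>_. UNIV)"
    unfolding Infinite_Sum.abs_summable_on_Sigma_iff
  proof (intro conjI ballI)
    show "(\<lambda>x. norm (F (fst (k, x)) (snd (k, x)))) summable_on UNIV" for k
      using cinner_abs_summable by (simp add: F_def)
    show "(\<lambda>k. norm (\<Sum>\<^sub>\<infinity>x. norm (F (fst (k, x)) (snd (k, x))))) summable_on UNIV"
      by (rule summable_on_comparison_test[OF summable_norm_mult_clin[OF cA v]])
         (auto simp: F_def infsum_abs_cinner_le infsum_nonneg simp del: norm_mult)
  qed
  then have sF: "(\<lambda>(k, x). F k x) summable_on UNIV \<times> UNIV"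
    using abs_summable_summable[of "\<lambda>(k, x). F k x"] by (simp add: case_prod_unfold)
  have diag: "cinner (ket x) ((A \<circ> mix v) (ket x)) = (\<Sum>\<^sub>\<infinity>k. F k x)" for x
  proof -
    have "((\<lambda>k. cinner (ket x) (A (cinner (v k) (ket x) *\<^sub>C v k))) has_sum cinner (ket x) (A (mix v (ket x)))) UNIV"
      by (rule has_sum_bounded_linear[OF bounded_linear_cinner_right
            has_sum_bounded_linear[OF clin_bl[OF cA] mix_has_sum[OF v]]])
    then show ?thesis by (simp add: F_def clin_scaleC[OF cA] infsumI)
  qed
  have "tr B V (A \<circ> mix v) = (\<Sum>\<^sub>\<infinity>x\<in>PiE V B. \<Sum>\<^sub>\<infinity>k. F k x)"
    unfolding tr_def diag ..
  \<comment> \<open>Outside the register \<open>A (v k)\<close> has coordinate 0, so the outer sum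
    may run over all labels.\<close>
  also have "\<dots> = (\<Sum>\<^sub>\<infinity>x. \<Sum>\<^sub>\<infinity>k. F k x)"
    by (rule infsum_cong_neutral) (auto simp: F_def bops_coord_outside[OF A])
  also have "\<dots> = (\<Sum>\<^sub>\<infinity>k. \<Sum>\<^sub>\<infinity>x. F k x)"
    by (rule infsum_swap_banach[symmetric, OF sF])
  finally show ?thesis by (simp add: F_def cinner_def)
qed

lemma tr_mix_mono:
  assumes "A \<in> bops B V" "A' \<in> bops B V" "A \<sqsubseteq>\<^sub>L A'" "sq_summable_vecs v"
  shows "tr B V (A \<circ> mix v) \<le> tr B V (A' \<circ> mix v)"
  unfolding tr_mix[OF assms(1,4)] tr_mix[OF assms(2,4)]
proof (rule infsum_mono_complex)
  fix k
  have "0 \<le> cinner (v k) (A' (v k) - A (v k))"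
    using assms(3) unfolding loewner_le_def positive_op_def by blast
  then show "cinner (v k) (A (v k)) \<le> cinner (v k) (A' (v k))"
    by (simp add: less_eq_complex_def)
qed (use assms in \<open>auto intro!: expectation_summable bops_clin\<close>)

lemma tr_mix_plus:
  assumes A: "A \<in> bops B V" "A' \<in> bops B V" and v: "sq_summable_vecs v"
  shows "tr B V ((\<lambda>\<psi>. A \<psi> + A' \<psi>) \<circ> mix v) = tr B V (A \<circ> mix v) + tr B V (A' \<circ> mix v)"
  unfolding tr_mix[OF A(1) v] tr_mix[OF A(2) v] tr_mix[OF bops_plus[OF A] v] cinner_add_right
  by (intro infsum_add expectation_summable bops_clin[OF A(1)] bops_clin[OF A(2)] v)

lemma tr_mix_sum:
  assumes "\<And>i. i \<in> I \<Longrightarrow> A i \<in> bops B V" and v: "sq_summable_vecs v"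
  shows "tr B V ((\<lambda>\<psi>. \<Sum>i\<in>I. A i \<psi>) \<circ> mix v) = (\<Sum>i\<in>I. tr B V (A i \<circ> mix v))"
  using assms(1)
proof (induction I rule: infinite_finite_induct)
  case (insert i I)
  then show ?case
    using tr_mix_plus[OF _ bops_sum[of I A B V] v, of "A i"] by (simp add: o_def)
qed (simp_all add: tr_def)

lemma conj_mix:
  assumes E: "clin E" and v: "sq_summable_vecs v"
  shows "E \<circ> mix v \<circ> adj E = mix (\<lambda>k. E (v k))"
proof
  fix \<psi>
  have "((\<lambda>k. E (cinner (v k) (adj E \<psi>) *\<^sub>C v k)) has_sum E (mix v (adj E \<psi>))) UNIV"
    by (rule has_sum_bounded_linear[OF clin_bl[OF E] mix_has_sum[OF v]])
  then show "(E \<circ> mix v \<circ> adj E) \<psi> = mix (\<lambda>k. E (v k)) \<psi>"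
    by (simp add: clin_scaleC[OF E] cinner_adj_right[OF E] mix_def infsumI)
qed

lemma tr_conj_mix:
  assumes E: "E \<in> bops B V" and A: "A \<in> bops B V" and v: "sq_summable_vecs v"
  shows "tr B V ((adj E \<circ> A \<circ> E) \<circ> mix v) = tr B V (A \<circ> (E \<circ> mix v \<circ> adj E))"
proof -
  note cE = bops_clin[OF E]
  have "adj E \<circ> A \<circ> E \<in> bops B V" by (intro bops_comp bops_adj E A)
  then show ?thesis
    unfolding conj_mix[OF cE v]
    by (simp add: tr_mix v sq_summable_vecs_clin[OF cE v] A cinner_adj_right[OF cE])
qed

section \<open>Partial density operators are mixtures\<close>

text \<open>Polarisation: reality of the form at \<open>\<phi> + \<psi>\<close> settles the
  imaginary parts, and at \<open>\<phi> + \<i> *\<^sub>C \<psi>\<close> the real parts.\<close>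

lemma positive_op_hermitian:
  assumes R: "clin R" "positive_op R"
  shows "cinner \<phi> (R \<psi>) = cnj (cinner \<psi> (R \<phi>))"
proof -
  have re: "Im (cinner \<xi> (R \<xi>)) = 0" for \<xi>
    using R(2) by (simp add: positive_op_def less_eq_complex_def)
  have "Im (cinner \<phi> (R \<psi>) + cinner \<psi> (R \<phi>)) = 0"
    using re[of "\<phi> + \<psi>"] re[of \<phi>] re[of \<psi>] by (simp add: clin_add[OF R(1)])
  moreover have "Re (cinner \<phi> (R \<psi>) - cinner \<psi> (R \<phi>)) = 0"
    using re[of "\<phi> + \<i> *\<^sub>C \<psi>"] re[of \<phi>] re[of \<psi>] by (simp add: clin_add[OF R(1)] clin_scaleC[OF R(1)])
  ultimately show ?thesis by (simp add: complex_eq_iff)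
qed

text \<open>The form is nonnegative at \<open>\<psi> + t *\<^sub>C \<phi>\<close>. Choosing the
  phase of \<open>t\<close> against \<open>c\<close> makes the cross terms real, which leaves a real
  quadratic in one parameter \<open>s\<close>.\<close>

lemma positive_op_Cauchy_Schwarz:
  assumes R: "clin R" "positive_op R"
  shows "(cmod (cinner \<psi> (R \<phi>)))\<^sup>2 \<le> Re (cinner \<phi> (R \<phi>)) * Re (cinner \<psi> (R \<psi>))"
proof -
  define c where "c = cinner \<psi> (R \<phi>)"
  define a where "a = Re (cinner \<psi> (R \<psi>))"
  define r where "r = Re (cinner \<phi> (R \<phi>))"
  have nn: "0 \<le> Re (cinner \<xi> (R \<xi>))" for \<xi>
    using R(2) by (simp add: positive_op_def less_eq_complex_def)
  have cc: "cinner \<phi> (R \<psi>) = cnj c" unfolding c_def by (rule positive_op_hermitian[OF R])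
  have im: "Im (cinner \<phi> (R \<phi>)) = 0"
    using R(2) by (simp add: positive_op_def less_eq_complex_def)
  have q: "0 \<le> a - 2 * s * (cmod c)\<^sup>2 + s\<^sup>2 * (cmod c)\<^sup>2 * r" for s
  proof -
    define t where "t = complex_of_real (- s) * cnj c"
    have "R (\<psi> + t *\<^sub>C \<phi>) = R \<psi> + t *\<^sub>C R \<phi>"
      by (simp only: clin_add[OF R(1)] clin_scaleC[OF R(1)])
    then have "cinner (\<psi> + t *\<^sub>C \<phi>) (R (\<psi> + t *\<^sub>C \<phi>)) =
        cinner \<psi> (R \<psi>) + t * c + cnj t * cnj c + cnj t * t * cinner \<phi> (R \<phi>)"
      by (simp add: cc c_def[symmetric] algebra_simps)
    moreover have "Re (cinner \<psi> (R \<psi>) + t * c + cnj t * cnj c + cnj t * t * cinner \<phi> (R \<phi>)) =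
        a - 2 * s * (cmod c)\<^sup>2 + s\<^sup>2 * (cmod c)\<^sup>2 * r"
      unfolding cmod_power2 t_def by (simp add: a_def r_def im power2_eq_square algebra_simps)
    ultimately have "Re (cinner (\<psi> + t *\<^sub>C \<phi>) (R (\<psi> + t *\<^sub>C \<phi>))) =
        a - 2 * s * (cmod c)\<^sup>2 + s\<^sup>2 * (cmod c)\<^sup>2 * r"
      by simp
    with nn show ?thesis by metis
  qed
  have "(cmod c)\<^sup>2 \<le> r * a"
  proof (cases "r = 0")
    case True
    have "c = 0"
    proof (rule ccontr)
      assume "c \<noteq> 0"
      \<comment> \<open>For \<open>r = 0\<close> the quadratic is affine in \<open>s\<close>; this
        value of \<open>s\<close> makes it -1.\<close>
      then have "2 * ((a + 1) / (2 * (cmod c)\<^sup>2)) * (cmod c)\<^sup>2 = a + 1" by simp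
      with q[of "(a + 1) / (2 * (cmod c)\<^sup>2)"] True show False by simp
    qed
    then show ?thesis using True by simp
  next
    case False
    then have r: "r > 0" using nn[of \<phi>] by (simp add: r_def)
    \<comment> \<open>The quadratic is least at \<open>s = 1 / r\<close>.\<close>
    have "0 \<le> r * (a - 2 * (1 / r) * (cmod c)\<^sup>2 + (1 / r)\<^sup>2 * (cmod c)\<^sup>2 * r)"
      using q[of "1 / r"] r by (intro mult_nonneg_nonneg) auto
    also have "\<dots> = r * a - (cmod c)\<^sup>2" using r by (simp add: power2_eq_square field_simps)
    finally show ?thesis by simp
  qed
  then show ?thesis by (simp add: c_def a_def r_def)
qed

text \<open>One step of a Cholesky decomposition. If \<open><e|R|e> = 0\<close>, then \<open>R e = 0\<close> and the vector is 0.\<close>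

definition chol_vec :: "('a ell2 \<Rightarrow> 'a ell2) \<Rightarrow> 'a ell2 \<Rightarrow> 'a ell2" where
  "chol_vec R e = complex_of_real (1 / sqrt (Re (cinner e (R e)))) *\<^sub>C R e"

definition chol_rest :: "('a ell2 \<Rightarrow> 'a ell2) \<Rightarrow> 'a ell2 \<Rightarrow> 'a ell2 \<Rightarrow> 'a ell2" where
  "chol_rest R e \<psi> = R \<psi> - cinner (chol_vec R e) \<psi> *\<^sub>C chol_vec R e"

context
  fixes R :: "'a ell2 \<Rightarrow> 'a ell2"
  assumes R: "clin R" "positive_op R"
begin

lemma chol_rest_clin: "clin (chol_rest R e)"
proof -
  obtain K where K: "K \<ge> 0" "\<And>\<psi>. norm (R \<psi>) \<le> K * norm \<psi>" using clin_bound[OF R(1)] by auto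
  show ?thesis
  proof (rule clinI)
    let ?w = "chol_vec R e"
    show "chol_rest R e (\<phi> + \<psi>) = chol_rest R e \<phi> + chol_rest R e \<psi>" for \<phi> \<psi>
      by (simp add: chol_rest_def clin_add[OF R(1)] scaleC_add_left)
    show "chol_rest R e (c *\<^sub>C \<psi>) = c *\<^sub>C chol_rest R e \<psi>" for c \<psi>
      by (simp add: chol_rest_def clin_scaleC[OF R(1)] scaleC_diff_right)
    fix \<psi>
    have "norm (chol_rest R e \<psi>) \<le> norm (R \<psi>) + norm (cinner ?w \<psi> *\<^sub>C ?w)"
      unfolding chol_rest_def by (rule norm_triangle_ineq4)
    also have "\<dots> \<le> K * norm \<psi> + norm ?w * norm \<psi> * norm ?w"
      using K(2)[of \<psi>] mult_right_mono[OF norm_cinner_le[of ?w \<psi>], of "norm ?w"] by simp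
    finally show "norm (chol_rest R e \<psi>) \<le> (K + norm ?w * norm ?w) * norm \<psi>"
      by (simp add: algebra_simps)
  qed
qed

lemma cinner_chol_vec:
  "cinner (chol_vec R e) \<psi> = complex_of_real (1 / sqrt (Re (cinner e (R e)))) * cinner e (R \<psi>)"
  unfolding chol_vec_def cinner_scaleC_left
  using positive_op_hermitian[OF R, of e \<psi>] cinner_commute[of "R e" \<psi>] by simp

text \<open>Divided by \<open>cinner e (R e)\<close>, the Cauchy-Schwarz inequality for the form of
  \<open>R\<close> says that the subtracted rank-one term does not exceed \<open>R\<close>.\<close>

lemma chol_rest_positive: "positive_op (chol_rest R e)"
  unfolding positive_op_def
proof
  fix \<psi>
  let ?r = "Re (cinner e (R e))"
  let ?w = "chol_vec R e"
  have r: "0 \<le> ?r" and p: "0 \<le> cinner \<psi> (R \<psi>)"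
    using R(2) by (auto simp: positive_op_def less_eq_complex_def)
  have "cinner \<psi> (chol_rest R e \<psi>) = cinner \<psi> (R \<psi>) - cinner ?w \<psi> * cnj (cinner ?w \<psi>)"
    by (simp add: chol_rest_def cinner_commute[of \<psi> ?w])
  also have "\<dots> = cinner \<psi> (R \<psi>) - complex_of_real ((cmod (cinner ?w \<psi>))\<^sup>2)"
    by (simp only: complex_norm_square)
  finally have eq: "cinner \<psi> (chol_rest R e \<psi>) = cinner \<psi> (R \<psi>) - complex_of_real ((cmod (cinner ?w \<psi>))\<^sup>2)" .
  have "(cmod (cinner ?w \<psi>))\<^sup>2 \<le> Re (cinner \<psi> (R \<psi>))"
  proof (cases "?r = 0")
    case True
    \<comment> \<open>Here \<open>1 / sqrt 0\<close> is 0, so nothing is subtracted.\<close>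
    then show ?thesis using p by (simp add: cinner_chol_vec less_eq_complex_def)
  next
    case False
    then have "(cmod (cinner ?w \<psi>))\<^sup>2 = (cmod (cinner e (R \<psi>)))\<^sup>2 / ?r"
      using r by (simp add: cinner_chol_vec norm_mult norm_divide power_mult_distrib power_divide)
    also have "\<dots> \<le> Re (cinner \<psi> (R \<psi>))"
      using positive_op_Cauchy_Schwarz[OF R, of e \<psi>] r False by (simp add: divide_le_eq mult.commute)
    finally show ?thesis .
  qed
  then show "0 \<le> cinner \<psi> (chol_rest R e \<psi>)"
    unfolding eq using p by (simp add: less_eq_complex_def)
qed

text \<open>Basis vectors eliminated in earlier steps of the decomposition stay eliminated.\<close>

lemma chol_rest_kernel: "R \<psi> = 0 \<Longrightarrow> chol_rest R e \<psi> = 0"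
  by (simp add: chol_rest_def cinner_chol_vec)

text \<open>The scaling in \<open>chol_vec\<close> is chosen so that a single step eliminates
  \<open>e\<close>.\<close>

lemma chol_rest_self: "chol_rest R e e = 0"
proof (cases "Re (cinner e (R e)) = 0")
  case True
  \<comment> \<open>A vanishing diagonal entry forces the whole column \<open>R e\<close> to
    vanish.\<close>
  have "cinner \<phi> (R e) = cinner \<phi> 0" for \<phi>
    using positive_op_Cauchy_Schwarz[OF R, of \<phi> e] True by simp
  then have "R e = 0" by (rule cinner_eqI)
  then show ?thesis by (rule chol_rest_kernel)
next
  case False
  let ?r = "Re (cinner e (R e))"
  have "0 \<le> cinner e (R e)" using R(2) by (simp add: positive_op_def)
  then have r: "0 < ?r" "cinner e (R e) = complex_of_real ?r"
    using False by (auto simp: less_eq_complex_def complex_eq_iff)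
  have "complex_of_real (1 / sqrt ?r) * cinner e (R e) * complex_of_real (1 / sqrt ?r) =
      complex_of_real (1 / sqrt ?r * ?r * (1 / sqrt ?r))"
    unfolding of_real_mult using r(2) by metis
  also have "1 / sqrt ?r * ?r * (1 / sqrt ?r) = 1"
    using r(1) by (simp add: field_simps)
  finally have "complex_of_real (1 / sqrt ?r) * cinner e (R e) * complex_of_real (1 / sqrt ?r) = 1"
    by (simp only: of_real_1)
  then show ?thesis
    unfolding chol_rest_def cinner_chol_vec by (simp only: chol_vec_def scaleC_scaleC scaleC_one diff_self)
qed

end

primrec chol :: "('a ell2 \<Rightarrow> 'a ell2) \<Rightarrow> (nat \<Rightarrow> 'a ell2) \<Rightarrow> nat \<Rightarrow> 'a ell2 \<Rightarrow> 'a ell2" where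
  "chol R e 0 = R"
| "chol R e (Suc n) = chol_rest (chol R e n) (e n)"

text \<open>Each basis vector is eliminated after finitely many steps, so \<open>\<rho>\<close> acts
  on it as a finite sum of rank-one terms; both sides are bounded, hence equal everywhere. The
  diagonals of the partial sums stay below that of \<open>\<rho>\<close>, whose summability bounds
  all the squared norms of the \<open>w k\<close> together.\<close>

lemma density_is_mix:
  fixes B :: "'v \<Rightarrow> 'b set"
  assumes "\<rho> \<in> partial_density B V" and "countable (PiE V B)" "PiE V B \<noteq> {}"
  shows "\<exists>w :: nat \<Rightarrow> ('v \<Rightarrow> 'b) ell2. sq_summable_vecs w \<and> \<rho> = mix w"
proof -
  let ?N = "PiE V B"
  have \<rho>: "\<rho> \<in> bops B V" "positive_op \<rho>" "(\<lambda>x. cinner (ket x) (\<rho> (ket x))) summable_on ?N"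
    using assms(1) by (auto simp: partial_density_def)
  \<comment> \<open>For finite \<open>?N\<close> the enumeration repeats labels; at a repeated label
    the remainder already annihilates the basis vector, so the new \<open>w n\<close> is 0.\<close>
  define en where "en = from_nat_into ?N"
  have en: "range en = ?N" unfolding en_def using assms(2,3) by (rule range_from_nat_into[rotated])
  define R where "R = chol \<rho> (\<lambda>n. ket (en n))"
  define w where "w n = chol_vec (R n) (ket (en n))" for n
  have R: "clin (R n)" "positive_op (R n)" for n
    by (induction n) (auto simp: R_def bops_clin[OF \<rho>(1)] \<rho>(2) chol_rest_clin chol_rest_positive)
  have ker: "R n (ket (en m)) = 0" if "m < n" for m n
    using that
  proof (induction n)
    case (Suc n)
    then show ?case
      using chol_rest_kernel[OF R(1,2)[of n]] chol_rest_self[OF R(1,2)[of n]]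
      by (cases "m = n") (auto simp: R_def)
  qed simp
  have dec: "\<rho> \<psi> = R n \<psi> + (\<Sum>k<n. cinner (w k) \<psi> *\<^sub>C w k)" for n \<psi>
    by (induction n) (auto simp: R_def w_def chol_rest_def algebra_simps)
  have diag: "(\<Sum>k<n. (cmod (coord (w k) x))\<^sup>2) \<le> Re (cinner (ket x) (\<rho> (ket x)))" for n x
  proof -
    have "0 \<le> Re (cinner (ket x) (R n (ket x)))"
      using R(2)[of n, unfolded positive_op_def, rule_format, of "ket x"] by (simp add: less_eq_complex_def)
    moreover have "Re (cinner (ket x) (\<Sum>k<n. cinner (w k) (ket x) *\<^sub>C w k)) = (\<Sum>k<n. (cmod (coord (w k) x))\<^sup>2)"
      unfolding cmod_power2 by (simp add: coord_sum power2_eq_square)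
    ultimately show ?thesis by (subst dec[of _ n]) simp
  qed
  have sdiag: "(\<lambda>x. Re (cinner (ket x) (\<rho> (ket x)))) summable_on UNIV"
  proof -
    have "(\<lambda>x. Re (cinner (ket x) (\<rho> (ket x)))) summable_on ?N" by (rule summable_on_Re[OF \<rho>(3)])
    then show ?thesis
      by (rule summable_on_cong_neutral[THEN iffD1, rotated -1]) (auto simp: bops_coord_outside[OF \<rho>(1)])
  qed
  have pdiag: "0 \<le> Re (cinner (ket x) (\<rho> (ket x)))" for x
    using \<rho>(2) unfolding positive_op_def less_eq_complex_def by (metis zero_complex.simps(1))
  define \<tau> where "\<tau> = (\<Sum>\<^sub>\<infinity>x. Re (cinner (ket x) (\<rho> (ket x))))"
  have bound: "(\<Sum>k<n. (norm (w k))\<^sup>2) \<le> \<tau>" for n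
  proof (rule has_sum_le_finite_sums)
    show "((\<lambda>x. \<Sum>k<n. (cmod (coord (w k) x))\<^sup>2) has_sum (\<Sum>k<n. (norm (w k))\<^sup>2)) UNIV"
      by (intro has_sum_finite_sum norm_sq_has_sum)
    fix F :: "('v \<Rightarrow> 'b) set" assume F: "finite F"
    have "(\<Sum>x\<in>F. \<Sum>k<n. (cmod (coord (w k) x))\<^sup>2) \<le> (\<Sum>x\<in>F. Re (cinner (ket x) (\<rho> (ket x))))"
      by (intro sum_mono diag)
    also have "\<dots> \<le> \<tau>" unfolding \<tau>_def using pdiag by (intro finite_sum_le_infsum sdiag F) auto
    finally show "(\<Sum>x\<in>F. \<Sum>k<n. (cmod (coord (w k) x))\<^sup>2) \<le> \<tau>" .
  qed
  have sw: "sq_summable_vecs w"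
    unfolding sq_summable_vecs_def
  proof (rule nonneg_bdd_above_summable_on)
    show "bdd_above (sum (\<lambda>k. (norm (w k))\<^sup>2) ` {F. F \<subseteq> UNIV \<and> finite F})"
    proof (intro bdd_aboveI2[of _ _ \<tau>], clarify)
      fix F :: "nat set" assume F: "finite F"
      then obtain n where "F \<subseteq> {..<n}" using finite_nat_iff_bounded by auto
      then have "(\<Sum>k\<in>F. (norm (w k))\<^sup>2) \<le> (\<Sum>k<n. (norm (w k))\<^sup>2)" by (intro sum_mono2) auto
      with bound[of n] show "(\<Sum>k\<in>F. (norm (w k))\<^sup>2) \<le> \<tau>" by linarith
    qed
  qed auto
  have "\<rho> = mix w"
  proof (rule clin_eq_on_kets[OF bops_clin[OF \<rho>(1)] clin_mix[OF sw]])
    fix x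
    show "\<rho> (ket x) = mix w (ket x)"
    proof (cases "x \<in> ?N")
      case True
      then obtain m where m: "x = en m" using en by (metis rangeE)
      \<comment> \<open>By the symmetry of \<open>R k\<close>, this is a multiple of a coordinate of
        \<open>R k (ket (en m))\<close>, which vanishes after step \<open>m\<close>.\<close>
      have "cinner (w k) (ket x) = 0" if "k \<ge> Suc m" for k
        using that m ker[of m k] by (simp only: w_def cinner_chol_vec[OF R(1,2)]) simp
      then have "((\<lambda>k. cinner (w k) (ket x) *\<^sub>C w k) has_sum (\<Sum>k<Suc m. cinner (w k) (ket x) *\<^sub>C w k)) UNIV"
        by (intro has_sum_finite_neutralI[of "{..<Suc m}"]) (auto simp: not_less Suc_le_eq)
      moreover have "\<rho> (ket x) = (\<Sum>k<Suc m. cinner (w k) (ket x) *\<^sub>C w k)"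
        using dec[of "ket x" "Suc m"] ker[of m "Suc m"] m by simp
      ultimately show ?thesis unfolding mix_def using infsumI by metis
    next
      case False
      \<comment> \<open>By \<open>diag\<close>, a zero on the diagonal of \<open>\<rho>\<close>
        leaves no room for a nonzero coordinate of any \<open>w k\<close>.\<close>
      have "coord (w k) x = 0" for k
      proof -
        have "(cmod (coord (w k) x))\<^sup>2 \<le> (\<Sum>k<Suc k. (cmod (coord (w k) x))\<^sup>2)"
          by (rule member_le_sum) auto
        also have "\<dots> \<le> 0" using diag[where n = "Suc k" and x = x] False by (simp add: bops_ket_outside[OF \<rho>(1)])
        finally show ?thesis by simp
      qed
      then show ?thesis using False by (simp add: mix_def bops_ket_outside[OF \<rho>(1)])
    qed
  qed
  with sw show ?thesis by blast
qed

section \<open>Initialisation of a variable\<close>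

text \<open>Brings mixtures over different index types to a common one: indices outside the range of
  \<open>f\<close> carry zero vectors, which contribute to neither sum.\<close>

lemma mix_reindex:
  assumes "inj f" "\<And>k. v' (f k) = v k" "\<And>j. j \<notin> range f \<Longrightarrow> v' j = 0" "sq_summable_vecs v"
  shows sq_summable_vecs_reindex: "sq_summable_vecs v'" and mix_reindex_eq: "mix v' = mix v"
proof -
  have "(\<lambda>k. (norm (v' (f k)))\<^sup>2) summable_on UNIV"
    using assms(2,4) by (simp add: sq_summable_vecs_def)
  then have "(\<lambda>j. (norm (v' j))\<^sup>2) summable_on range f"
    using summable_on_reindex[OF assms(1), of "\<lambda>j. (norm (v' j))\<^sup>2"] by (simp add: o_def)
  then show "sq_summable_vecs v'" unfolding sq_summable_vecs_def
    by (rule summable_on_cong_neutral[THEN iffD1, rotated -1]) (use assms(3) in auto)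
  show "mix v' = mix v"
  proof
    fix \<psi>
    have "mix v' \<psi> = (\<Sum>\<^sub>\<infinity>j\<in>range f. cinner (v' j) \<psi> *\<^sub>C v' j)"
      unfolding mix_def by (rule infsum_cong_neutral) (use assms(3) in auto)
    also have "\<dots> = mix v \<psi>"
      unfolding mix_def by (subst infsum_reindex[OF assms(1)]) (simp add: o_def assms(2))
    finally show "mix v' \<psi> = mix v \<psi>" .
  qed
qed

context
  fixes B :: "'v \<Rightarrow> 'b::zero set" and V :: "'v set" and q :: 'v
  assumes q: "q \<in> V" and B0: "0 \<in> B q"
begin

text \<open>For different \<open>j\<close> the vectors read disjoint sets of coordinates of
  \<open>\<psi>\<close>, those whose label at \<open>q\<close> is \<open>j\<close>.\<close>

lemma sum_norm_ketbra_le: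
  assumes F: "finite F" "F \<subseteq> B q" and i: "i \<in> B q"
  shows "(\<Sum>j\<in>F. (norm (ketbra B V q i j \<psi>))\<^sup>2) \<le> (norm \<psi>)\<^sup>2"
proof (rule has_sum_le_finite_sums)
  show "((\<lambda>z. \<Sum>j\<in>F. (cmod (coord (ketbra B V q i j \<psi>) z))\<^sup>2) has_sum (\<Sum>j\<in>F. (norm (ketbra B V q i j \<psi>))\<^sup>2)) UNIV"
    by (intro has_sum_finite_sum norm_sq_has_sum)
  fix G :: "('v \<Rightarrow> 'b) set" assume G: "finite G"
  define H where "H = {z \<in> G. z \<in> PiE V B \<and> z q = i}"
  have inj: "inj_on (\<lambda>(z, j). z(q := j)) (H \<times> F)"
  proof (rule inj_onI, clarify)
    fix z j z' j' assume "z \<in> H" "z' \<in> H" and eq: "z(q := j) = z'(q := j')"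
    then have "z q = z' q" by (simp add: H_def)
    moreover have "z x = z' x" if "x \<noteq> q" for x using fun_cong[OF eq, of x] that by simp
    ultimately show "z = z' \<and> j = j'" using fun_cong[OF eq, of q] by (metis ext fun_upd_same)
  qed
  have "(\<Sum>z\<in>G. \<Sum>j\<in>F. (cmod (coord (ketbra B V q i j \<psi>) z))\<^sup>2) =
      (\<Sum>z\<in>H. \<Sum>j\<in>F. (cmod (coord \<psi> (z(q := j))))\<^sup>2)"
    using F i by (intro sum.mono_neutral_cong_right G sum.cong)
      (auto simp: H_def coord_ketbra[where B = B, OF q i] subset_iff split: if_splits intro!: sum.neutral sum.cong)
  also have "\<dots> = (\<Sum>z\<in>(\<lambda>(z, j). z(q := j)) ` (H \<times> F). (cmod (coord \<psi> z))\<^sup>2)"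
    unfolding sum.reindex[OF inj] by (simp add: sum.cartesian_product case_prod_unfold)
  also have "\<dots> \<le> (norm \<psi>)\<^sup>2" using F G by (intro sum_coord_le_norm) (auto simp: H_def)
  finally show "(\<Sum>z\<in>G. \<Sum>j\<in>F. (cmod (coord (ketbra B V q i j \<psi>) z))\<^sup>2) \<le> (norm \<psi>)\<^sup>2" .
qed

text \<open>Changing the label at \<open>q\<close> is a bijection between the basis labels that
  carry \<open>i\<close> there and those that carry \<open>j\<close>.\<close>

lemma cinner_ketbra:
  assumes i: "i \<in> B q" and j: "j \<in> B q"
  shows "cinner (ketbra B V q i j \<phi>) \<psi> = cinner \<phi> (ketbra B V q j i \<psi>)"
proof -
  let ?P = "\<lambda>k. {z. z \<in> PiE V B \<and> z q = k}"
  have upd: "z(q := k) \<in> PiE V B" if "z \<in> PiE V B" "k \<in> B q" for z k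
    using that q by (auto simp: PiE_def Pi_def extensional_def)
  have "cinner (ketbra B V q i j \<phi>) \<psi> = (\<Sum>\<^sub>\<infinity>z\<in>?P i. cnj (coord \<phi> (z(q := j))) * coord \<psi> z)"
    unfolding cinner_def by (rule infsum_cong_neutral) (auto simp: coord_ketbra[where B = B, OF q i j])
  also have "\<dots> = (\<Sum>\<^sub>\<infinity>z\<in>?P j. cnj (coord \<phi> z) * coord \<psi> (z(q := i)))"
    by (rule infsum_reindex_bij_witness[of _ "\<lambda>z. z(q := i)" "\<lambda>z. z(q := j)"])
       (use i j upd in auto)
  also have "\<dots> = cinner \<phi> (ketbra B V q j i \<psi>)"
    unfolding cinner_def by (rule infsum_cong_neutral) (auto simp: coord_ketbra[where B = B, OF q j i])
  finally show ?thesis .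
qed

text \<open>Indices outside \<open>B q\<close> get the zero vector because \<open>mix\<close> sums
  over a whole index type.\<close>

definition reset_vecs :: "('k \<Rightarrow> ('v \<Rightarrow> 'b) ell2) \<Rightarrow> 'k \<times> 'b \<Rightarrow> ('v \<Rightarrow> 'b) ell2" where
  "reset_vecs v = (\<lambda>(k, i). if i \<in> B q then ketbra B V q 0 i (v k) else 0)"

lemma reset_vecs_sum_le:
  assumes "finite F"
  shows "(\<Sum>i\<in>F. (norm (reset_vecs v (k, i)))\<^sup>2) \<le> (norm (v k))\<^sup>2"
proof -
  have "(\<Sum>i\<in>F. (norm (reset_vecs v (k, i)))\<^sup>2) = (\<Sum>i\<in>F \<inter> B q. (norm (ketbra B V q 0 i (v k)))\<^sup>2)"
    using assms by (auto simp: reset_vecs_def sum.inter_restrict intro!: sum.cong)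
  also have "\<dots> \<le> (norm (v k))\<^sup>2" using assms B0 by (intro sum_norm_ketbra_le) auto
  finally show ?thesis .
qed

lemma sq_summable_reset_vecs:
  assumes v: "sq_summable_vecs v"
  shows "sq_summable_vecs (reset_vecs v)"
proof -
  have s: "(\<lambda>i. (norm (reset_vecs v (k, i)))\<^sup>2) summable_on UNIV" for k
    by (rule nonneg_bdd_above_summable_on)
       (auto intro!: bdd_aboveI2[of _ _ "(norm (v k))\<^sup>2"] reset_vecs_sum_le)
  have "(\<lambda>p. norm ((norm (reset_vecs v p))\<^sup>2)) summable_on Sigma UNIV (\<lambda>_. UNIV)"
    unfolding Infinite_Sum.abs_summable_on_Sigma_iff
  proof (intro conjI ballI)
    show "(\<lambda>i. norm ((norm (reset_vecs v (k, i)))\<^sup>2)) summable_on UNIV" for k using s by simp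
    have "(\<Sum>\<^sub>\<infinity>i. (norm (reset_vecs v (k, i)))\<^sup>2) \<le> (norm (v k))\<^sup>2" for k
      by (rule infsum_le_finite_sums[OF s reset_vecs_sum_le])
    then show "(\<lambda>k. norm (\<Sum>\<^sub>\<infinity>i. norm ((norm (reset_vecs v (k, i)))\<^sup>2))) summable_on UNIV"
      by (intro summable_on_comparison_test[OF v[unfolded sq_summable_vecs_def]]) (auto simp: infsum_nonneg)
  qed
  then show ?thesis by (simp add: sq_summable_vecs_def)
qed

text \<open>The sum over basis labels in \<open>init_state\<close> is exchanged with the sum over
  the mixture; the joint family is summable by \<open>sq_summable_reset_vecs\<close>.\<close>

lemma init_state_mix:
  assumes v: "sq_summable_vecs v"
  shows "init_state B V q (mix v) = mix (reset_vecs v)"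
proof
  fix \<psi>
  let ?f = "\<lambda>p. cinner (reset_vecs v p) \<psi> *\<^sub>C reset_vecs v p"
  have summand: "(ketbra B V q 0 i \<circ> mix v \<circ> ketbra B V q i 0) \<psi> = (\<Sum>\<^sub>\<infinity>k. ?f (k, i))" if i: "i \<in> B q" for i
  proof -
    note K = bops_clin[OF ketbra_bops[where B = B, OF q B0 i]]
    have "((\<lambda>k. ketbra B V q 0 i (cinner (v k) (ketbra B V q i 0 \<psi>) *\<^sub>C v k)) has_sum
        ketbra B V q 0 i (mix v (ketbra B V q i 0 \<psi>))) UNIV"
      by (rule has_sum_bounded_linear[OF clin_bl[OF K] mix_has_sum[OF v]])
    then show ?thesis using i
      by (simp add: clin_scaleC[OF K] reset_vecs_def cinner_ketbra[OF B0 i] infsumI)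
  qed
  have sum: "(\<lambda>(k, i). ?f (k, i)) summable_on UNIV \<times> UNIV"
    using mix_has_sum[OF sq_summable_reset_vecs[OF v], of \<psi>] by (auto simp: case_prod_unfold dest: has_sum_imp_summable)
  have "init_state B V q (mix v) \<psi> = (\<Sum>\<^sub>\<infinity>i\<in>B q. \<Sum>\<^sub>\<infinity>k. ?f (k, i))"
    unfolding init_state_def by (rule infsum_cong) (rule summand)
  also have "\<dots> = (\<Sum>\<^sub>\<infinity>i. \<Sum>\<^sub>\<infinity>k. ?f (k, i))"
    by (rule infsum_cong_neutral) (auto simp: reset_vecs_def)
  also have "\<dots> = (\<Sum>\<^sub>\<infinity>k. \<Sum>\<^sub>\<infinity>i. ?f (k, i))"
    by (rule infsum_swap_banach[OF sum, symmetric])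
  also have "\<dots> = mix (reset_vecs v) \<psi>"
    using infsum_Sigma'_banach[OF sum] by (simp add: mix_def case_prod_unfold)
  finally show "init_state B V q (mix v) \<psi> = mix (reset_vecs v) \<psi>" .
qed

text \<open>The coordinates of \<open>init_pre B V q A\<close>, whose summands have disjoint supports.\<close>

definition ipre :: "('v, 'b) qop \<Rightarrow> ('v, 'b) qop" where
  "ipre A \<psi> = Abs_ell2 (\<lambda>z. if z \<in> PiE V B then coord (A (ketbra B V q 0 (z q) \<psi>)) (z(q := 0)) else 0)"

context
  fixes A :: "('v, 'b) qop"
  assumes A: "A \<in> bops B V"
begin

lemma PiE_at_q: "z \<in> PiE V B \<Longrightarrow> z q \<in> B q"
  using q by auto

text \<open>The coordinates with label \<open>i\<close> at \<open>q\<close> are those of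
  \<open>?u i\<close>, whose norm is at most \<open>K * norm (ketbra B V q 0 i \<psi>)\<close>; the
  squares of these are summed by \<open>sum_norm_ketbra_le\<close>.\<close>

lemma ipre_sum_le:
  assumes K: "K \<ge> 0" "\<And>\<psi>. norm (A \<psi>) \<le> K * norm \<psi>" and F: "finite F"
  shows "(\<Sum>z\<in>F. (cmod (if z \<in> PiE V B then coord (A (ketbra B V q 0 (z q) \<psi>)) (z(q := 0)) else 0))\<^sup>2)
    \<le> (K * norm \<psi>)\<^sup>2"
proof -
  let ?u = "\<lambda>i. ketbra B V q i 0 (A (ketbra B V q 0 i \<psi>))"
  let ?H = "F \<inter> PiE V B"
  let ?I = "(\<lambda>z. z q) ` ?H"
  have I: "i \<in> B q" if "i \<in> ?I" for i using that by (auto simp: PiE_at_q)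
  have "(\<Sum>z\<in>F. (cmod (if z \<in> PiE V B then coord (A (ketbra B V q 0 (z q) \<psi>)) (z(q := 0)) else 0))\<^sup>2)
      = (\<Sum>z\<in>?H. (cmod (coord (?u (z q)) z))\<^sup>2)"
    using F by (auto simp: sum.inter_restrict coord_ketbra[where B = B, OF q PiE_at_q B0] intro!: sum.cong)
  also have "\<dots> \<le> (\<Sum>z\<in>?H. \<Sum>i\<in>?I. (cmod (coord (?u i) z))\<^sup>2)"
    using F by (intro sum_mono member_le_sum[of "_ q" ?I "\<lambda>i. (cmod (coord (?u i) _))\<^sup>2"]) auto
  also have "\<dots> = (\<Sum>i\<in>?I. \<Sum>z\<in>?H. (cmod (coord (?u i) z))\<^sup>2)" by (rule sum.swap)
  also have "\<dots> \<le> (\<Sum>i\<in>?I. (norm (?u i))\<^sup>2)" using F by (intro sum_mono sum_coord_le_norm) auto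
  also have "\<dots> \<le> (\<Sum>i\<in>?I. K\<^sup>2 * (norm (ketbra B V q 0 i \<psi>))\<^sup>2)"
  proof (rule sum_mono)
    fix i assume "i \<in> ?I"
    then have i: "i \<in> B q" by (rule I)
    have "(norm (?u i))\<^sup>2 \<le> (norm (A (ketbra B V q 0 i \<psi>)))\<^sup>2"
      using sum_norm_ketbra_le[of "{0}" i "A (ketbra B V q 0 i \<psi>)"] B0 i by simp
    also have "\<dots> \<le> K\<^sup>2 * (norm (ketbra B V q 0 i \<psi>))\<^sup>2"
      unfolding power_mult_distrib[symmetric] by (intro power_mono K) auto
    finally show "(norm (?u i))\<^sup>2 \<le> K\<^sup>2 * (norm (ketbra B V q 0 i \<psi>))\<^sup>2" .
  qed
  also have "\<dots> = K\<^sup>2 * (\<Sum>i\<in>?I. (norm (ketbra B V q 0 i \<psi>))\<^sup>2)" by (simp add: sum_distrib_left)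
  also have "\<dots> \<le> K\<^sup>2 * (norm \<psi>)\<^sup>2"
    using F I B0 by (intro mult_left_mono sum_norm_ketbra_le) auto
  finally show ?thesis by (simp add: power_mult_distrib)
qed

lemma coord_ipre:
  "coord (ipre A \<psi>) z = (if z \<in> PiE V B then coord (A (ketbra B V q 0 (z q) \<psi>)) (z(q := 0)) else 0)"
proof -
  obtain K where "K \<ge> 0" "\<And>\<psi>. norm (A \<psi>) \<le> K * norm \<psi>" using clin_bound[OF bops_clin[OF A]] by auto
  from coord_Abs[OF sq_summableI[OF ipre_sum_le[OF this]]] show ?thesis unfolding ipre_def by simp
qed

lemma ipre_bops: "ipre A \<in> bops B V"
proof (rule bopsI)
  obtain K where K: "K \<ge> 0" "\<And>\<psi>. norm (A \<psi>) \<le> K * norm \<psi>" using clin_bound[OF bops_clin[OF A]] by auto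
  note kb = ketbra_bops[where B = B, OF q B0]
  show "clin (ipre A)"
  proof (rule clinI[of _ K])
    show "ipre A (\<phi> + \<psi>) = ipre A \<phi> + ipre A \<psi>" for \<phi> \<psi>
      by (rule ell2_eqI)
         (auto simp: coord_ipre PiE_at_q clin_add[OF bops_clin[OF kb]] clin_add[OF bops_clin[OF A]])
    show "ipre A (c *\<^sub>C \<psi>) = c *\<^sub>C ipre A \<psi>" for c \<psi>
      by (rule ell2_eqI)
         (auto simp: coord_ipre PiE_at_q clin_scaleC[OF bops_clin[OF kb]] clin_scaleC[OF bops_clin[OF A]])
    fix \<psi>
    have "(norm (ipre A \<psi>))\<^sup>2 \<le> (K * norm \<psi>)\<^sup>2"
      by (rule norm_sq_leI) (simp only: coord_ipre ipre_sum_le[OF K])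
    then show "norm (ipre A \<psi>) \<le> K * norm \<psi>" using K(1) by (simp add: power2_le_iff_abs_le)
  qed
  show "ipre A (restr (PiE V B) \<psi>) = ipre A \<psi>" for \<psi>
    by (rule ell2_eqI) (simp add: coord_ipre PiE_at_q bops_restr_arg[OF kb])
  show "restr (PiE V B) (ipre A \<psi>) = ipre A \<psi>" for \<psi>
    by (rule ell2_eqI) (simp add: coord_ipre)
qed

text \<open>The summand for \<open>i\<close> is the restriction of \<open>ipre A \<psi>\<close> to
  the labels with \<open>i\<close> at \<open>q\<close>, so the series is a decomposition into
  fibres.\<close>

lemma ipre_has_sum:
  "((\<lambda>i. (ketbra B V q i 0 \<circ> A \<circ> ketbra B V q 0 i) \<psi>) has_sum ipre A \<psi>) (B q)"
proof -
  have in_B: "restr {z. z q = i} (ipre A \<psi>) = (ketbra B V q i 0 \<circ> A \<circ> ketbra B V q 0 i) \<psi>"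
    if "i \<in> B q" for i
    by (rule ell2_eqI) (auto simp: coord_ipre coord_ketbra[where B = B, OF q that B0])
  have out_B: "restr {z. z q = i} (ipre A \<psi>) = 0" if "i \<notin> B q" for i
    by (rule ell2_eqI) (use that PiE_at_q in \<open>auto simp: coord_ipre\<close>)
  have "((\<lambda>i. restr {z. z q = i} (ipre A \<psi>)) has_sum ipre A \<psi>) (B q)"
    using has_sum_restr_fibres[of "\<lambda>z. z q" "ipre A \<psi>"]
    by (rule has_sum_cong_neutral[THEN iffD1, rotated -1]) (auto simp: out_B)
  then show ?thesis by (rule has_sum_cong[THEN iffD1, rotated]) (rule in_B)
qed

lemma init_pre_eq: "init_pre B V q A = ipre A"
  by (rule ext) (simp only: init_pre_def infsumI[OF ipre_has_sum])

lemma init_pre_bops: "init_pre B V q A \<in> bops B V"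
  unfolding init_pre_eq by (rule ipre_bops)

lemma tr_init_mix:
  assumes v: "sq_summable_vecs v"
  shows "tr B V (init_pre B V q A \<circ> mix v) = tr B V (A \<circ> init_state B V q (mix v))"
proof -
  let ?f = "\<lambda>p. cinner (reset_vecs v p) (A (reset_vecs v p))"
  have zero: "A 0 = 0" by (rule clin_zero[OF bops_clin[OF A]])
  have expect: "cinner (v k) (ipre A (v k)) = (\<Sum>\<^sub>\<infinity>i. ?f (k, i))" for k
  proof -
    have "cinner (v k) (ipre A (v k)) =
        (\<Sum>\<^sub>\<infinity>i\<in>B q. cinner (v k) ((ketbra B V q i 0 \<circ> A \<circ> ketbra B V q 0 i) (v k)))"
      by (rule infsumI[symmetric]) (rule has_sum_bounded_linear[OF bounded_linear_cinner_right ipre_has_sum])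
    also have "\<dots> = (\<Sum>\<^sub>\<infinity>i. ?f (k, i))"
      by (rule infsum_cong_neutral) (auto simp: reset_vecs_def cinner_ketbra[OF B0] zero)
    finally show ?thesis .
  qed
  have sum: "(\<lambda>(k, i). ?f (k, i)) summable_on UNIV \<times> UNIV"
    using expectation_summable[OF bops_clin[OF A] sq_summable_reset_vecs[OF v]] by (simp add: case_prod_unfold)
  have "tr B V (init_pre B V q A \<circ> mix v) = (\<Sum>\<^sub>\<infinity>k. \<Sum>\<^sub>\<infinity>i. ?f (k, i))"
    unfolding init_pre_eq tr_mix[OF ipre_bops v] expect ..
  also have "\<dots> = (\<Sum>\<^sub>\<infinity>p. ?f p)"
    using infsum_Sigma'_banach[OF sum] by (simp add: case_prod_unfold)
  also have "\<dots> = tr B V (A \<circ> init_state B V q (mix v))"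
    unfolding init_state_mix[OF v] by (rule tr_mix[OF A sq_summable_reset_vecs[OF v], symmetric])
  finally show ?thesis .
qed

end

end

section \<open>States reachable by the transitions\<close>

text \<open>The index type absorbs further basis labels, so that it serves for all reachable states.\<close>

definition mixture :: "('v, 'b) qop \<Rightarrow> bool" where
  "mixture \<rho> \<longleftrightarrow> (\<exists>v :: nat \<times> 'b list \<Rightarrow> ('v \<Rightarrow> 'b) ell2. sq_summable_vecs v \<and> \<rho> = mix v)"

lemma mixture_density:
  fixes B :: "'v \<Rightarrow> 'b set"
  assumes "\<rho> \<in> partial_density B V" "countable (PiE V B)" "PiE V B \<noteq> {}"
  shows "mixture \<rho>"
proof -
  obtain w :: "nat \<Rightarrow> ('v \<Rightarrow> 'b) ell2" where w: "sq_summable_vecs w" "\<rho> = mix w"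
    using density_is_mix[OF assms] by blast
  define v where "v = (\<lambda>(n, l :: 'b list). if l = [] then w n else 0)"
  have "inj (\<lambda>n :: nat. (n, [] :: 'b list))" by (auto intro: injI)
  note r = mix_reindex[OF this, of v w]
  have "sq_summable_vecs v" "mix v = mix w" by (rule r; use w in \<open>auto simp: v_def image_iff\<close>)+
  then show ?thesis unfolding mixture_def using w(2) by metis
qed

lemma mixture_conj:
  assumes "clin E" "mixture \<rho>"
  shows "mixture (E \<circ> \<rho> \<circ> adj E)"
proof -
  obtain v :: "nat \<times> 'b list \<Rightarrow> ('a \<Rightarrow> 'b) ell2" where v: "sq_summable_vecs v" "\<rho> = mix v"
    using assms(2) unfolding mixture_def by blast
  then show ?thesis
    unfolding mixture_def v(2) conj_mix[OF assms(1) v(1)] using sq_summable_vecs_clin[OF assms(1) v(1)] by blast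
qed

lemma mixture_init_state:
  assumes "q \<in> V" "0 \<in> B q" "mixture \<rho>"
  shows "mixture (init_state B V q \<rho>)"
proof -
  obtain v :: "nat \<times> 'b list \<Rightarrow> ('a \<Rightarrow> 'b) ell2" where v: "sq_summable_vecs v" "\<rho> = mix v"
    using assms(3) unfolding mixture_def by blast
  let ?u = "reset_vecs B V q v"
  \<comment> \<open>Each initialisation pushes its basis label \<open>i\<close> onto the list;
    indices with an empty list are not hit and carry 0.\<close>
  define w where "w = (\<lambda>(n, l). case l of [] \<Rightarrow> 0 | i # l' \<Rightarrow> ?u ((n, l'), i))"
  have "inj (\<lambda>((n :: nat, l), i :: 'b). (n, i # l))" by (auto intro: injI)
  note r = mix_reindex[OF this, of w ?u]
  have out: "w j = 0" if "j \<notin> range (\<lambda>((n :: nat, l), i :: 'b). (n, i # l))" for j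
    using that by (auto simp: w_def image_iff split: prod.splits list.splits)
  have "sq_summable_vecs w" "mix w = mix ?u"
    by (rule r; use out sq_summable_reset_vecs[where B = B and V = V, OF assms(1,2) v(1)] in \<open>auto simp: w_def\<close>)+
  then show ?thesis
    unfolding mixture_def v(2) init_state_mix[where B = B and V = V, OF assms(1,2) v(1)] by metis
qed

section \<open>Standard proof outlines\<close>

text \<open>The Loewner order compares arbitrary functions, whereas monotonicity of the trace
  (\<open>tr_mix_mono\<close>) is for operators in \<open>bops\<close>.\<close>

definition below :: "('v \<Rightarrow> 'b set) \<Rightarrow> 'v set \<Rightarrow> ('v, 'b) qop \<Rightarrow> ('v, 'b) qop \<Rightarrow> bool" where
  "below B V A A' \<longleftrightarrow> A \<in> bops B V \<and> A' \<in> bops B V \<and> A \<sqsubseteq>\<^sub>L A'"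

lemma loewner_refl [simp]: "A \<sqsubseteq>\<^sub>L A"
  by (simp add: loewner_le_def positive_op_def)

lemma below_refl: "A \<in> bops B V \<Longrightarrow> below B V A A"
  by (simp add: below_def)

lemma below_trans:
  assumes "below B V A A'" "below B V A' A''"
  shows "below B V A A''"
proof -
  have "0 \<le> cinner \<psi> (A'' \<psi> - A \<psi>)" for \<psi>
  proof -
    have "0 \<le> cinner \<psi> (A' \<psi> - A \<psi>)" "0 \<le> cinner \<psi> (A'' \<psi> - A' \<psi>)"
      using assms by (simp_all add: below_def loewner_le_def positive_op_def)
    then show ?thesis by (simp add: less_eq_complex_def)
  qed
  then show ?thesis using assms by (simp add: below_def loewner_le_def positive_op_def)
qed

lemma tr_below: "below B V A A' \<Longrightarrow> mixture \<rho> \<Longrightarrow> tr B V (A \<circ> \<rho>) \<le> tr B V (A' \<circ> \<rho>)"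
  by (auto simp: below_def mixture_def intro: tr_mix_mono)

lemma tr_pull_op:
  assumes "ext B (set qs) V T \<in> bops B V" "A \<in> bops B V" "mixture \<rho>"
  shows "tr B V (pull_op B V qs T A \<circ> \<rho>) = tr B V (A \<circ> apply_op B V qs T \<rho>)"
  using assms by (auto simp: pull_op_def apply_op_def mixture_def tr_conj_mix)

lemma pull_op_bops:
  "ext B (set qs) V T \<in> bops B V \<Longrightarrow> A \<in> bops B V \<Longrightarrow> pull_op B V qs T A \<in> bops B V"
  unfolding pull_op_def by (intro bops_comp bops_adj)

lemma mixture_apply_op:
  "ext B (set qs) V T \<in> bops B V \<Longrightarrow> mixture \<rho> \<Longrightarrow> mixture (apply_op B V qs T \<rho>)"
  unfolding apply_op_def by (intro mixture_conj bops_clin)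

text \<open>In \<open>annotated B V as A S D\<close>, \<open>A\<close> is the assertion with which \<open>S\<close> is entered and \<open>as\<close> the block
  of predicates standing immediately before \<open>S\<close>. Following the structure of \<open>S\<close>, it is stable under
  the deletion of predicates, unlike the formation rules of \<^const>\<open>outline\<close>; the membership
  \<open>Inv C \<in> set as\<close> records that invariants cannot be deleted.\<close>

inductive annotated :: "('v \<Rightarrow> 'b::zero set) \<Rightarrow> 'v set \<Rightarrow> ('v, 'b) qop annot list \<Rightarrow>
    ('v, 'b) qop \<Rightarrow> ('v, ('v, 'b) qop) aprog \<Rightarrow> ('v, 'b) qop \<Rightarrow> bool"
  for B V where
  skip: "below B V A D \<Longrightarrow> annotated B V as A ASkip D"
| init: "\<lbrakk>q \<in> V; below B V A (init_pre B V q E); below B V E D\<rbrakk> \<Longrightarrow> annotated B V as A (AInit q) D"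
| unitary: "\<lbrakk>ext B (set qs) V U \<in> bops B V; below B V A (pull_op B V qs U E); below B V E D\<rbrakk> \<Longrightarrow>
     annotated B V as A (AUnitary qs U) D"
| seq: "\<lbrakk>annotated B V as A S\<^sub>1 E; annotated B V [] E S\<^sub>2 D\<rbrakk> \<Longrightarrow> annotated B V as A (ASeq S\<^sub>1 S\<^sub>2) D"
| measure: "\<lbrakk>\<forall>m<length bs. ext B (set qs) V (fst (bs ! m)) \<in> bops B V;
     below B V A (\<lambda>\<psi>. \<Sum>m<length bs. pull_op B V qs (fst (bs ! m)) (E m) \<psi>);
     \<forall>m<length bs. annotated B V [] (E m) (snd (bs ! m)) D\<rbrakk> \<Longrightarrow> annotated B V as A (AIf qs bs) D"
| loop: "\<lbrakk>ext B (set qs) V M0 \<in> bops B V; ext B (set qs) V M1 \<in> bops B V; Inv C \<in> set as; below B V A C;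
     C = (\<lambda>\<psi>. pull_op B V qs M0 F \<psi> + pull_op B V qs M1 E \<psi>); below B V F D; annotated B V [] E S C\<rbrakk> \<Longrightarrow>
     annotated B V as A (AWhile qs M0 M1 S) D"
| pre: "\<lbrakk>below B V A (pred_of b); annotated B V (as @ [b]) (pred_of b) S D\<rbrakk> \<Longrightarrow>
     annotated B V as A (APre b S) D"
| post: "\<lbrakk>annotated B V as A S (pred_of b); below B V (pred_of b) D\<rbrakk> \<Longrightarrow> annotated B V as A (APost S b) D"

inductive_cases annotated_seqE: "annotated B V as A (ASeq S\<^sub>1 S\<^sub>2) D"
inductive_cases annotated_measureE: "annotated B V as A (AIf qs bs) D"
inductive_cases annotated_loopE: "annotated B V as A (AWhile qs M0 M1 S) D"
inductive_cases annotated_preE: "annotated B V as A (APre b S) D"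
inductive_cases annotated_postE: "annotated B V as A (APost S b) D"

lemma annotated_bops: "annotated B V as A S D \<Longrightarrow> A \<in> bops B V"
  by (induction rule: annotated.induct) (auto simp: below_def)

text \<open>The rule of consequence on the left. The block may change too, as long as its invariants
  remain; deleting a plain predicate uses this freedom.\<close>

lemma annotated_strengthen:
  assumes "annotated B V as A S D" "below B V A' A" "\<forall>C. Inv C \<in> set as \<longrightarrow> Inv C \<in> set as'"
  shows "annotated B V as' A' S D"
  using assms
proof (induction arbitrary: A' as' rule: annotated.induct)
  case (measure bs qs A E D as)
  show ?case
    by (rule annotated.measure[of _ _ _ _ _ E])
       (use measure in \<open>auto intro: below_trans\<close>)
next
  case (loop qs M0 M1 C as A F E D S)
  show ?case
    by (rule annotated.loop[OF loop.hyps(1,2) _ _ loop.hyps(5-7)])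
       (use loop.prems loop.hyps(3,4) in \<open>auto intro: below_trans\<close>)
next
  case (pre A b as S D)
  \<comment> \<open>\<open>b\<close> stays the entry assertion of \<open>S\<close>; the new
    assertion is absorbed by the comparison with \<open>b\<close>.\<close>
  have "annotated B V (as' @ [b]) (pred_of b) S D"
    using pre.prems pre.hyps by (intro pre.IH) (auto simp: below_def intro: below_refl)
  then show ?case using pre.hyps(1) pre.prems(1) by (blast intro: annotated.pre below_trans)
qed (blast intro: annotated.intros below_trans)+

lemma annotated_weaken:
  assumes "annotated B V as A S D" "below B V D D'"
  shows "annotated B V as A S D'"
  using assms
proof (induction arbitrary: D' rule: annotated.induct)
  case (measure bs qs A E D as)
  then show ?case by (intro annotated.measure[of _ _ _ _ _ E]) auto
next
  case (loop qs M0 M1 C as A F E D S)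
  then show ?case by (intro annotated.loop[of _ _ _ _ _ C _ _ F E]) (auto intro: below_trans)
qed (blast intro: annotated.intros below_trans)+

lemma erase_strip: "erase S S' \<Longrightarrow> strip S' = strip S"
proof (induction rule: erase.induct)
  case (7 bs bs' qs)
  from 7(1) have len: "length bs = length bs'" by (metis length_map)
  have "map (map_prod id strip) bs' = map (map_prod id strip) bs"
  proof (rule nth_equalityI)
    fix m assume "m < length (map (map_prod id strip) bs')"
    then have m: "m < length bs" "m < length bs'" using len by auto
    have "fst (bs ! m) = fst (bs' ! m)" using 7(1) m by (metis nth_map)
    then show "map (map_prod id strip) bs' ! m = map (map_prod id strip) bs ! m"
      using 7(2) m by (simp add: map_prod_def case_prod_unfold)
  qed (simp add: len)
  then show ?case by simp
qed auto

text \<open>When an intermediate assertion disappears, the comparisons on its two sides combine by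
  transitivity.\<close>

lemma annotated_erase:
  assumes "erase S S'" "annotated B V as A S D"
  shows "annotated B V as A S' D"
  using assms
proof (induction arbitrary: as A D rule: erase.induct)
  case (2 S S' X)
  from 2(3) have *: "below B V A X" "annotated B V (as @ [Plain X]) X S D" by (auto elim: annotated_preE)
  \<comment> \<open>Dropping \<open>Plain X\<close> from the block loses no invariant.\<close>
  have "annotated B V as A S D" by (rule annotated_strengthen[OF *(2,1)]) simp
  then show ?case by (rule 2(2))
next
  case (3 S S' X)
  from 3(3) have "annotated B V as A S X" "below B V X D" by (auto elim: annotated_postE)
  with 3(2) show ?case by (auto intro: annotated_weaken)
next
  case (7 bs bs' qs)
  from 7(1) have len: "length bs' = length bs" by (metis length_map)
  have fst: "fst (bs' ! m) = fst (bs ! m)" if "m < length bs" for m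
    using 7(1) len that by (metis nth_map)
  from 7(3) show ?case
  proof (rule annotated_measureE)
    fix E
    assume *: "\<forall>m<length bs. ext B (set qs) V (fst (bs ! m)) \<in> bops B V"
      "below B V A (\<lambda>\<psi>. \<Sum>m<length bs. pull_op B V qs (fst (bs ! m)) (E m) \<psi>)"
      "\<forall>m<length bs. annotated B V [] (E m) (snd (bs ! m)) D"
    have "(\<lambda>\<psi>. \<Sum>m<length bs'. pull_op B V qs (fst (bs' ! m)) (E m) \<psi>) =
        (\<lambda>\<psi>. \<Sum>m<length bs. pull_op B V qs (fst (bs ! m)) (E m) \<psi>)"
      unfolding len by (intro ext sum.cong) (auto simp: fst)
    then show ?thesis
      using * 7(2) len fst by (intro annotated.measure[of _ _ _ _ _ E]) auto
  qed
qed (blast intro: annotated.intros elim: annotated_preE annotated_postE annotated_seqE annotated_loopE)+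

text \<open>The formation rules other than consequence and deletion match predicates exactly, so
  there the comparisons in \<open>annotated\<close> are reflexive. \<open>wf_prog\<close> and the
  inclusion of the variables in \<open>V\<close> ensure that the extended operators lie in
  \<open>bops B V\<close>.\<close>

lemma outline_annotated:
  fixes B :: "'v \<Rightarrow> 'b::zero set"
  assumes B0: "\<And>q. 0 \<in> B q"
    and "outline B V a S D" "wf_prog B (strip S)" "vars (strip S) \<subseteq> V"
  shows "D \<in> bops B V \<and> annotated B V [a] (pred_of a) S D"
  using assms(2-)
proof (induction rule: outline.induct)
  case (skip A)
  then show ?case by (auto simp: qpred_def intro: annotated.skip below_refl)
next
  case (init A q)
  then have "A \<in> bops B V" "q \<in> V" by (auto simp: qpred_def)
  then show ?case using init_pre_bops[where B = B, OF _ B0] by (auto intro!: annotated.init below_refl)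
next
  case (unitary A qs U)
  then have "A \<in> bops B V" "ext B (set qs) V U \<in> bops B V"
    by (auto simp: qpred_def unitary_on_def intro: ext_bops)
  then show ?case by (auto intro!: annotated.unitary below_refl pull_op_bops)
next
  case (seq a S\<^sub>1 b S\<^sub>2 C)
  then have "annotated B V [b] (pred_of b) S\<^sub>2 C" "annotated B V [a] (pred_of a) S\<^sub>1 (pred_of b)" "C \<in> bops B V"
    by auto
  then show ?case by (auto intro!: annotated.seq annotated.pre below_refl annotated_bops)
next
  case (measure bs D qs)
  let ?bs = "map (\<lambda>(M, a, S). (M, APre a S)) bs"
  let ?M = "\<lambda>m. fst (bs ! m)" and ?E = "\<lambda>m. pred_of (fst (snd (bs ! m)))" and ?S = "\<lambda>m. snd (snd (bs ! m))"
  from measure.prems have wf: "measurement_on B (set qs) (map fst bs)" "set qs \<subseteq> V"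
    by (auto simp: comp_def case_prod_unfold)
  have br: "D \<in> bops B V \<and> annotated B V [fst (snd (bs ! m))] (?E m) (?S m) D" if m: "m < length bs" for m
  proof -
    obtain M a S where MaS: "bs ! m = (M, a, S)" by (metis prod_cases3)
    then have "(M, a, S) \<in> set bs" using m by (metis nth_mem)
    then have "wf_prog B (strip S)" "vars (strip S) \<subseteq> V"
      using measure.prems by (force simp: list_all_iff)+
    then show ?thesis using measure.IH \<open>(M, a, S) \<in> set bs\<close> MaS by auto
  qed
  have ext: "ext B (set qs) V (?M m) \<in> bops B V" if "m < length bs" for m
    using wf that by (auto simp: measurement_on_def intro!: ext_bops)
  \<comment> \<open>That \<open>D\<close> is in \<open>bops B V\<close> can only come from a branch.
    A measurement without outcomes would sum to 0, while the identity fixes the basis vector with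
    all labels 0.\<close>
  have "bs \<noteq> []"
  proof
    assume "bs = []"
    then have "idop B (set qs) (ket (restrict (\<lambda>_. 0) (set qs))) = 0"
      using wf(1) by (auto simp: measurement_on_def dest: fun_cong)
    then have "coord (restr (PiE (set qs) B) (ket (restrict (\<lambda>_. 0) (set qs)))) (restrict (\<lambda>_. 0) (set qs)) = 0"
      by (simp add: idop_eq_restr)
    then show False using B0 by (simp split: if_splits)
  qed
  then have D: "D \<in> bops B V" using br[of 0] by simp
  have E: "?E m \<in> bops B V" if "m < length bs" for m
    using br[OF that] annotated_bops by blast
  have "(\<lambda>\<psi>. \<Sum>(M, a, S)\<leftarrow>bs. pull_op B V qs M (pred_of a) \<psi>) =
      (\<lambda>\<psi>. \<Sum>m<length ?bs. pull_op B V qs (fst (?bs ! m)) (?E m) \<psi>)"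
    by (rule HOL.ext) (simp add: sum_list_sum_nth case_prod_unfold atLeast0LessThan)
  moreover have "annotated B V [a] (\<lambda>\<psi>. \<Sum>m<length ?bs. pull_op B V qs (fst (?bs ! m)) (?E m) \<psi>) (AIf qs ?bs) D" for a
  proof (rule annotated.measure[of _ _ _ _ _ ?E])
    show "below B V (\<lambda>\<psi>. \<Sum>m<length ?bs. pull_op B V qs (fst (?bs ! m)) (?E m) \<psi>)
        (\<lambda>\<psi>. \<Sum>m<length ?bs. pull_op B V qs (fst (?bs ! m)) (?E m) \<psi>)"
      by (intro below_refl bops_sum pull_op_bops) (auto simp: ext E case_prod_unfold)
    show "\<forall>m<length ?bs. annotated B V [] (?E m) (snd (?bs ! m)) D"
    proof (intro allI impI)
      fix m assume "m < length ?bs"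
      then show "annotated B V [] (?E m) (snd (?bs ! m)) D"
        using br[of m] E[of m] by (auto simp: case_prod_unfold intro!: annotated.pre below_refl)
    qed
  qed (auto simp: ext case_prod_unfold)
  ultimately show ?case using D by simp
next
  case (loop A b S C qs M0 M1)
  then have wf: "M0 \<in> bops B (set qs)" "M1 \<in> bops B (set qs)" "set qs \<subseteq> V"
    and IH: "C \<in> bops B V" "annotated B V [b] (pred_of b) S C" and A: "A \<in> bops B V"
    by (auto simp: measurement_on_def qpred_def)
  have b: "pred_of b \<in> bops B V" by (rule annotated_bops[OF IH(2)])
  have "annotated B V [] (pred_of b) (APost (APre b S) (Plain C)) C"
    using IH b by (auto intro!: annotated.post annotated.pre below_refl)
  then have "annotated B V [Inv C] C (AWhile qs M0 M1 (APost (APre b S) (Plain C))) A"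
    by (intro annotated.loop[OF _ _ _ _ loop.hyps(3)]) (use wf IH A in \<open>auto intro: ext_bops below_refl\<close>)
  then show ?case using A by simp
next
  case (conseq A a' S D' D)
  then have IH: "D' \<in> bops B V" "annotated B V [a'] (pred_of a') S D'"
    and AD: "A \<in> bops B V" "D \<in> bops B V" by (auto simp: qpred_def)
  have a': "pred_of a' \<in> bops B V" by (rule annotated_bops[OF IH(2)])
  \<comment> \<open>Consequence puts two predicates into one block; one of them has to be deleted
    before the outline is standard.\<close>
  have "annotated B V ([Plain A] @ [a']) (pred_of a') S D'"
    by (rule annotated_strengthen[OF IH(2) below_refl[OF a']]) simp
  then show ?case
    using conseq.hyps AD IH(1) a' by (auto simp: below_def intro!: annotated.post annotated.pre)
next
  case (delete a S D S')
  then show ?case using erase_strip[OF delete.hyps(2)] annotated_erase[OF delete.hyps(2)] by auto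
qed

text \<open>Verification conditions on the bare program. In \<open>seq\<close>, the equation of
  \<open>asrt []\<close> and \<open>asrt [Fst]\<close> matches the fact that \<open>at_prog\<close>
  gives both occurrences the same program. In \<open>loop\<close>, \<open>asrt []\<close> is also
  the postcondition of the body, since a finished body leaves the configuration at the loop
  itself.\<close>

inductive verified :: "('v \<Rightarrow> 'b::zero set) \<Rightarrow> 'v set \<Rightarrow> (dir list \<Rightarrow> ('v, 'b) qop) \<Rightarrow>
    ('v, ('v, 'b) qop) prog \<Rightarrow> ('v, 'b) qop \<Rightarrow> bool"
  for B V where
  skip: "below B V (asrt []) D \<Longrightarrow> verified B V asrt Skip D"
| init: "\<lbrakk>q \<in> V; below B V (asrt []) (init_pre B V q E); below B V E D\<rbrakk> \<Longrightarrow> verified B V asrt (Init q) D"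
| unitary: "\<lbrakk>ext B (set qs) V U \<in> bops B V; below B V (asrt []) (pull_op B V qs U E); below B V E D\<rbrakk> \<Longrightarrow>
     verified B V asrt (Unitary qs U) D"
| seq: "\<lbrakk>asrt [] = asrt [Fst]; verified B V (\<lambda>p. asrt (Fst # p)) P (asrt [Snd]);
     verified B V (\<lambda>p. asrt (Snd # p)) Q D\<rbrakk> \<Longrightarrow> verified B V asrt (Seq P Q) D"
| measure: "\<lbrakk>\<forall>m<length bs. ext B (set qs) V (fst (bs ! m)) \<in> bops B V;
     below B V (asrt []) (\<lambda>\<psi>. \<Sum>m<length bs. pull_op B V qs (fst (bs ! m)) (E m) \<psi>);
     \<forall>m<length bs. below B V (E m) (asrt [Branch m]);
     \<forall>m<length bs. verified B V (\<lambda>p. asrt (Branch m # p)) (snd (bs ! m)) D\<rbrakk> \<Longrightarrow> verified B V asrt (If qs bs) D"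
| loop: "\<lbrakk>ext B (set qs) V M0 \<in> bops B V; ext B (set qs) V M1 \<in> bops B V;
     asrt [] = (\<lambda>\<psi>. pull_op B V qs M0 F \<psi> + pull_op B V qs M1 E \<psi>); below B V F D;
     below B V E (asrt [Body]); verified B V (\<lambda>p. asrt (Body # p)) P (asrt [])\<rbrakk> \<Longrightarrow>
     verified B V asrt (While qs M0 M1 P) D"

lemma verified_weaken:
  assumes "verified B V asrt P D" "below B V D D'"
  shows "verified B V asrt P D'"
  using assms
proof (induction arbitrary: D' rule: verified.induct)
  case (measure bs qs asrt E D)
  then show ?case by (intro verified.measure[of _ _ _ _ _ E]) auto
next
  case (loop qs M0 M1 asrt F E D P)
  then show ?case by (intro verified.loop[of _ _ _ _ _ _ F E]) (auto intro: below_trans)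
qed (blast intro: verified.intros below_trans)+

lemma preceding_APre: "preceding as (APre b S) p = preceding (as @ [b]) S p"
  by (cases p) auto

lemma preceding_APost: "preceding as (APost S b) p = preceding as S p"
  by (cases p) auto

text \<open>The second conclusion links the entry assertion, whose predicate may have been deleted,
  to the predicate that the text retains; in a sequence it weakens the postcondition of the first
  component to the assertion of the second.\<close>

lemma annotated_verified:
  assumes "annotated B V as A S D" "as = [] \<or> (\<exists>b. as = [b] \<and> pred_of b = A)"
    "\<forall>p. subprog (strip S) p \<noteq> None \<longrightarrow> length (preceding as S p) = 1"
  shows "verified B V (\<lambda>p. pred_of (hd (preceding as S p))) (strip S) D \<and>
    below B V A (pred_of (hd (as @ leading S)))"
  using assms
proof (induction rule: annotated.induct)
  case (skip A D as)
  from skip.prems(2)[rule_format, of "[]"] skip show ?case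
    by (auto simp: below_def intro!: verified.skip)
next
  case (init q A E D as)
  from init.prems(2)[rule_format, of "[]"] init show ?case
    by (auto simp: below_def intro!: verified.init[of _ _ _ _ E] below_refl)
next
  case (unitary qs U A E D as)
  from unitary.prems(2)[rule_format, of "[]"] unitary show ?case
    by (auto simp: below_def intro!: verified.unitary[of _ _ _ _ _ E] below_refl)
next
  case (seq as A S\<^sub>1 E S\<^sub>2 D)
  have l1: "length (preceding as S\<^sub>1 p) = 1" if "subprog (strip S\<^sub>1) p \<noteq> None" for p
    using seq.prems(2)[rule_format, of "Fst # p"] that by simp
  have l2: "length (preceding [] S\<^sub>2 p) = 1" if "subprog (strip S\<^sub>2) p \<noteq> None" for p
    using seq.prems(2)[rule_format, of "Snd # p"] that by simp
  have 1: "verified B V (\<lambda>p. pred_of (hd (preceding as S\<^sub>1 p))) (strip S\<^sub>1) E"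
    "below B V A (pred_of (hd (as @ leading S\<^sub>1)))"
    using seq.IH(1) seq.prems(1) l1 by auto
  have 2: "verified B V (\<lambda>p. pred_of (hd (preceding [] S\<^sub>2 p))) (strip S\<^sub>2) D"
    "below B V E (pred_of (hd (leading S\<^sub>2)))"
    using seq.IH(2) l2 by auto
  show ?case using verified_weaken[OF 1(1) 2(2)] 1(2) 2(1) by (auto intro!: verified.seq)
next
  case (measure bs qs A E D as)
  have len: "length (preceding [] (snd (bs ! m)) p) = 1"
    if "m < length bs" "subprog (strip (snd (bs ! m))) p \<noteq> None" for m p
    using measure.prems(2)[rule_format, of "Branch m # p"] that by simp
  have IH: "verified B V (\<lambda>p. pred_of (hd (preceding [] (snd (bs ! m)) p))) (strip (snd (bs ! m))) D"
    "below B V (E m) (pred_of (hd (leading (snd (bs ! m)))))" if "m < length bs" for m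
    using measure.IH that len by auto
  obtain b where b: "as = [b]" "pred_of b = A"
    using measure.prems(2)[rule_format, of "[]"] measure.prems(1) by auto
  have "verified B V (\<lambda>p. pred_of (hd (preceding as (AIf qs bs) p))) (If qs (map (map_prod id strip) bs)) D"
  proof (rule verified.measure[of _ _ _ _ _ E])
    show "below B V (pred_of (hd (preceding as (AIf qs bs) [])))
        (\<lambda>\<psi>. \<Sum>m<length (map (map_prod id strip) bs). pull_op B V qs (fst (map (map_prod id strip) bs ! m)) (E m) \<psi>)"
      using measure.hyps(2) b by simp
  qed (use measure.hyps IH in auto)
  then show ?case using b measure.hyps(2) by (auto simp: below_def intro: below_refl)
next
  case (loop qs M0 M1 C as A F E D S)
  obtain b where b: "as = [b]" "pred_of b = A"
    using loop.prems(2)[rule_format, of "[]"] loop.prems(1) by auto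
  \<comment> \<open>The block has a single member and contains \<open>Inv C\<close>, so the entry
    assertion is the invariant itself.\<close>
  then have AC: "A = C" "b = Inv C" using loop.hyps(3) by auto
  have len: "length (preceding [] S p) = 1" if "subprog (strip S) p \<noteq> None" for p
    using loop.prems(2)[rule_format, of "Body # p"] that by simp
  then have IH: "verified B V (\<lambda>p. pred_of (hd (preceding [] S p))) (strip S) C"
    "below B V E (pred_of (hd (leading S)))"
    using loop.IH by auto
  have "verified B V (\<lambda>p. pred_of (hd (preceding as (AWhile qs M0 M1 S) p))) (While qs M0 M1 (strip S)) D"
    by (rule verified.loop[OF loop.hyps(1,2) _ loop.hyps(6), of _ E]) (use IH b AC loop.hyps(5) in auto)
  then show ?case using loop.hyps(4) b AC by simp
next
  case (pre A b as S D)
  \<comment> \<open>With \<open>b\<close> in the block, length 1 leaves no room for a predicate in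
    front of it.\<close>
  from pre.prems(2)[rule_format, of "[]"] have as: "as = []" by simp
  have "verified B V (\<lambda>p. pred_of (hd (preceding (as @ [b]) S p))) (strip S) D"
    using pre.IH pre.prems(2) as by (simp add: preceding_APre)
  then show ?case using pre.hyps(1) as by (simp add: preceding_APre)
next
  case (post as A S b D)
  then have "verified B V (\<lambda>p. pred_of (hd (preceding as S p))) (strip S) (pred_of b) \<and>
      below B V A (pred_of (hd (as @ leading S)))"
    by (simp add: preceding_APost)
  then show ?case using post.hyps(2) by (auto simp: preceding_APost intro: verified_weaken)
qed

section \<open>Executions\<close>

text \<open>Configurations are tagged with the occurrence at which they stand, since an ensemble may
  contain equal configurations at different occurrences.\<close>

fun tracked :: "('v, ('v, 'b) qop) prog \<Rightarrow> ('v, 'b) config \<times> dir list \<Rightarrow> bool" where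
  "tracked P ((R, \<sigma>), p) \<longleftrightarrow> mixture \<sigma> \<and> (R = None \<or> (subprog P p \<noteq> None \<and> R = Some (at_prog p P)))"

fun weight :: "('v \<Rightarrow> 'b set) \<Rightarrow> 'v set \<Rightarrow> (dir list \<Rightarrow> ('v, 'b) qop) \<Rightarrow> ('v, 'b) qop \<Rightarrow>
    ('v, 'b) config \<times> dir list \<Rightarrow> complex" where
  "weight B V asrt D ((R, \<sigma>), p) = tr B V ((if R = None then D else asrt p) \<circ> \<sigma>)"

text \<open>Both claims for one ensemble, with \<open>w\<close> standing for the trace at the start;
  in this form they are preserved by every transition.\<close>

definition dominated :: "('v \<Rightarrow> 'b set) \<Rightarrow> 'v set \<Rightarrow> (dir list \<Rightarrow> ('v, 'b) qop) \<Rightarrow>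
    ('v, ('v, 'b) qop) prog \<Rightarrow> ('v, 'b) qop \<Rightarrow> complex \<Rightarrow> ('v, 'b) config multiset \<Rightarrow> bool" where
  "dominated B V asrt P D w \<A> \<longleftrightarrow> (\<exists>M. image_mset fst M = \<A> \<and> (\<forall>c\<in>#M. tracked P c) \<and>
     w \<le> (\<Sum>c\<in>#M. weight B V asrt D c))"

lemma dominated_singleton:
  "\<lbrakk>mixture \<sigma>; R = None \<or> (subprog P p \<noteq> None \<and> R = Some (at_prog p P));
    w \<le> tr B V ((if R = None then D else asrt p) \<circ> \<sigma>)\<rbrakk> \<Longrightarrow> dominated B V asrt P D w {#(R, \<sigma>)#}"
  unfolding dominated_def by (rule exI[of _ "{#((R, \<sigma>), p)#}"]) auto

text \<open>Lifts a transition of a component to the surrounding program: \<open>f\<close> rewrites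
  tagged configurations, and \<open>g\<close> is its effect once tags are forgotten.\<close>

lemma dominated_map:
  assumes "dominated B V asrt P D w \<A>"
    and f: "\<And>c. tracked P c \<Longrightarrow> tracked P' (f c) \<and> weight B V asrt' D' (f c) = weight B V asrt D c \<and>
      fst (f c) = g (fst c)"
  shows "dominated B V asrt' P' D' w (image_mset g \<A>)"
proof -
  obtain M where M: "image_mset fst M = \<A>" "\<forall>c\<in>#M. tracked P c" "w \<le> (\<Sum>c\<in>#M. weight B V asrt D c)"
    using assms(1) unfolding dominated_def by blast
  have "image_mset fst (image_mset f M) = image_mset g \<A>"
    unfolding M(1)[symmetric] multiset.map_comp using f M(2) by (intro image_mset_cong) auto
  moreover have "(\<Sum>c\<in>#image_mset f M. weight B V asrt' D' c) = (\<Sum>c\<in>#M. weight B V asrt D c)"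
    unfolding multiset.map_comp using f M(2) by (intro arg_cong[of _ _ sum_mset] image_mset_cong) auto
  ultimately show ?thesis
    unfolding dominated_def using f M(2,3) by (intro exI[of _ "image_mset f M"]) auto
qed

inductive_cases config_step_SeqE: "config_step B V (Some (Seq P Q), \<rho>) \<A>"
inductive_cases config_step_SkipE: "config_step B V (Some Skip, \<rho>) \<A>"
inductive_cases config_step_InitE: "config_step B V (Some (Init q), \<rho>) \<A>"
inductive_cases config_step_UnitaryE: "config_step B V (Some (Unitary qs U), \<rho>) \<A>"
inductive_cases config_step_IfE: "config_step B V (Some (If qs bs), \<rho>) \<A>"
inductive_cases config_step_WhileE: "config_step B V (Some (While qs M0 M1 P), \<rho>) \<A>"

text \<open>By induction on the verification conditions: at the path \<open>[]\<close> the construct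
  itself makes the transition, and at longer paths a transition of a component is lifted by
  \<open>dominated_map\<close>.\<close>

lemma verified_step:
  fixes B :: "'v \<Rightarrow> 'b::zero set"
  assumes B0: "\<And>q. 0 \<in> B q"
    and "verified B V asrt P D" "subprog P p \<noteq> None"
      "config_step B V (Some (at_prog p P), \<rho>) \<A>" "mixture \<rho>"
  shows "dominated B V asrt P D (tr B V (asrt p \<circ> \<rho>)) \<A>"
  using assms(2-)
proof (induction arbitrary: p \<A> rule: verified.induct)
  case (skip asrt D)
  then have "p = []" by (cases p) auto
  moreover from skip.prems this have "\<A> = {#(None, \<rho>)#}" by (auto elim: config_step_SkipE)
  ultimately show ?case using tr_below[OF skip.hyps skip.prems(3)] skip.prems(3)
    by (simp only:) (intro dominated_singleton, auto simp: o_def)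
next
  case (init q asrt E D)
  then have p: "p = []" by (cases p) auto
  from init.prems p have \<A>: "\<A> = {#(None, init_state B V q \<rho>)#}" by (auto elim: config_step_InitE)
  have mix: "mixture (init_state B V q \<rho>)"
    using mixture_init_state[where B = B, OF init.hyps(1) B0 init.prems(3)] .
  have E: "E \<in> bops B V" using init.hyps(3) by (simp add: below_def)
  obtain v :: "nat \<times> 'b list \<Rightarrow> ('v \<Rightarrow> 'b) ell2" where v: "sq_summable_vecs v" "\<rho> = mix v"
    using init.prems(3) unfolding mixture_def by blast
  have "tr B V (asrt [] \<circ> \<rho>) \<le> tr B V (init_pre B V q E \<circ> \<rho>)"
    by (rule tr_below[OF init.hyps(2) init.prems(3)])
  also have "\<dots> = tr B V (E \<circ> init_state B V q \<rho>)"
    unfolding v(2) by (rule tr_init_mix[where B = B, OF init.hyps(1) B0 E v(1)])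
  also have "\<dots> \<le> tr B V (D \<circ> init_state B V q \<rho>)" by (rule tr_below[OF init.hyps(3) mix])
  finally show ?case unfolding \<A> p using mix by (intro dominated_singleton) (auto simp: o_def)
next
  case (unitary qs U asrt E D)
  then have p: "p = []" by (cases p) auto
  from unitary.prems p have \<A>: "\<A> = {#(None, apply_op B V qs U \<rho>)#}" by (auto elim: config_step_UnitaryE)
  note mix = mixture_apply_op[OF unitary.hyps(1) unitary.prems(3)]
  have E: "E \<in> bops B V" using unitary.hyps(3) by (simp add: below_def)
  have "tr B V (asrt [] \<circ> \<rho>) \<le> tr B V (pull_op B V qs U E \<circ> \<rho>)"
    by (rule tr_below[OF unitary.hyps(2) unitary.prems(3)])
  also have "\<dots> = tr B V (E \<circ> apply_op B V qs U \<rho>)" by (rule tr_pull_op[OF unitary.hyps(1) E unitary.prems(3)])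
  also have "\<dots> \<le> tr B V (D \<circ> apply_op B V qs U \<rho>)" by (rule tr_below[OF unitary.hyps(3) mix])
  finally show ?case unfolding \<A> p using mix by (intro dominated_singleton) (auto simp: o_def)
next
  case (seq asrt P Q D)
  have fst: "dominated B V asrt (Seq P Q) D (tr B V (asrt (Fst # p) \<circ> \<rho>)) \<A>"
    if "subprog P p \<noteq> None" "config_step B V (Some (Seq (at_prog p P) Q), \<rho>) \<A>" for p
  proof -
    from that(2) obtain \<A>' where \<A>': "\<A> = image_mset (\<lambda>(R, \<sigma>). (seq_rest R Q, \<sigma>)) \<A>'"
      "config_step B V (Some (at_prog p P), \<rho>) \<A>'" by (auto elim: config_step_SeqE)
    \<comment> \<open>A finished \<open>P\<close> hands over to \<open>Q\<close>, the occurrence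
      \<open>[Snd]\<close>, whose assertion is the postcondition of \<open>P\<close>.\<close>
    let ?f = "\<lambda>((R, \<sigma>), r). ((seq_rest R Q, \<sigma>), if R = None then [Snd] else Fst # r)"
    show ?thesis
      unfolding \<A>'(1)
    proof (rule dominated_map[OF seq.IH(1)[OF that(1) \<A>'(2) seq.prems(3)], of _ ?f])
      fix c :: "('v, 'b) config \<times> dir list"
      assume "tracked P c"
      moreover obtain R \<sigma> r where "c = ((R, \<sigma>), r)" by (metis prod.collapse)
      ultimately show "tracked (Seq P Q) (?f c) \<and> weight B V asrt D (?f c) =
          weight B V (\<lambda>p. asrt (Fst # p)) (asrt [Snd]) c \<and> fst (?f c) = (\<lambda>(R, \<sigma>). (seq_rest R Q, \<sigma>)) (fst c)"
        by (cases R) auto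
    qed
  qed
  from seq.prems(1) consider "p = []" | p' where "p = Fst # p'" "subprog P p' \<noteq> None"
    | p' where "p = Snd # p'" "subprog Q p' \<noteq> None"
    by (cases p; cases "hd p") auto
  then show ?case
  proof cases
    case 1
    \<comment> \<open>A composition makes the transitions of its first component, so
      \<open>[]\<close> is treated as \<open>[Fst]\<close>.\<close>
    then show ?thesis using fst[of "[]"] seq.prems(2) seq.hyps(1) by (simp add: o_def)
  next
    case 2
    then show ?thesis using fst[of p'] seq.prems(2) by (simp add: o_def)
  next
    case (3 p')
    have "dominated B V asrt (Seq P Q) D (tr B V (asrt (Snd # p') \<circ> \<rho>)) (image_mset id \<A>)"
      using 3 seq.prems
      by (intro dominated_map[OF seq.IH(2)[OF 3(2), of \<A>], of _ "\<lambda>(C, r). (C, Snd # r)"]) auto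
    then show ?thesis using 3 by (simp add: o_def)
  qed
next
  case (measure bs qs asrt E D)
  from measure.prems(1) consider "p = []"
    | m p' where "p = Branch m # p'" "m < length bs" "subprog (snd (bs ! m)) p' \<noteq> None"
    by (cases p; cases "hd p") (auto split: if_splits)
  then show ?case
  proof cases
    case 1
    let ?\<sigma> = "\<lambda>m. apply_op B V qs (fst (bs ! m)) \<rho>"
    define M where "M = image_mset (\<lambda>m. ((Some (snd (bs ! m)), ?\<sigma> m), [Branch m])) (mset_set {..<length bs})"
    have "\<A> = mset (map (\<lambda>(M, P). (Some P, apply_op B V qs M \<rho>)) bs)"
      using measure.prems(2) 1 by (auto elim: config_step_IfE)
    also have "\<dots> = mset (map (\<lambda>m. (Some (snd (bs ! m)), ?\<sigma> m)) [0..<length bs])"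
      by (intro arg_cong[of _ _ mset] nth_equalityI) (auto simp: case_prod_unfold)
    also have "\<dots> = image_mset fst M"
      by (simp add: M_def multiset.map_comp comp_def mset_upt atLeast0LessThan)
    finally have \<A>: "image_mset fst M = \<A>" ..
    have mix: "mixture (?\<sigma> m)" if "m < length bs" for m
      using measure.hyps(1) that measure.prems(3) by (intro mixture_apply_op) auto
    have E: "E m \<in> bops B V" if "m < length bs" for m
      using measure.hyps(3) that by (simp add: below_def)
    obtain v :: "nat \<times> 'b list \<Rightarrow> ('v \<Rightarrow> 'b) ell2" where v: "sq_summable_vecs v" "\<rho> = mix v"
      using measure.prems(3) unfolding mixture_def by blast
    have "tr B V (asrt [] \<circ> \<rho>) \<le> tr B V ((\<lambda>\<psi>. \<Sum>m<length bs. pull_op B V qs (fst (bs ! m)) (E m) \<psi>) \<circ> \<rho>)"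
      by (rule tr_below[OF measure.hyps(2) measure.prems(3)])
    also have "\<dots> = (\<Sum>m<length bs. tr B V (pull_op B V qs (fst (bs ! m)) (E m) \<circ> \<rho>))"
      unfolding v(2) using measure.hyps(1) E by (intro tr_mix_sum v(1) pull_op_bops) auto
    also have "\<dots> = (\<Sum>m<length bs. tr B V (E m \<circ> ?\<sigma> m))"
      using measure.hyps(1) E measure.prems(3) by (intro sum.cong tr_pull_op) auto
    also have "\<dots> \<le> (\<Sum>m<length bs. tr B V (asrt [Branch m] \<circ> ?\<sigma> m))"
      using measure.hyps(3) mix by (intro sum_mono tr_below) auto
    also have "\<dots> = (\<Sum>c\<in>#M. weight B V asrt D c)"
      by (simp add: M_def multiset.map_comp comp_def sum_unfold_sum_mset)
    finally show ?thesis
      unfolding dominated_def 1 using \<A> mix by (intro exI[of _ M]) (auto simp: M_def)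
  next
    case (2 m p')
    have IH: "dominated B V (\<lambda>p. asrt (Branch m # p)) (snd (bs ! m)) D (tr B V (asrt (Branch m # p') \<circ> \<rho>)) \<A>"
      using measure.IH measure.prems 2 by (auto simp: o_def)
    have "dominated B V asrt (If qs bs) D (tr B V (asrt (Branch m # p') \<circ> \<rho>)) (image_mset id \<A>)"
      using 2(2) by (intro dominated_map[OF IH, of _ "\<lambda>(C, r). (C, Branch m # r)"]) auto
    then show ?thesis using 2 by (simp add: o_def)
  qed
next
  case (loop qs M0 M1 asrt F E D P)
  let ?W = "While qs M0 M1 P"
  from loop.prems(1) consider "p = []" | p' where "p = Body # p'" "subprog P p' \<noteq> None"
    by (cases p; cases "hd p") auto
  then show ?case
  proof cases
    case 1
    let ?\<sigma>0 = "apply_op B V qs M0 \<rho>" and ?\<sigma>1 = "apply_op B V qs M1 \<rho>"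
    \<comment> \<open>The tag of a terminated configuration is arbitrary. The other one is at
      \<open>[Body]\<close>, since \<open>at_prog [Body] ?W\<close> is
      \<open>Seq P ?W\<close>.\<close>
    define M where "M = {#((None, ?\<sigma>0), []), ((Some (Seq P ?W), ?\<sigma>1), [Body])#}"
    have \<A>: "image_mset fst M = \<A>"
      using loop.prems(2) 1 by (auto simp: M_def elim: config_step_WhileE)
    note mix = mixture_apply_op[OF loop.hyps(1) loop.prems(3)] mixture_apply_op[OF loop.hyps(2) loop.prems(3)]
    have FE: "F \<in> bops B V" "E \<in> bops B V" using loop.hyps(4,5) by (auto simp: below_def)
    obtain v :: "nat \<times> 'b list \<Rightarrow> ('v \<Rightarrow> 'b) ell2" where v: "sq_summable_vecs v" "\<rho> = mix v"
      using loop.prems(3) unfolding mixture_def by blast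
    have "tr B V (asrt [] \<circ> \<rho>) = tr B V (pull_op B V qs M0 F \<circ> \<rho>) + tr B V (pull_op B V qs M1 E \<circ> \<rho>)"
      unfolding v(2) loop.hyps(3) by (intro tr_mix_plus pull_op_bops loop.hyps FE v(1))
    also have "\<dots> = tr B V (F \<circ> ?\<sigma>0) + tr B V (E \<circ> ?\<sigma>1)"
      by (simp add: tr_pull_op loop.hyps(1,2) FE loop.prems(3))
    also have "\<dots> \<le> tr B V (D \<circ> ?\<sigma>0) + tr B V (asrt [Body] \<circ> ?\<sigma>1)"
      by (intro add_mono tr_below loop.hyps(4,5) mix)
    finally show ?thesis
      unfolding dominated_def 1 using \<A> mix by (intro exI[of _ M]) (auto simp: M_def)
  next
    case (2 p')
    from loop.prems(2) 2 obtain \<A>' where \<A>': "\<A> = image_mset (\<lambda>(R, \<sigma>). (seq_rest R ?W, \<sigma>)) \<A>'"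
      "config_step B V (Some (at_prog p' P), \<rho>) \<A>'" by (auto elim: config_step_SeqE)
    \<comment> \<open>A finished body returns to the loop, that is, to the path \<open>[]\<close>,
      whose assertion is the postcondition of the body.\<close>
    let ?f = "\<lambda>((R, \<sigma>), r). ((seq_rest R ?W, \<sigma>), if R = None then [] else Body # r)"
    have "dominated B V asrt ?W D (tr B V (asrt (Body # p') \<circ> \<rho>)) \<A>"
      unfolding \<A>'(1)
    proof (rule dominated_map[OF loop.IH[OF 2(2) \<A>'(2) loop.prems(3)], of _ ?f])
      fix c :: "('v, 'b) config \<times> dir list"
      assume "tracked P c"
      moreover obtain R \<sigma> r where "c = ((R, \<sigma>), r)" by (metis prod.collapse)
      ultimately show "tracked ?W (?f c) \<and> weight B V asrt D (?f c) =
          weight B V (\<lambda>p. asrt (Body # p)) (asrt []) c \<and> fst (?f c) = (\<lambda>(R, \<sigma>). (seq_rest R ?W, \<sigma>)) (fst c)"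
        by (cases R) auto
    qed
    then show ?thesis using 2 by (simp add: o_def)
  qed
qed

section \<open>Ensemble transitions as sequences of steps of single configurations\<close>

definition one_step :: "('v \<Rightarrow> 'b::zero set) \<Rightarrow> 'v set \<Rightarrow>
    ('v, 'b) config multiset \<Rightarrow> ('v, 'b) config multiset \<Rightarrow> bool" where
  "one_step B V \<A> \<B> \<longleftrightarrow> (\<exists>C \<C> \<D>. \<A> = add_mset C \<D> \<and> config_step B V C \<C> \<and> \<B> = \<D> + \<C>)"

lemma one_steps_add:
  assumes "(one_step B V)\<^sup>*\<^sup>* \<A> \<B>"
  shows "(one_step B V)\<^sup>*\<^sup>* (\<X> + \<A>) (\<X> + \<B>)"
  using assms
proof induction
  case (step \<B> \<C>)
  then obtain C \<D> \<E> where "\<B> = add_mset C \<D>" "config_step B V C \<E>" "\<C> = \<D> + \<E>"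
    unfolding one_step_def by blast
  then have "one_step B V (\<X> + \<B>) (\<X> + \<C>)"
    unfolding one_step_def by (intro exI[of _ C] exI[of _ \<E>] exI[of _ "\<X> + \<D>"]) auto
  with step.IH show ?case by simp
qed simp

lemma one_steps_sum:
  assumes "finite I" "\<forall>i\<in>I. (one_step B V)\<^sup>*\<^sup>* (\<A> i) (\<B> i)"
  shows "(one_step B V)\<^sup>*\<^sup>* (\<Sum>i\<in>I. \<A> i) (\<Sum>i\<in>I. \<B> i)"
  using assms
proof (induction I rule: finite_induct)
  case (insert i I)
  have "(one_step B V)\<^sup>*\<^sup>* (\<A> i + (\<Sum>i\<in>I. \<A> i)) (\<A> i + (\<Sum>i\<in>I. \<B> i))"
    using insert by (intro one_steps_add) auto
  also have "(one_step B V)\<^sup>*\<^sup>* (\<A> i + (\<Sum>i\<in>I. \<B> i)) (\<B> i + (\<Sum>i\<in>I. \<B> i))"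
    using insert.prems one_steps_add[of B V "\<A> i" "\<B> i" "\<Sum>i\<in>I. \<B> i"] by (simp add: add.commute)
  finally show ?case using insert.hyps by simp
qed simp

text \<open>Configurations evolve independently, so the simultaneous steps of \<open>MS2\<close> can
  be made one after another, with no step for the stuck parts. Preservation then has to be shown for
  one configuration only.\<close>

lemma ens_step_one_steps: "ens_step B V \<A> \<B> \<Longrightarrow> (one_step B V)\<^sup>*\<^sup>* \<A> \<B>"
proof (induction rule: ens_step.induct)
  case (MS1 C \<A>)
  then have "one_step B V {#C#} \<A>" unfolding one_step_def by (intro exI[of _ C] exI[of _ \<A>] exI[of _ "{#}"]) auto
  then show ?case by blast
next
  case (MS2 I\<^sub>0 I\<^sub>1 \<A> \<B>)
  then have "(one_step B V)\<^sup>*\<^sup>* (\<Sum>i\<in>I\<^sub>1. \<A> i) (\<Sum>i\<in>I\<^sub>1. \<B> i)" by (intro one_steps_sum) auto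
  from one_steps_add[OF this, of "\<Sum>i\<in>I\<^sub>0. \<A> i"] show ?case
    using MS2.hyps(1-3) by (simp add: sum.union_disjoint)
qed

text \<open>Only the moving configuration is replaced, by tagged successors whose total weight is at
  least its own; all other tags are kept.\<close>

lemma dominated_one_step:
  fixes B :: "'v \<Rightarrow> 'b::zero set"
  assumes B0: "\<And>q. 0 \<in> B q" and "verified B V asrt P D"
    and "dominated B V asrt P D w \<A>" "one_step B V \<A> \<B>"
  shows "dominated B V asrt P D w \<B>"
proof -
  obtain M where M: "image_mset fst M = \<A>" "\<forall>c\<in>#M. tracked P c" "w \<le> (\<Sum>c\<in>#M. weight B V asrt D c)"
    using assms(3) unfolding dominated_def by blast
  obtain C \<C> \<D> where C: "\<A> = add_mset C \<D>" "config_step B V C \<C>" "\<B> = \<D> + \<C>"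
    using assms(4) unfolding one_step_def by blast
  obtain c M' where c: "M = add_mset c M'" "fst c = C" "image_mset fst M' = \<D>"
    using msed_map_invR[of fst M C \<D>] M(1) C(1) by blast
  obtain R \<sigma> p where c_eq: "c = ((R, \<sigma>), p)" by (metis prod.collapse)
  have "R \<noteq> None" using C(2) c(2) c_eq by (auto elim: config_step.cases)
  moreover have "tracked P c" using M(2) c(1) by simp
  ultimately have R: "subprog P p \<noteq> None" "R = Some (at_prog p P)" "mixture \<sigma>"
    using c_eq by auto
  then have "dominated B V asrt P D (tr B V (asrt p \<circ> \<sigma>)) \<C>"
    using C(2) c(2) c_eq by (intro verified_step[OF B0 assms(2)]) auto
  then obtain N where N: "image_mset fst N = \<C>" "\<forall>c\<in>#N. tracked P c"
    "tr B V (asrt p \<circ> \<sigma>) \<le> (\<Sum>c\<in>#N. weight B V asrt D c)"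
    unfolding dominated_def by blast
  have "w \<le> (\<Sum>c\<in>#M'. weight B V asrt D c) + tr B V (asrt p \<circ> \<sigma>)"
    using M(3) c(1) c_eq R(2) by (simp add: add.commute)
  also have "\<dots> \<le> (\<Sum>c\<in>#M' + N. weight B V asrt D c)" using N(3) by (simp add: add_left_mono)
  finally show ?thesis
    unfolding dominated_def using M(2) c(1,3) C(3) N(1,2) by (intro exI[of _ "M' + N"]) auto
qed

lemma dominated_ens_steps:
  fixes B :: "'v \<Rightarrow> 'b::zero set"
  assumes B0: "\<And>q. 0 \<in> B q" and ver: "verified B V asrt P D"
    and "(ens_step B V)\<^sup>*\<^sup>* \<A> \<B>" "dominated B V asrt P D w \<A>"
  shows "dominated B V asrt P D w \<B>"
  using assms(3,4)
proof induction
  case (step \<B> \<C>)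
  from ens_step_one_steps[OF step.hyps(2)] step.IH[OF step.prems] show ?case
    by induction (blast intro: dominated_one_step[OF B0 ver])+
qed

text \<open>Turns tags on a multiset back into a function of the given indices. Equal configurations
  may carry different tags, so the function is chosen one index at a time.\<close>

lemma image_fst_mset_set:
  assumes "finite I" "image_mset fst M = {#f i. i \<in># mset_set I#}"
  shows "\<exists>T. M = {#(f i, T i). i \<in># mset_set I#}"
  using assms
proof (induction I arbitrary: M rule: finite_induct)
  case (insert i I)
  then obtain c M' where c: "M = add_mset c M'" "fst c = f i" "image_mset fst M' = {#f i. i \<in># mset_set I#}"
    using msed_map_invR[of fst M "f i" "{#f i. i \<in># mset_set I#}"] by auto
  then obtain T where T: "M' = {#(f i, T i). i \<in># mset_set I#}" using insert.IH by blast
  have "M' = {#(f j, (T(i := snd c)) j). j \<in># mset_set I#}"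
    unfolding T using insert.hyps by (intro image_mset_cong) auto
  moreover have "c = (f i, (T(i := snd c)) i)" using c(2) by (metis fun_upd_same prod.collapse)
  ultimately have "M = {#(f j, (T(i := snd c)) j). j \<in># mset_set (insert i I)#}"
    using c(1) insert.hyps by simp
  then show ?case by blast
qed simp

lemma finite_vars: "finite (vars P)"
proof (induction P)
  case (If qs bs)
  have "finite (vars (snd b))" if "b \<in> set bs" for b
    using If[of b "snd b"] that by (simp add: snds.simps)
  then show ?case by auto
qed auto

theorem theorem6p1:
  fixes B :: "'v \<Rightarrow> 'b::zero set"
    and P :: "('v, ('v, 'b) qop) prog"
    and a :: "('v, 'b) qop annot"
    and S :: "('v, ('v, 'b) qop) aprog"
    and D \<rho> :: "('v, 'b) qop"
    and I :: "'i set"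
    and R :: "'i \<Rightarrow> ('v, ('v, 'b) qop) prog option"
    and \<sigma> :: "'i \<Rightarrow> ('v, 'b) qop"
  assumes "\<And>q. countable (B q)" and "\<And>q. 0 \<in> B q"
    and "wf_prog B P"
    and "outline B (vars P) a S D" and "strip S = P" and "standard a S"
    and "\<rho> \<in> partial_density B (vars P)"
    and "finite I"
    and "(ens_step B (vars P))\<^sup>*\<^sup>* {#(Some P, \<rho>)#} {#(R i, \<sigma> i). i \<in># mset_set I#}"
  shows "\<exists>T :: 'i \<Rightarrow> dir list.
    (\<forall>i\<in>I. R i = None \<or> (subprog P (T i) \<noteq> None \<and> R i = Some (at_prog (T i) P))) \<and>
    tr B (vars P) (pred_of a \<circ> \<rho>)
      \<le> (\<Sum>i\<in>I. tr B (vars P) ((if R i = None then D else pre a S (T i)) \<circ> \<sigma> i))"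
proof -
  let ?V = "vars P"
  have "annotated B ?V [a] (pred_of a) S D"
    using outline_annotated[where B = B, OF assms(2,4)] assms(3,5) by simp
  then have ver: "verified B ?V (pre a S) P D"
    using annotated_verified[of B ?V "[a]" "pred_of a" S D] assms(5,6)
    by (auto simp: standard_def pre_def[abs_def])
  have "mixture \<rho>"
  proof (rule mixture_density[OF assms(7)])
    show "countable (PiE ?V B)" using finite_vars assms(1) by (rule countable_PiE)
    show "PiE ?V B \<noteq> {}" using assms(2) by (auto simp: PiE_eq_empty_iff)
  qed
  \<comment> \<open>At the path \<open>[]\<close> the block begins with \<open>a\<close> itself, so
    the bound holds with equality.\<close>
  then have "dominated B ?V (pre a S) P D (tr B ?V (pred_of a \<circ> \<rho>)) {#(Some P, \<rho>)#}"
    by (intro dominated_singleton[where p = "[]"]) (auto simp: pre_def)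
  from dominated_ens_steps[OF assms(2) ver assms(9) this]
  obtain M where M: "image_mset fst M = {#(R i, \<sigma> i). i \<in># mset_set I#}" "\<forall>c\<in>#M. tracked P c"
    "tr B ?V (pred_of a \<circ> \<rho>) \<le> (\<Sum>c\<in>#M. weight B ?V (pre a S) D c)"
    unfolding dominated_def by blast
  obtain T where T: "M = {#((R i, \<sigma> i), T i). i \<in># mset_set I#}"
    using image_fst_mset_set[OF assms(8) M(1)] by blast
  have "\<forall>i\<in>I. R i = None \<or> (subprog P (T i) \<noteq> None \<and> R i = Some (at_prog (T i) P))"
    using M(2) assms(8) unfolding T by auto
  moreover have "(\<Sum>c\<in>#M. weight B ?V (pre a S) D c) =
      (\<Sum>i\<in>I. tr B ?V ((if R i = None then D else pre a S (T i)) \<circ> \<sigma> i))"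
    unfolding T by (simp add: multiset.map_comp comp_def sum_unfold_sum_mset)
  ultimately show ?thesis using M(3) by (intro exI[of _ T]) (simp only: simp_thms)
qed

end
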